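(* Let $G_1,G_2$ be connected graphs with $G_1\subseteq G_2$. Then $f(G_1\cup G_2,P_5)=R_3(G_1\cup G_2)$.
   Context: $G_1\subseteq G_2$ means $G_1$ is a (not necessarily induced or spanning) subgraph of $G_2$; $G_1\cup G_2$ is the vertex-disjoint union. $P_5$ is the path on $5$ vertices. Monochromatic: all edges same color; rainbow: all edges distinct colors. $f(H,G)$ is the minimum $n$ such that every edge-coloring of $K_n$ with any number of colors contains a monochromatic copy of $H$ or a rainbow copy of $G$. $R_3(H)$ is the minimum $n$ such that every coloring of $E(K_n)$ with colors from $\{1,2,3\}$ (not all need be used) contains a monochromatic $H$. *)

theory Defs
  imports Main "HOL-Library.Ramsey"
begin

type_synonym 'a ugraph = "'a set \<times> 'a set set"

abbreviation verts :: "'a ugraph \<Rightarrow> 'a set" where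
  "verts G \<equiv> fst G"

abbreviation edges :: "'a ugraph \<Rightarrow> 'a set set" where
  "edges G \<equiv> snd G"

definition simple_graph :: "'a ugraph \<Rightarrow> bool" where
  "simple_graph G \<longleftrightarrow> finite (verts G) \<and> edges G \<subseteq> nsets (verts G) 2"

text \<open>The one-vertex graph is connected, the graph without vertices is not.\<close>

definition connected_graph :: "'a ugraph \<Rightarrow> bool" where
  "connected_graph G \<longleftrightarrow> simple_graph G \<and> verts G \<noteq> {} \<and>
     (\<forall>u\<in>verts G. \<forall>v\<in>verts G. (u, v) \<in> {(x, y). {x, y} \<in> edges G}\<^sup>*)"

definition complete_graph :: "nat \<Rightarrow> nat ugraph" where
  "complete_graph n = ({..<n}, nsets {..<n} 2)"

definition path_graph :: "nat \<Rightarrow> nat ugraph" where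
  "path_graph k = ({..<k}, {{i, Suc i} |i. Suc i < k})"

definition disjoint_union :: "'a ugraph \<Rightarrow> 'b ugraph \<Rightarrow> ('a + 'b) ugraph" where
  "disjoint_union G H =
     (verts G <+> verts H, (\<lambda>e. Inl ` e) ` edges G \<union> (\<lambda>e. Inr ` e) ` edges H)"

text \<open>\<open>embedding \<phi> G H\<close>: the image of \<open>G\<close> under \<open>\<phi>\<close> is a copy of \<open>G\<close> in \<open>H\<close>,
  not necessarily induced or spanning.\<close>

definition embedding :: "('a \<Rightarrow> 'b) \<Rightarrow> 'a ugraph \<Rightarrow> 'b ugraph \<Rightarrow> bool" where
  "embedding \<phi> G H \<longleftrightarrow> inj_on \<phi> (verts G) \<and> \<phi> ` verts G \<subseteq> verts H \<and>
     (\<forall>e\<in>edges G. \<phi> ` e \<in> edges H)"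

text \<open>The subgraph relation is understood up to isomorphism, so the two graphs
  may have different vertex types.\<close>

definition is_subgraph :: "'a ugraph \<Rightarrow> 'b ugraph \<Rightarrow> bool" where
  "is_subgraph G H \<longleftrightarrow> (\<exists>\<phi>. embedding \<phi> G H)"

definition has_monochromatic :: "nat \<Rightarrow> (nat set \<Rightarrow> nat) \<Rightarrow> 'a ugraph \<Rightarrow> bool" where
  "has_monochromatic n c H \<longleftrightarrow>
     (\<exists>\<phi>. embedding \<phi> H (complete_graph n) \<and> (\<exists>i. \<forall>e\<in>edges H. c (\<phi> ` e) = i))"

definition has_rainbow :: "nat \<Rightarrow> (nat set \<Rightarrow> nat) \<Rightarrow> 'a ugraph \<Rightarrow> bool" where
  "has_rainbow n c G \<longleftrightarrow>
     (\<exists>\<phi>. embedding \<phi> G (complete_graph n) \<and> inj_on (\<lambda>e. c (\<phi> ` e)) (edges G))"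

text \<open>Since \<open>complete_graph n\<close> has finitely many edges, colors in \<open>nat\<close> account for
  edge-colorings with any number of colors.\<close>

definition constrained_ramsey :: "'a ugraph \<Rightarrow> 'b ugraph \<Rightarrow> nat" where
  "constrained_ramsey H G =
     (LEAST n. \<forall>c :: nat set \<Rightarrow> nat. has_monochromatic n c H \<or> has_rainbow n c G)"

definition multicolor_ramsey :: "nat \<Rightarrow> 'a ugraph \<Rightarrow> nat" where
  "multicolor_ramsey k H =
     (LEAST n. \<forall>c :: nat set \<Rightarrow> nat.
        c ` edges (complete_graph n) \<subseteq> {1..k} \<longrightarrow> has_monochromatic n c H)"

end

theory Submission
  imports Defs
begin

text \<open>
  Both numbers are least elements of the same set: for every \<open>n\<close>, a colouring of \<open>K\<^sub>n\<close> without a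
  monochromatic \<open>G1 \<union> G2\<close> and without a rainbow \<open>P\<^sub>5\<close> can be replaced by one with three colours
  and no monochromatic \<open>G1 \<union> G2\<close>.

  A colouring with at least four colours and no rainbow \<open>P\<^sub>5\<close> on at least five vertices either
  belongs to one of four explicit families, which are recoloured by hand, or has a dominating
  colour \<open>d\<close>: the sets \<open>V\<^sub>j\<close> of vertices meeting colour \<open>j \<noteq> d\<close> are disjoint. In the latter case
  a connected graph in a union of colours \<open>j \<noteq> d\<close> lies in a single \<open>V\<^sub>j\<close>, so merging fails only if
  at least two of these colours contain \<open>G2\<close> and at least three contain \<open>G1\<close>. The copies then
  span a complete multipartite graph in colour \<open>d\<close>, whence \<open>G2\<close> has large chromatic number.
  This leaves room to discard the copies and to put their vertices back as small cliques
  separated by multipartite graphs of too few parts to contain \<open>G2\<close>.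
\<close>

section \<open>Colourings without a rainbow path on five vertices\<close>

text \<open>Rainbow paws (a triangle with a pendant edge) separate the two kinds of colourings:
  without one, four or more colours force a dominating colour; with one, a fifth vertex already pins
  down an exceptional family. The dominated case rests on two uses of the hypotheses. Connectivity
  turns a function that is constant along the edges of a colour into one that is constant on a copy,
  which keeps copies inside one piece of a recolouring. The embedding of \<open>G1\<close> into
  \<open>G2\<close> makes a colour that avoids \<open>G1\<close> avoid \<open>G2\<close>, and lets
  \<open>G1\<close> inherit every proper colouring of \<open>G2\<close>. If \<open>m\<close>
  disjoint sets V_j all contain \<open>G2\<close>, a proper m-colouring of \<open>G2\<close> would
  place both graphs in colour \<open>d\<close>; so m-partite colours are harmless in a recolouring.
  The gap is the case of exactly two sets containing \<open>G2\<close> and others containing only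
  \<open>G1\<close>: there \<open>G2\<close> may be 3-colourable and only bipartite colours are
  harmless. This forces a separate construction, whose clique sizes \<alpha> and \<beta> are
  balanced against the class sizes of a proper 3-colouring of \<open>G1\<close>.\<close>

locale rainbow_P5_free =
  fixes V :: "'v set" and w :: "'v \<Rightarrow> 'v \<Rightarrow> 'c"
  assumes sym: "w x y = w y x"
    and no_rainbow: "distinct [p, q, r, s, t] \<Longrightarrow> {p, q, r, s, t} \<subseteq> V \<Longrightarrow>
      \<not> distinct [w p q, w q r, w r s, w s t]"
begin

definition mono_off_vertex :: bool where
  "mono_off_vertex \<longleftrightarrow> (\<exists>a i. a \<in> V \<and> (\<forall>x\<in>V - {a}. \<forall>y\<in>V - {a}. x \<noteq> y \<longrightarrow> w x y = i))"

definition triangle_type :: bool where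
  "triangle_type \<longleftrightarrow> (\<exists>a b d i. distinct [a, b, d] \<and> {a, b, d} \<subseteq> V \<and>
     distinct [w a b, w a d, w b d, i] \<and>
     (\<forall>x\<in>V - {a, b, d}. w a x \<in> {i, w b d} \<and> w b x = i \<and> w d x = i \<and>
        (\<forall>y\<in>V - {a, b, d}. x \<noteq> y \<longrightarrow> w x y = i)))"

text \<open>Each of the three perfect matchings on \<open>a\<close>, \<open>b\<close>,
  \<open>d\<close>, \<open>e\<close> may mix the background colour \<open>i\<close> with one private
  colour: \<open>j\<close>, \<open>k\<close> or \<open>l\<close>.\<close>

definition K4_type :: bool where
  "K4_type \<longleftrightarrow> (\<exists>a b d e i j k l. distinct [a, b, d, e] \<and> {a, b, d, e} \<subseteq> V \<and> distinct [i, j, k, l] \<and>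
     w a b \<in> {i, j} \<and> w d e \<in> {i, j} \<and> w a d \<in> {i, k} \<and> w b e \<in> {i, k} \<and>
     w a e \<in> {i, l} \<and> w b d \<in> {i, l} \<and>
     (\<forall>x\<in>V - {a, b, d, e}. \<forall>y\<in>V. x \<noteq> y \<longrightarrow> w x y = i))"

text \<open>The proper 3-edge-colouring of K4 with one vertex doubled into the twins
  \<open>e\<close>, \<open>f\<close>, and a fourth colour on the pair of twins.\<close>

definition K5_type :: bool where
  "K5_type \<longleftrightarrow> (\<exists>a b d e f. distinct [a, b, d, e, f] \<and> V = {a, b, d, e, f} \<and>
     w a e = w a f \<and> w b d = w a f \<and> w b e = w b f \<and> w a d = w b f \<and>
     w d e = w d f \<and> w a b = w d f \<and> distinct [w a f, w b f, w d f, w e f])"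

section \<open>Small patterns that determine the whole colouring\<close>

lemmas expand = distinct.simps list.set insert_iff empty_iff insert_subset Diff_iff mem_Collect_eq

lemma no_rainbow':
  "distinct [p, q, r, s, t] \<Longrightarrow> p \<in> V \<Longrightarrow> q \<in> V \<Longrightarrow> r \<in> V \<Longrightarrow> s \<in> V \<Longrightarrow> t \<in> V \<Longrightarrow>
    w p q = w q r \<or> w p q = w r s \<or> w p q = w s t \<or> w q r = w r s \<or> w q r = w s t \<or> w r s = w s t"
  using no_rainbow[of p q r s t] by auto

text \<open>For a further vertex \<open>u\<close>, each of three paths with end edge
  \<open>u p\<close> uses three distinct colours elsewhere. The colour of the triangle
  \<open>p q r\<close> is the only one common to all three paths, so \<open>u p\<close> has it.
  Pairs of further vertices are handled in the same way.\<close>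

lemma star_base:
  assumes d: "distinct [a, p, q, r]" and V: "{a, p, q, r} \<subseteq> V"
    and col: "distinct [w a p, w a q, w a r, w p q]" "w q r = w p q" "w p r = w p q"
  shows mono_off_vertex
proof -
  have one: "w u p = w p q"
    if d: "distinct [a, p, q, r, u]" and V: "{a, p, q, r, u} \<subseteq> V"
      and col: "distinct [w a p, w a q, w a r, w p q]" "w q r = w p q" "w p r = w p q" for u p q r
    using no_rainbow'[of u p q a r] no_rainbow'[of q r a p u] no_rainbow'[of r q a p u]
      sym d V col unfolding expand by (smt (verit))+
  have outer: "w u p = w p q \<and> w u q = w p q \<and> w u r = w p q" if "u \<in> V - {a, p, q, r}" for u
    using one[of p q r u] one[of q p r u] one[of r q p u] sym that d V col
    unfolding expand by (smt (verit))+
  have outer2: "w u v = w p q" if "u \<in> V - {a, p, q, r}" "v \<in> V - {a, p, q, r}" "u \<noteq> v" for u v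
    using no_rainbow'[of v u p a q] no_rainbow'[of v u q a r] no_rainbow'[of v u r a p] outer[of u]
      sym that d V col unfolding expand by (smt (verit))+
  have "w x y = w p q" if "x \<in> V - {a}" "y \<in> V - {a}" "x \<noteq> y" for x y
    using outer[of x] outer[of y] outer2[of x y] sym col sym that
    unfolding expand by (smt (verit))+
  then show ?thesis
    unfolding mono_off_vertex_def using V by blast
qed

text \<open>Three paths start with \<open>y x\<close>, continue to \<open>b\<close> or
  \<open>d\<close> and traverse two sides of the triangle; the colours on their remaining edges have
  only \<open>i\<close> in common.\<close>

lemma apex_pair:
  assumes "distinct [a, b, d, x, y]" and "{a, b, d, x, y} \<subseteq> V"
    and "distinct [w a b, w a d, w b d, i]" and "w x b = i" "w x d = i"
  shows "w x y = i"
  using no_rainbow'[of y x b a d] no_rainbow'[of y x b d a] no_rainbow'[of y x d b a] assms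
    sym unfolding expand by (smt (verit))+

text \<open>The seed of the triangle family in which both known outer vertices deviate at
  \<open>a\<close>, so that neither is the apex that \<open>triangle_apex_base\<close> asks
  for.\<close>

lemma triangle_double_base:
  assumes d: "distinct [a, b, d, u, v]" and V: "{a, b, d, u, v} \<subseteq> V"
    and ne: "distinct [w a b, w a d, w b d, i]"
    and j: "w a u = w b d" "w a v = w b d"
    and i: "w b u = i" "w b v = i" "w d u = i" "w d v = i" "w u v = i"
  shows triangle_type
proof -
  have one: "w b x = i"
    if "distinct [a, b, d, u, v, x]" "{a, b, d, u, v, x} \<subseteq> V" "distinct [w a b, w a d, w b d, i]"
      "w a u = w b d" "w b u = i" "w d u = i" "w u v = i" for b d x
    using no_rainbow'[of x b a d u] no_rainbow'[of x b u a d] no_rainbow'[of x b a u v] that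
      sym unfolding expand by (smt (verit))+
  have ax: "w a x \<in> {i, w b d}" if "x \<in> V - {a, b, d, u, v}" for x
    using no_rainbow'[of x a b d u] no_rainbow'[of x a d b u] d V ne i that sym unfolding expand by (smt (verit))+
  have main: "w a x \<in> {i, w b d} \<and> w b x = i \<and> w d x = i" if "x \<in> V - {a, b, d}" for x
  proof (cases "x \<in> {u, v}")
    case True
    then show ?thesis using i j by auto
  next
    case False
    then show ?thesis
      using ax[of x] one[of b d x] one[of d b x] that d V ne j i sym unfolding expand by (smt (verit))+
  qed
  have "w x y = i" if "x \<in> V - {a, b, d}" "y \<in> V - {a, b, d}" "x \<noteq> y" for x y
    using apex_pair[of a b d x y i] main[of x] that d V ne sym unfolding expand by (smt (verit))+
  then show ?thesis
    unfolding triangle_type_def using main d V ne by (intro exI[of _ a] exI[of _ b] exI[of _ d] exI[of _ i]) auto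
qed

text \<open>An edge from outside to a vertex of the triangle has colour \<open>i\<close> or the
  colour of the opposite side. If \<open>x\<close> deviates from \<open>i\<close> at
  \<open>a\<close> and \<open>y\<close> at \<open>b\<close>, then \<open>x a b y u\<close> is
  rainbow unless \<open>x = y\<close>. So either all deviations sit at one outer vertex
  \<open>e\<close>, which gives the K4 family, or they all concern one vertex of the
  triangle.\<close>

lemma triangle_apex_base:
  assumes d: "distinct [a, b, d, u]" and V: "{a, b, d, u} \<subseteq> V"
    and ne: "distinct [w a b, w a d, w b d, i]"
    and i: "w a u = i" "w b u = i" "w d u = i"
  shows "triangle_type \<or> K4_type"
proof -
  let ?O = "V - {a, b, d}"
  have one: "w x a \<in> {i, w b d}"
    if "distinct [a, b, d, u]" "{a, b, d, u} \<subseteq> V" "distinct [w a b, w a d, w b d, i]"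
      "w a u = i" "w b u = i" "w d u = i" "x \<in> V - {a, b, d}" for a b d x
  proof (cases "x = u")
    case False
    then show ?thesis
      using no_rainbow'[of x a b d u] no_rainbow'[of x a d b u] that sym unfolding expand by (smt (verit))+
  qed (use that sym in auto)
  have two: "x = y"
    if "distinct [a, b, d, u]" "{a, b, d, u} \<subseteq> V" "distinct [w a b, w a d, w b d, i]"
      "w a u = i" "w b u = i" "w d u = i" "x \<in> V - {a, b, d}" "y \<in> V - {a, b, d}"
      "w x a \<noteq> i" "w y b \<noteq> i" for a b d x y
  proof (rule ccontr)
    assume "x \<noteq> y"
    moreover have "x \<noteq> u" "y \<noteq> u" using that sym by auto
    moreover have "w x a = w b d" "w y b = w a d"
      using one[of a b d x] one[of b a d y] that sym unfolding expand by (smt (verit))+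
    moreover have "w u y = i"
      using apex_pair[of a b d u y i] \<open>y \<noteq> u\<close> that sym unfolding expand by (smt (verit))+
    ultimately show False
      using no_rainbow'[of x a b y u] that sym unfolding expand by (smt (verit))+
  qed
  have tri: triangle_type
    if "distinct [a, b, d, u]" "{a, b, d, u} \<subseteq> V" "distinct [w a b, w a d, w b d, i]"
      "w a u = i" "w b u = i" "w d u = i" "\<And>x. x \<in> V - {a, b, d} \<Longrightarrow> w x b = i \<and> w x d = i" for a b d
  proof -
    have 1: "w x y = i" if "x \<in> V - {a, b, d}" "y \<in> V - {a, b, d}" "x \<noteq> y" for x y
      using apex_pair[of a b d x y i] that \<open>\<And>x. x \<in> V - {a, b, d} \<Longrightarrow> w x b = i \<and> w x d = i\<close>[of x]
        \<open>distinct [a, b, d, u]\<close> \<open>{a, b, d, u} \<subseteq> V\<close> \<open>distinct [w a b, w a d, w b d, i]\<close>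
      unfolding expand by (smt (verit))
    have 2: "w a x \<in> {i, w b d}" "w b x = i" "w d x = i" if "x \<in> V - {a, b, d}" for x
      using one[of a b d x] that \<open>\<And>x. x \<in> V - {a, b, d} \<Longrightarrow> w x b = i \<and> w x d = i\<close>[of x]
        \<open>distinct [a, b, d, u]\<close> \<open>{a, b, d, u} \<subseteq> V\<close> \<open>distinct [w a b, w a d, w b d, i]\<close>
        \<open>w a u = i\<close> \<open>w b u = i\<close> \<open>w d u = i\<close> sym
      unfolding expand by (smt (verit))+
    show ?thesis
      unfolding triangle_type_def
      by (rule exI[of _ a], rule exI[of _ b], rule exI[of _ d], rule exI[of _ i])
        (use 1 2 that(1-3) in auto)
  qed
  define N where "N v = {x \<in> ?O. w x v \<noteq> i}" for v
  have ins: "{b, a, d} = {a, b, d}" "{d, a, b} = {a, b, d}" "{d, b, a} = {a, b, d}" "{a, d, b} = {a, b, d}" "{b, d, a} = {a, b, d}"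
    by auto
  have Nab: "x = y" if "x \<in> N a" "y \<in> N b" for x y
    using two[of a b d x y] that d V ne i unfolding N_def by blast
  have Nad: "x = y" if "x \<in> N a" "y \<in> N d" for x y
    using two[of a d b x y] that d V ne i sym unfolding N_def ins unfolding expand by (smt (verit))+
  have Nbd: "x = y" if "x \<in> N b" "y \<in> N d" for x y
    using two[of b d a x y] that d V ne i sym unfolding N_def ins unfolding expand by (smt (verit))+
  show ?thesis
  proof (cases "\<exists>e\<in>?O. N a \<union> N b \<union> N d \<subseteq> {e}")
    case True
    then obtain e where e: "e \<in> ?O" "N a \<union> N b \<union> N d \<subseteq> {e}" by blast
    have triv: "w x a = i \<and> w x b = i \<and> w x d = i" if "x \<in> ?O" "x \<noteq> e" for x
      using e that unfolding N_def by blast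
    have out: "w x y = i" if x: "x \<in> V - {a, b, d, e}" and y: "y \<in> V" "x \<noteq> y" for x y
    proof (cases "y \<in> {a, b, d}")
      case True
      then show ?thesis using triv[of x] x by auto
    next
      case False
      then show ?thesis using apex_pair[of a b d x y i] triv[of x] x y V d ne unfolding expand by (smt (verit))+
    qed
    have ee: "w e a \<in> {i, w b d}" "w e b \<in> {i, w a d}" "w e d \<in> {i, w a b}"
      using one[of a b d e] one[of b a d e] one[of d a b e] e(1) d V ne i sym
      unfolding expand by (smt (verit))+
    have "w d e \<in> {i, w a b}" "w b e \<in> {i, w a d}" "w a e \<in> {i, w b d}"
      using ee by (simp_all add: sym[of d e] sym[of b e] sym[of a e])
    moreover have "distinct [a, b, d, e]" "{a, b, d, e} \<subseteq> V" "distinct [i, w a b, w a d, w b d]"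
      using d V ne e(1) by auto
    ultimately have K4_type
      unfolding K4_type_def
      by - (rule exI[of _ a], rule exI[of _ b], rule exI[of _ d], rule exI[of _ e], rule exI[of _ i],
          rule exI[of _ "w a b"], rule exI[of _ "w a d"], rule exI[of _ "w b d"],
          (intro conjI ballI impI; (assumption | rule out | simp only: insert_iff simp_thms)?; assumption?))
    then show ?thesis ..
  next
    case False
    have "u \<in> ?O" using d V by auto
    with False obtain x where x: "x \<in> N a \<union> N b \<union> N d" by blast
    then have "x \<in> ?O" unfolding N_def by blast
    with False obtain y where y: "y \<in> N a \<union> N b \<union> N d" "y \<noteq> x" by blast
    have "(N b = {} \<and> N d = {}) \<or> (N a = {} \<and> N d = {}) \<or> (N a = {} \<and> N b = {})"
      using x y Nab Nad Nbd by blast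
    then show ?thesis
    proof (elim disjE conjE)
      assume "N b = {}" "N d = {}"
      then show ?thesis using tri[of a b d] d V ne i unfolding N_def by blast
    next
      assume N: "N a = {}" "N d = {}"
      have "w x a = i \<and> w x d = i" if "x \<in> V - {b, a, d}" for x
        using N that unfolding N_def ins by blast
      then show ?thesis using tri[of b a d] d V ne i sym[of b a] by auto
    next
      assume N: "N a = {}" "N b = {}"
      have "w x a = i \<and> w x b = i" if "x \<in> V - {d, a, b}" for x
        using N that unfolding N_def ins by blast
      then show ?thesis using tri[of d a b] d V ne i sym[of d a] sym[of d b] by auto
    qed
  qed
qed

text \<open>Each of four paths ending in \<open>e x\<close> uses three of the four colours before
  its last edge, and every colour is missed by exactly one of them; hence a sixth vertex
  \<open>x\<close> has no colour left for \<open>e x\<close>.\<close>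

lemma K5_base:
  assumes d: "distinct [a, b, d, e, f]" and V: "{a, b, d, e, f} \<subseteq> V"
    and col: "w a e = w a f" "w b d = w a f" "w b e = w b f" "w a d = w b f" "w d e = w d f" "w a b = w d f"
      "distinct [w a f, w b f, w d f, w e f]"
  shows K5_type
proof -
  have "V = {a, b, d, e, f}"
  proof (rule ccontr)
    assume "V \<noteq> {a, b, d, e, f}"
    then obtain x where "x \<in> V" "x \<notin> {a, b, d, e, f}" using V by auto
    then show False
      using no_rainbow'[of f d a e x] no_rainbow'[of d a f e x] no_rainbow'[of b d f e x]
        no_rainbow'[of a b f e x] sym d V col unfolding expand by (smt (verit))+
  qed
  then show ?thesis unfolding K5_type_def using d col by blast
qed

section \<open>Rainbow paws\<close>

definition has_rainbow_paw :: bool where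
  "has_rainbow_paw \<longleftrightarrow> (\<exists>x y z t. distinct [x, y, z, t] \<and> {x, y, z, t} \<subseteq> V \<and>
     distinct [w x y, w y z, w z x, w z t])"

lemma has_rainbow_pawI:
  "distinct [x, y, z, t] \<Longrightarrow> {x, y, z, t} \<subseteq> V \<Longrightarrow> distinct [w x y, w y z, w z x, w z t] \<Longrightarrow> has_rainbow_paw"
  unfolding has_rainbow_paw_def by blast

text \<open>The listed paths leave ten patterns for the edges that are still free. In
  \<open>c0\<close> there is a rainbow star on a monochromatic triangle, in \<open>c1\<close> to
  \<open>c4\<close> a rainbow triangle with an apex joined to it in one further colour, in
  \<open>c5\<close> to \<open>c8\<close> a rainbow triangle with two deviating vertices;
  \<open>c9\<close> is the five-vertex colouring.\<close>

lemma paw_structure: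
  assumes d: "distinct [x, y, z, t, u]" and V: "{x, y, z, t, u} \<subseteq> V"
    and paw: "distinct [w x y, w y z, w z x, w z t]"
  shows "mono_off_vertex \<or> triangle_type \<or> K4_type \<or> K5_type"
proof -
  note s = sym[of y x] sym[of z y] sym[of x z] sym[of t z] sym[of t x] sym[of t y] sym[of u x] sym[of u y] sym[of u z] sym[of u t]
  consider
      (c0) "w x y = w y t \<and> w x y = w x t \<and> distinct [w z x, w y z, w z t, w x y]" |
      (c1) "w y u = w z u \<and> w y u = w t u \<and> distinct [w y z, w y t, w z t, w y u]" |
      (c2) "w x u = w z u \<and> w x u = w t u \<and> distinct [w z x, w x t, w z t, w x u]" |
      (c3) "w x u = w y u \<and> w x u = w z u \<and> distinct [w x y, w z x, w y z, w x u]" |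
      (c4) "w x t = w y t \<and> w x t = w z t \<and> distinct [w x y, w z x, w y z, w x t]" |
      (c5) "w y t = w z x \<and> w y t = w z u \<and> w x y = w y u \<and> w x y = w x t \<and> w x y = w t u \<and> w x y = w x u \<and> distinct [w y z, w z t, w y t, w x y]" |
      (c6) "w x t = w y z \<and> w x t = w z u \<and> w x y = w x u \<and> w x y = w y t \<and> w x y = w t u \<and> w x y = w y u \<and> distinct [w z x, w z t, w x t, w x y]" |
      (c7) "w y z = w x t \<and> w y z = w x u \<and> w y t = w y u \<and> w y t = w z t \<and> w y t = w z u \<and> w y t = w t u \<and> distinct [w x y, w z x, w y z, w y t]" |
      (c8) "w z x = w y t \<and> w z x = w y u \<and> w x t = w x u \<and> w x t = w z t \<and> w x t = w z u \<and> w x t = w t u \<and> distinct [w x y, w y z, w z x, w x t]" |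
      (c9) "w z x = w x t \<and> w z x = w y u \<and> w y z = w y t \<and> w y z = w x u \<and> w z u = w t u \<and> w z u = w x y \<and> distinct [w z x, w y z, w z u, w z t]"
    using paw d V s
    no_rainbow'[of x u z y t] no_rainbow'[of y x z t u] no_rainbow'[of x t z y u] no_rainbow'[of y u z x t]
    no_rainbow'[of t y z x u] no_rainbow'[of z x y t u] no_rainbow'[of y u x z t] no_rainbow'[of t z x y u]
    no_rainbow'[of x y t z u] no_rainbow'[of z t x y u] no_rainbow'[of y x t z u] no_rainbow'[of x z y u t]
    no_rainbow'[of y z x t u] no_rainbow'[of y t x u z] no_rainbow'[of y t z x u] no_rainbow'[of t z y x u]
    no_rainbow'[of x z y t u] no_rainbow'[of z x u y t] no_rainbow'[of x y z u t] no_rainbow'[of x y z t u]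
    no_rainbow'[of x u t y z] no_rainbow'[of x u y z t] no_rainbow'[of t y x z u] no_rainbow'[of z t y x u]
    no_rainbow'[of z y x t u]
    unfolding expand by (smt (verit))
  then show ?thesis
  proof cases
    case c0
    then show ?thesis using star_base[of z x y t] d V s unfolding expand by (smt (verit))
  next
    case c1
    then show ?thesis using triangle_apex_base[of y z t u "w y u"] d V s unfolding expand by (smt (verit))
  next
    case c2
    then show ?thesis using triangle_apex_base[of x z t u "w x u"] d V s unfolding expand by (smt (verit))
  next
    case c3
    then show ?thesis using triangle_apex_base[of x y z u "w x u"] d V s unfolding expand by (smt (verit))
  next
    case c4
    then show ?thesis using triangle_apex_base[of x y z t "w x t"] d V s unfolding expand by (smt (verit))
  next
    case c5
    then show ?thesis using triangle_double_base[of z y t x u "w x y"] d V s unfolding expand by (smt (verit))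
  next
    case c6
    then show ?thesis using triangle_double_base[of z x t y u "w x y"] d V s unfolding expand by (smt (verit))
  next
    case c7
    then show ?thesis using triangle_double_base[of x y z t u "w y t"] d V s unfolding expand by (smt (verit))
  next
    case c8
    then show ?thesis using triangle_double_base[of y x z t u "w x t"] d V s unfolding expand by (smt (verit))
  next
    case c9
    then show ?thesis using K5_base[of x y u z t] d V s unfolding expand by (smt (verit))
  qed
qed

text \<open>Without a rainbow paw, an edge between two leaves has the colour of the spoke to one of
  its ends, since any other colour differs from one of the two remaining spokes. Orient the edge
  towards that end. Any three leaves then carry a directed path \<open>p q r\<close>, and
  \<open>s k p q r\<close> is rainbow.\<close>

lemma star_paw:
  assumes d: "distinct [k, p, q, r, s]" and V: "{k, p, q, r, s} \<subseteq> V"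
    and "distinct [w k p, w k q, w k r, w k s]"
  shows has_rainbow_paw
proof (rule ccontr)
  assume no: "\<not> has_rainbow_paw"
  have edge: "w p q = w k p \<or> w p q = w k q"
    if "distinct [k, p, q, r, s]" "{k, p, q, r, s} \<subseteq> V" "distinct [w k p, w k q, w k r, w k s]" for p q r s
    using has_rainbow_pawI[of p q k r] has_rainbow_pawI[of p q k s] no that sym[of q k] unfolding expand by (smt (verit))
  show False
    using assms edge[of p q r s] edge[of p r q s] edge[of p s q r] edge[of q r p s] edge[of q s p r] edge[of r s p q]
      no_rainbow'[of s k p q r] no_rainbow'[of s k q p r] no_rainbow'[of s k p r q] no_rainbow'[of s k r p q]
      no_rainbow'[of s k q r p] no_rainbow'[of s k r q p]
      no_rainbow'[of r k p q s] no_rainbow'[of r k p s q] no_rainbow'[of q k p s r] no_rainbow'[of q k p r s]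
      no_rainbow'[of r k s p q] no_rainbow'[of r k s q p] no_rainbow'[of p k s q r] no_rainbow'[of p k s r q]
      no_rainbow'[of p k q s r] no_rainbow'[of p k q r s] no_rainbow'[of p k r s q] no_rainbow'[of p k r q s]
      sym unfolding expand by (smt (verit))
qed

text \<open>Without a rainbow paw, two paws and the path \<open>q k p r s\<close> force
  \<open>p r\<close> to repeat the colour of \<open>k p\<close>, and likewise \<open>q r\<close>
  that of \<open>k q\<close>. Then \<open>r\<close> is the centre of a rainbow star with leaves
  \<open>k\<close>, \<open>p\<close>, \<open>q\<close>, \<open>s\<close>.\<close>

lemma chair_paw:
  assumes d: "distinct [k, p, q, r, s]" and V: "{k, p, q, r, s} \<subseteq> V"
    and "distinct [w k p, w k q, w k r, w r s]"
  shows has_rainbow_paw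
proof (rule ccontr)
  assume no: "\<not> has_rainbow_paw"
  have edge: "w p r = w k p"
    if "distinct [k, p, q, r, s]" "{k, p, q, r, s} \<subseteq> V" "distinct [w k p, w k q, w k r, w r s]" for p q
    using has_rainbow_pawI[of p r k q] has_rainbow_pawI[of k p r s] no_rainbow'[of q k p r s] no that
      sym[of r k] sym[of q k] sym[of p r] sym[of r p] unfolding expand by (smt (verit))
  show False
    using star_paw[of r k p q s] edge[of p q] edge[of q p] sym no assms unfolding expand by (smt (verit))
qed

text \<open>A diagonal repeats at most one of the four colours, so one of the two triangles at it is
  rainbow. Of the two edges on the other side at least one differs from the diagonal and serves as
  the pendant edge.\<close>

lemma C4_paw:
  assumes d: "distinct [k, p, q, r]" and V: "{k, p, q, r} \<subseteq> V"
    and "distinct [w k p, w p q, w q r, w r k]"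
  shows has_rainbow_paw
  using has_rainbow_pawI[of k p q r] has_rainbow_pawI[of p q k r] has_rainbow_pawI[of q r k p]
    has_rainbow_pawI[of r k q p] assms sym unfolding expand by (smt (verit))

text \<open>The cases are the ways in which the two paths can share vertices. Each leads to a
  rainbow star, chair, 4-cycle or paw, or to a rainbow path on five vertices.\<close>

lemma cherries_paw:
  assumes "distinct [x, y, z]" and "{x, y, z} \<subseteq> V" and "distinct [x', y', z']" and "{x', y', z'} \<subseteq> V"
    and "distinct [w x y, w y z, w x' y', w y' z']"
  shows has_rainbow_paw
proof -
  note a = assms
  consider "y' = y" | "y' = x" | "y' = z" | "y' \<notin> {x, y, z}" by blast
  then show ?thesis
  proof cases
    case 1
    then show ?thesis
      using star_paw[of y x z x' z'] a sym unfolding expand by (smt (verit))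
  next
    case 2
    then show ?thesis
      using chair_paw[of x x' z' y z] has_rainbow_pawI[of y z x z'] has_rainbow_pawI[of y z x x'] a sym
      unfolding expand by (smt (verit))
  next
    case 3
    then show ?thesis
      using chair_paw[of z x' z' y x] has_rainbow_pawI[of y x z z'] has_rainbow_pawI[of y x z x'] a sym
      unfolding expand by (smt (verit))
  next
    case y': 4
    consider "x' = y" | "z' = y" | "x' \<noteq> y" "z' \<noteq> y" by blast
    then show ?thesis
    proof cases
      case 1
      then show ?thesis
        using y' chair_paw[of y x z y' z'] has_rainbow_pawI[of y' x y z] has_rainbow_pawI[of y' z y x] a sym
        unfolding expand by (smt (verit))
    next
      case 2
      then show ?thesis
        using y' chair_paw[of y x z y' x'] has_rainbow_pawI[of y' x y z] has_rainbow_pawI[of y' z y x] a sym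
        unfolding expand by (smt (verit))
    next
      case 3
      consider "x' = x" | "x' = z" | "z' = x" | "z' = z" | "{x', z'} \<inter> {x, z} = {}" by blast
      then show ?thesis
      proof cases
        case 1
        then show ?thesis
          using y' 3 C4_paw[of x y z y'] no_rainbow'[of z y x y' z'] a sym unfolding expand by (smt (verit))
      next
        case 2
        then show ?thesis
          using y' 3 C4_paw[of x y z y'] no_rainbow'[of x y z y' z'] a sym unfolding expand by (smt (verit))
      next
        case 3
        then show ?thesis
          using y' \<open>x' \<noteq> y\<close> C4_paw[of x y z y'] no_rainbow'[of z y x y' x'] a sym unfolding expand by (smt (verit))
      next
        case 4
        then show ?thesis
          using y' 3 C4_paw[of x y z y'] no_rainbow'[of x y z y' x'] a sym unfolding expand by (smt (verit))
      next
        case 5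
        then have "distinct [x, y, z, x', y', z']" using y' 3 a by auto
        then show ?thesis
          using chair_paw[of y x z y' x'] chair_paw[of y x z y' z'] chair_paw[of y' x' z' y x] chair_paw[of y' x' z' y z]
            a sym unfolding expand by (smt (verit))
      qed
    qed
  qed
qed

definition dominated_by :: "'c \<Rightarrow> bool" where
  "dominated_by i \<longleftrightarrow> (\<forall>x\<in>V. \<forall>y\<in>V. \<forall>z\<in>V. distinct [x, y, z] \<longrightarrow> w x y = i \<or> w y z = i \<or> w x y = w y z)"

text \<open>The pairs of colours meeting at a vertex form a connected graph on the set of colours. Unless
  it is a star, whose centre is then a dominating colour, it has two disjoint edges.\<close>

lemma dominated_or_paw:
  assumes many: "\<And>p q r. \<exists>x\<in>V. \<exists>y\<in>V. x \<noteq> y \<and> w x y \<notin> {p, q, r}"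
  shows "(\<exists>i. dominated_by i) \<or> has_rainbow_paw"
proof (rule ccontr)
  assume "\<not> ?thesis"
  then have nodom: "\<And>i. \<not> dominated_by i" and nopaw: "\<not> has_rainbow_paw" by auto
  define adj where "adj p q \<longleftrightarrow> p \<noteq> q \<and> (\<exists>x y z. distinct [x, y, z] \<and> {x, y, z} \<subseteq> V \<and> w x y = p \<and> w y z = q)" for p q
  have adjI: "adj (w x y) (w y z)" if "distinct [x, y, z]" "{x, y, z} \<subseteq> V" "w x y \<noteq> w y z" for x y z
    using that unfolding adj_def by blast
  have meet: "r \<in> {p, q} \<or> s \<in> {p, q}" if "adj p q" "adj r s" for p q r s
  proof (rule ccontr)
    assume "\<not> ?thesis"
    moreover obtain x y z where "distinct [x, y, z]" "{x, y, z} \<subseteq> V" "w x y = p" "w y z = q" "p \<noteq> q"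
      using \<open>adj p q\<close> unfolding adj_def by blast
    moreover obtain x' y' z' where "distinct [x', y', z']" "{x', y', z'} \<subseteq> V" "w x' y' = r" "w y' z' = s" "r \<noteq> s"
      using \<open>adj r s\<close> unfolding adj_def by blast
    ultimately show False
      using cherries_paw[of x y z x' y' z'] nopaw by auto
  qed
  have has_adj: "\<exists>t. adj (w x y) t" if xy: "x \<in> V" "y \<in> V" "x \<noteq> y" for x y
  proof -
    obtain z v where zv: "z \<in> V" "v \<in> V" "z \<noteq> v" "w z v \<noteq> w x y"
      using many[of "w x y" "w x y" "w x y"] by auto
    show ?thesis
    proof (rule ccontr)
      assume "\<not> ?thesis"
      then have "\<And>t. \<not> adj (w x y) t" by blast
      then show False
        using adjI[of x y z] adjI[of y z v] adjI[of y x z] adjI[of y x v] adjI[of x y v] zv xy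
          sym[of y x] sym[of z v] empty_subsetI[of V]
        unfolding expand by metis
    qed
  qed
  have other: "\<exists>r s. adj r s \<and> r \<noteq> i \<and> s \<noteq> i" for i
    using nodom[of i] adjI unfolding dominated_by_def by fastforce
  obtain p q where pq: "adj p q" using other by blast
  obtain r s where "adj r s" "r \<noteq> p" "s \<noteq> p" using other by blast
  moreover obtain r' s' where "adj r' s'" "r' \<noteq> q" "s' \<noteq> q" using other by blast
  moreover have ne: "a \<noteq> b" if "adj a b" for a b using that unfolding adj_def by blast
  \<comment> \<open>Pairs that meet pairwise without a common element form a triangle on three
    colours \<open>p\<close>, \<open>q\<close>, \<open>m\<close>. A fourth colour belongs to some
    pair as well, and that pair misses one side of the triangle.\<close>
  ultimately have "\<exists>m. m \<noteq> p \<and> m \<noteq> q \<and> (adj q m \<or> adj m q) \<and> (adj p m \<or> adj m p)"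
    using meet[of p q r s] meet[of p q r' s'] meet[of r s r' s'] pq by auto
  then obtain m where m: "m \<noteq> p" "m \<noteq> q" "adj q m \<or> adj m q" "adj p m \<or> adj m p" by blast
  obtain x y where xy: "x \<in> V" "y \<in> V" "x \<noteq> y" "w x y \<notin> {p, q, m}" using many[of p q m] by blast
  then obtain t where "adj (w x y) t" using has_adj by blast
  then show False
    using xy m pq meet[of "w x y" t] ne[of p q] by auto
qed

theorem rainbow_P5_free_structure:
  assumes "finite V" "5 \<le> card V"
    and many: "\<And>p q r. \<exists>x\<in>V. \<exists>y\<in>V. x \<noteq> y \<and> w x y \<notin> {p, q, r}"
  shows "(\<exists>i. dominated_by i) \<or> mono_off_vertex \<or> triangle_type \<or> K4_type \<or> K5_type"
proof (cases has_rainbow_paw)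
  case True
  then obtain x y z t where p: "distinct [x, y, z, t]" "{x, y, z, t} \<subseteq> V" "distinct [w x y, w y z, w z x, w z t]"
    unfolding has_rainbow_paw_def by blast
  have "card {x, y, z, t} = 4" using p(1) by simp
  then have "V - {x, y, z, t} \<noteq> {}"
    using assms(1,2) card_mono[of "{x, y, z, t}" V] by auto
  then obtain u where "u \<in> V" "u \<notin> {x, y, z, t}" by blast
  then show ?thesis using p paw_structure[of x y z t u] by auto
next
  case False
  then show ?thesis using dominated_or_paw many by blast
qed

end

section \<open>Monochromatic copies\<close>

text \<open>Host set and colour are explicit so that copies can be moved between parts of
  \<open>V\<close> and between colourings. A graph without edges is a copy in every colour, which
  matters when \<open>G1\<close> is a single vertex.\<close>

definition copy :: "('v set \<Rightarrow> 'c) \<Rightarrow> 'c \<Rightarrow> 'v set \<Rightarrow> 'a ugraph \<Rightarrow> ('a \<Rightarrow> 'v) \<Rightarrow> bool" where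
  "copy c i S G \<phi> \<longleftrightarrow> inj_on \<phi> (verts G) \<and> \<phi> ` verts G \<subseteq> S \<and>
     (\<forall>u v. {u, v} \<in> edges G \<longrightarrow> c {\<phi> u, \<phi> v} = i)"

definition colourable :: "nat \<Rightarrow> 'a ugraph \<Rightarrow> bool" where
  "colourable k G \<longleftrightarrow> (\<exists>col :: 'a \<Rightarrow> nat. col ` verts G \<subseteq> {..<k} \<and>
     (\<forall>u v. {u, v} \<in> edges G \<longrightarrow> col u \<noteq> col v))"

lemma connected_graphD:
  assumes "connected_graph G"
  shows "simple_graph G" "finite (verts G)" "verts G \<noteq> {}" "0 < card (verts G)"
  using assms unfolding connected_graph_def simple_graph_def by (auto simp: card_gt_0_iff)

lemma simple_graph_edgeD:
  assumes "simple_graph G" "{u, v} \<in> edges G"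
  shows "u \<in> verts G" "v \<in> verts G" "u \<noteq> v"
proof -
  have "{u, v} \<in> nsets (verts G) 2" using assms unfolding simple_graph_def by blast
  then show "u \<in> verts G" "v \<in> verts G" "u \<noteq> v" unfolding nsets_def by auto
qed

lemma simple_graph_edgeE:
  assumes "simple_graph G" "e \<in> edges G"
  obtains u v where "e = {u, v}" "u \<in> verts G" "v \<in> verts G" "u \<noteq> v"
proof -
  have "e \<in> nsets (verts G) 2" using assms unfolding simple_graph_def by blast
  then show ?thesis using that by (auto simp: nsets_2_eq)
qed

lemma connected_graph_const:
  assumes "connected_graph G" and e: "\<And>u v. {u, v} \<in> edges G \<Longrightarrow> f u = f v"
    and "x \<in> verts G" "y \<in> verts G"
  shows "f x = f y"
proof -
  have "(x, y) \<in> {(x, y). {x, y} \<in> edges G}\<^sup>*"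
    using assms unfolding connected_graph_def by blast
  then show ?thesis by (induction rule: rtrancl_induct) (auto dest: e)
qed

lemma connected_graph_edge_at:
  assumes "connected_graph G" "2 \<le> card (verts G)" "v \<in> verts G"
  obtains u where "{v, u} \<in> edges G"
proof -
  obtain x where x: "x \<in> verts G" "x \<noteq> v"
    using assms(2) by (metis One_nat_def card_1_singleton_iff card_le_Suc0_iff_eq connected_graphD(2) assms(1)
        not_less_eq_eq numeral_2_eq_2)
  then have "(v, x) \<in> {(x, y). {x, y} \<in> edges G}\<^sup>*"
    using assms unfolding connected_graph_def by blast
  then show ?thesis using x(2) that by (cases rule: converse_rtranclE) auto
qed

lemma copyD:
  assumes "copy c i S G \<phi>"
  shows "inj_on \<phi> (verts G)" "\<phi> ` verts G \<subseteq> S" "{u, v} \<in> edges G \<Longrightarrow> c {\<phi> u, \<phi> v} = i"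
  using assms unfolding copy_def by auto

lemma card_copy:
  assumes "copy c i S G \<phi>"
  shows "card (\<phi> ` verts G) = card (verts G)"
  using assms unfolding copy_def by (simp add: card_image)

lemma copy_transport:
  assumes G: "simple_graph G" and copy: "copy c i S G \<phi>"
    and h: "inj_on h (\<phi> ` verts G)" "h ` \<phi> ` verts G \<subseteq> T"
    and c: "\<And>x y. x \<in> \<phi> ` verts G \<Longrightarrow> y \<in> \<phi> ` verts G \<Longrightarrow> x \<noteq> y \<Longrightarrow> c {x, y} = i \<Longrightarrow> c' {h x, h y} = i'"
  shows "copy c' i' T G (h \<circ> \<phi>)"
proof -
  have "c' {h (\<phi> u), h (\<phi> v)} = i'" if e: "{u, v} \<in> edges G" for u v
  proof (rule c)
    show "\<phi> u \<noteq> \<phi> v"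
      using simple_graph_edgeD[OF G e] copyD(1)[OF copy] by (auto simp: inj_on_def)
  qed (use simple_graph_edgeD[OF G e] copyD(3)[OF copy e] in auto)
  then show ?thesis
    using copyD(1)[OF copy] h unfolding copy_def by (auto intro: comp_inj_on)
qed

lemma copy_change:
  assumes "simple_graph G" "copy c i S G \<phi>" "\<phi> ` verts G \<subseteq> T"
    and "\<And>x y. x \<in> \<phi> ` verts G \<Longrightarrow> y \<in> \<phi> ` verts G \<Longrightarrow> x \<noteq> y \<Longrightarrow> c {x, y} = i \<Longrightarrow> c' {x, y} = i'"
  shows "copy c' i' T G \<phi>"
  using copy_transport[of G c i S \<phi> "\<lambda>x. x" T c' i'] assms by (simp add: comp_def)

text \<open>This is how connectivity is used: an invariant \<open>f\<close> that does not change
  along edges of colour \<open>i\<close> confines a copy to one of its level sets. Later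
  \<open>f\<close> is the label, group, side or clique of a vertex.\<close>

lemma copy_const:
  assumes G: "connected_graph G" and copy: "copy c i S G \<phi>"
    and f: "\<And>x y. x \<in> S \<Longrightarrow> y \<in> S \<Longrightarrow> x \<noteq> y \<Longrightarrow> c {x, y} = i \<Longrightarrow> f x = f y"
  shows "x \<in> \<phi> ` verts G \<Longrightarrow> y \<in> \<phi> ` verts G \<Longrightarrow> f x = f y"
proof -
  have "f (\<phi> u) = f (\<phi> v)" if e: "{u, v} \<in> edges G" for u v
  proof (rule f)
    show "\<phi> u \<noteq> \<phi> v"
      using simple_graph_edgeD[OF connected_graphD(1)[OF G] e] copyD(1)[OF copy] by (auto simp: inj_on_def)
  qed (use simple_graph_edgeD[OF connected_graphD(1)[OF G] e] copyD(2)[OF copy] copyD(3)[OF copy e] in auto)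
  then show "x \<in> \<phi> ` verts G \<Longrightarrow> y \<in> \<phi> ` verts G \<Longrightarrow> f x = f y"
    using connected_graph_const[OF G, of "f \<circ> \<phi>"] by auto
qed

lemma copy_colourable:
  assumes G: "simple_graph G" and copy: "copy c i S G \<phi>"
    and f: "\<And>x. x \<in> \<phi> ` verts G \<Longrightarrow> f x < (k :: nat)"
      "\<And>x y. x \<in> \<phi> ` verts G \<Longrightarrow> y \<in> \<phi> ` verts G \<Longrightarrow> x \<noteq> y \<Longrightarrow> c {x, y} = i \<Longrightarrow> f x \<noteq> f y"
  shows "colourable k G"
  unfolding colourable_def
proof (intro exI[of _ "f \<circ> \<phi>"] conjI allI impI)
  show "(f \<circ> \<phi>) ` verts G \<subseteq> {..<k}" using f(1) by auto
next
  fix u v assume e: "{u, v} \<in> edges G"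
  have "\<phi> u \<noteq> \<phi> v"
    using simple_graph_edgeD[OF G e] copyD(1)[OF copy] by (auto simp: inj_on_def)
  then show "(f \<circ> \<phi>) u \<noteq> (f \<circ> \<phi>) v"
    using f(2) simple_graph_edgeD[OF G e] copyD(3)[OF copy e] by auto
qed

text \<open>Each colour class is injected into its own part, and disjointness of the parts makes the
  union of these maps injective. Every part is measured against its own class only, so that parts of
  unequal size can be used.\<close>

lemma multipartite_copy:
  fixes col :: "'a \<Rightarrow> nat"
  assumes G: "simple_graph G"
    and col: "\<And>u v. {u, v} \<in> edges G \<Longrightarrow> col u \<noteq> col v"
    and fin: "\<And>v. v \<in> verts G \<Longrightarrow> finite (P (col v))"
    and disj: "\<And>u v. u \<in> verts G \<Longrightarrow> v \<in> verts G \<Longrightarrow> col u \<noteq> col v \<Longrightarrow> P (col u) \<inter> P (col v) = {}"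
    and card: "\<And>v. v \<in> verts G \<Longrightarrow> card {u \<in> verts G. col u = col v} \<le> card (P (col v))"
    and cross: "\<And>u v x y. u \<in> verts G \<Longrightarrow> v \<in> verts G \<Longrightarrow> col u \<noteq> col v \<Longrightarrow> x \<in> P (col u) \<Longrightarrow> y \<in> P (col v) \<Longrightarrow> c {x, y} = i"
  obtains \<phi> where "copy c i (\<Union>v\<in>verts G. P (col v)) G \<phi>" "\<And>v. v \<in> verts G \<Longrightarrow> \<phi> v \<in> P (col v)"
proof -
  have finG: "finite (verts G)" using G unfolding simple_graph_def by simp
  have "\<forall>l\<in>col ` verts G. \<exists>g. inj_on g {u \<in> verts G. col u = l} \<and> g ` {u \<in> verts G. col u = l} \<subseteq> P l"
  proof
    fix l assume "l \<in> col ` verts G"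
    then obtain v where "v \<in> verts G" "l = col v" by blast
    then show "\<exists>g. inj_on g {u \<in> verts G. col u = l} \<and> g ` {u \<in> verts G. col u = l} \<subseteq> P l"
      using card_le_inj[of "{u \<in> verts G. col u = l}" "P l"] finG fin card by auto
  qed
  from bchoice[OF this] obtain g where g: "\<And>l. l \<in> col ` verts G \<Longrightarrow> inj_on (g l) {u \<in> verts G. col u = l}"
      "\<And>l. l \<in> col ` verts G \<Longrightarrow> g l ` {u \<in> verts G. col u = l} \<subseteq> P l"
    by blast
  define \<phi> where "\<phi> v = g (col v) v" for v
  have in_P: "\<phi> v \<in> P (col v)" if "v \<in> verts G" for v
    using g(2)[of "col v"] that unfolding \<phi>_def by auto
  have "inj_on \<phi> (verts G)"
  proof (rule inj_onI)
    fix u v assume uv: "u \<in> verts G" "v \<in> verts G" "\<phi> u = \<phi> v"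
    then have "col u = col v" using in_P[of u] in_P[of v] disj[of u v] by auto
    then show "u = v" using uv g(1)[of "col u"] unfolding \<phi>_def inj_on_def by auto
  qed
  moreover have "c {\<phi> u, \<phi> v} = i" if e: "{u, v} \<in> edges G" for u v
    using cross[of u v] simple_graph_edgeD[OF G e] col[OF e] in_P by blast
  ultimately have "copy c i (\<Union>v\<in>verts G. P (col v)) G \<phi>"
    unfolding copy_def using in_P by auto
  then show ?thesis using that in_P by blast
qed

lemma copy_edge:
  assumes G: "connected_graph G" "2 \<le> card (verts G)" and copy: "copy c' i S G \<phi>"
  obtains x y where "x \<in> \<phi> ` verts G" "y \<in> \<phi> ` verts G" "x \<noteq> y" "c' {x, y} = i"
proof -
  obtain u v where e: "{u, v} \<in> edges G"
    using connected_graph_edge_at[OF G] connected_graphD(3)[OF G(1)] by blast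
  have "\<phi> u \<in> \<phi> ` verts G" "\<phi> v \<in> \<phi> ` verts G" "\<phi> u \<noteq> \<phi> v"
    using simple_graph_edgeD[OF connected_graphD(1)[OF G(1)] e] copyD(1)[OF copy] by (auto simp: inj_on_def)
  then show ?thesis using that copyD(3)[OF copy e] by blast
qed

text \<open>Permuting the colours sorts the classes by size. The last bound holds because the class
  now called 2 is a smallest one; it ensures that an empty class 2, as for a bipartite graph, stays
  empty.\<close>

lemma sorted_three_colouring:
  fixes col :: "'a \<Rightarrow> nat"
  assumes col: "\<And>v. v \<in> verts G \<Longrightarrow> col v < 3" "\<And>u v. {u, v} \<in> edges G \<Longrightarrow> col u \<noteq> col v"
    and G: "simple_graph G"
  obtains col' :: "'a \<Rightarrow> nat" where "\<And>v. v \<in> verts G \<Longrightarrow> col' v < 3"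
    "\<And>u v. {u, v} \<in> edges G \<Longrightarrow> col' u \<noteq> col' v"
    "card {v \<in> verts G. col' v = 1} \<le> card {v \<in> verts G. col' v = 0}"
    "card {v \<in> verts G. col' v = 2} \<le> card {v \<in> verts G. col' v = 1}"
    "card {v \<in> verts G. col' v = 2} \<le> card {v \<in> verts G. col v = 2}"
proof -
  define s where "s l = card {v \<in> verts G. col v = l}" for l
  have "\<exists>a b e. {a, b, e} = {0, 1, 2 :: nat} \<and> distinct [a, b, e] \<and> s b \<le> s a \<and> s e \<le> s b"
  proof -
    consider "s 1 \<le> s 0" "s 2 \<le> s 1" | "s 2 \<le> s 0" "s 1 \<le> s 2" | "s 0 \<le> s 1" "s 2 \<le> s 0"
      | "s 2 \<le> s 1" "s 0 \<le> s 2" | "s 0 \<le> s 2" "s 1 \<le> s 0" | "s 1 \<le> s 2" "s 0 \<le> s 1"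
      by linarith
    then show ?thesis
    proof cases
      case 1 then show ?thesis by - (rule exI[of _ 0], rule exI[of _ 1], rule exI[of _ 2], auto)
    next
      case 2 then show ?thesis by - (rule exI[of _ 0], rule exI[of _ 2], rule exI[of _ 1], auto)
    next
      case 3 then show ?thesis by - (rule exI[of _ 1], rule exI[of _ 0], rule exI[of _ 2], auto)
    next
      case 4 then show ?thesis by - (rule exI[of _ 1], rule exI[of _ 2], rule exI[of _ 0], auto)
    next
      case 5 then show ?thesis by - (rule exI[of _ 2], rule exI[of _ 0], rule exI[of _ 1], auto)
    next
      case 6 then show ?thesis by - (rule exI[of _ 2], rule exI[of _ 1], rule exI[of _ 0], auto)
    qed
  qed
  then obtain a b e where abe: "{a, b, e} = {0, 1, 2}" "distinct [a, b, e]" "s b \<le> s a" "s e \<le> s b" by blast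
  define col' where "col' v = (if col v = a then 0 else if col v = b then 1 else 2 :: nat)" for v
  have in_abe: "col v \<in> {a, b, e}" if "v \<in> verts G" for v
    unfolding abe(1) using col(1)[OF that] by auto
  have cls: "{v \<in> verts G. col' v = 0} = {v \<in> verts G. col v = a}" "{v \<in> verts G. col' v = 1} = {v \<in> verts G. col v = b}"
    "{v \<in> verts G. col' v = 2} = {v \<in> verts G. col v = e}"
    using abe(2) in_abe unfolding col'_def by auto
  have "2 \<in> {a, b, e}" unfolding abe(1) by simp
  then have "s e \<le> s 2" using abe(3,4) by auto
  show ?thesis
  proof (rule that[of col'])
    show "col' u \<noteq> col' v" if uv: "{u, v} \<in> edges G" for u v
      using col(2)[OF uv] in_abe[of u] in_abe[of v] simple_graph_edgeD[OF G uv] unfolding col'_def by auto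
    show "col' v < 3" for v unfolding col'_def by simp
  qed (use abe(3,4) \<open>s e \<le> s 2\<close> in \<open>simp_all only: cls s_def\<close>)
qed

lemma sum_three_classes:
  fixes col :: "'a \<Rightarrow> nat"
  assumes "finite X" "\<And>v. v \<in> X \<Longrightarrow> col v < 3"
  shows "card {v \<in> X. col v = 0} + card {v \<in> X. col v = 1} + card {v \<in> X. col v = 2} = card X"
proof -
  have "X = {v \<in> X. col v = 0} \<union> {v \<in> X. col v = 1} \<union> {v \<in> X. col v = 2}"
    using assms(2) by fastforce
  moreover have "card ({v \<in> X. col v = 0} \<union> {v \<in> X. col v = 1} \<union> {v \<in> X. col v = 2})
      = card {v \<in> X. col v = 0} + card {v \<in> X. col v = 1} + card {v \<in> X. col v = 2}"
    using assms(1) by (subst card_Un_disjoint; auto)+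
  ultimately show ?thesis by simp
qed

lemma copy_mono: "copy c j S G \<phi> \<Longrightarrow> S \<subseteq> T \<Longrightarrow> copy c j T G \<phi>"
  unfolding copy_def by blast

lemma copy_restrict: "copy c j S G \<phi> \<Longrightarrow> \<phi> ` verts G \<subseteq> T \<Longrightarrow> copy c j T G \<phi>"
  unfolding copy_def by blast

lemma trivial_copy:
  assumes G: "connected_graph G" "card (verts G) = 1" and "x \<in> S"
  shows "copy c i S G (\<lambda>_. x)"
proof -
  obtain v where v: "verts G = {v}" using G(2) by (auto simp: card_1_singleton_iff)
  then have "{p, q} \<notin> edges G" for p q
    using simple_graph_edgeD[OF connected_graphD(1)[OF G(1)], of p q] by auto
  then show ?thesis using v \<open>x \<in> S\<close> unfolding copy_def by auto
qed

section \<open>Avoiding a disjoint pair of copies\<close>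

locale graph_pair =
  fixes G1 :: "'a ugraph" and G2 :: "'b ugraph" and emb :: "'a \<Rightarrow> 'b"
  assumes conn1: "connected_graph G1" and conn2: "connected_graph G2" and emb: "embedding emb G1 G2"
begin

abbreviation n1 :: nat where "n1 \<equiv> card (verts G1)"
abbreviation n2 :: nat where "n2 \<equiv> card (verts G2)"

lemmas simple1 = connected_graphD(1)[OF conn1] and simple2 = connected_graphD(1)[OF conn2]

definition pair_free :: "('v set \<Rightarrow> nat) \<Rightarrow> 'v set \<Rightarrow> bool" where
  "pair_free c V \<longleftrightarrow> \<not> (\<exists>i \<phi>1 \<phi>2. copy c i V G1 \<phi>1 \<and> copy c i V G2 \<phi>2 \<and> \<phi>1 ` verts G1 \<inter> \<phi>2 ` verts G2 = {})"

definition has_free_3_colouring :: "'v set \<Rightarrow> bool" where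
  "has_free_3_colouring V \<longleftrightarrow> (\<exists>c :: 'v set \<Rightarrow> nat. range c \<subseteq> {1, 2, 3} \<and> pair_free c V)"

lemma pair_freeD:
  "pair_free c V \<Longrightarrow> copy c i V G1 \<phi>1 \<Longrightarrow> copy c i V G2 \<phi>2 \<Longrightarrow> \<phi>1 ` verts G1 \<inter> \<phi>2 ` verts G2 = {} \<Longrightarrow> False"
  unfolding pair_free_def by blast

text \<open>A colour of \<open>c'\<close> that lies inside one colour of \<open>c\<close> inherits
  freeness, so in a recolouring only properly merged classes need an argument.\<close>

lemma pair_free_class:
  assumes "pair_free c V" "copy c' i V G1 \<phi>1" "copy c' i V G2 \<phi>2" "\<phi>1 ` verts G1 \<inter> \<phi>2 ` verts G2 = {}"
    and c: "\<And>x y. x \<in> V \<Longrightarrow> y \<in> V \<Longrightarrow> x \<noteq> y \<Longrightarrow> c' {x, y} = i \<Longrightarrow> c {x, y} = j"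
  shows False
proof (rule pair_freeD[OF assms(1) _ _ assms(4)])
  show "copy c j V G1 \<phi>1"
    using copyD(2)[OF assms(2)] by (intro copy_change[OF simple1 assms(2)] c) blast+
  show "copy c j V G2 \<phi>2"
    using copyD(2)[OF assms(3)] by (intro copy_change[OF simple2 assms(3)] c) blast+
qed

lemma emb_edge: "{u, v} \<in> edges G1 \<Longrightarrow> {emb u, emb v} \<in> edges G2"
  using emb unfolding embedding_def by fastforce

lemma n1_le_n2: "n1 \<le> n2"
  using emb connected_graphD(2)[OF conn2] unfolding embedding_def by (metis card_image card_mono)

lemma copy_sub:
  assumes "copy c i S G2 \<phi>"
  shows "copy c i S G1 (\<phi> \<circ> emb)"
proof -
  have "inj_on emb (verts G1)" "emb ` verts G1 \<subseteq> verts G2"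
    using emb unfolding embedding_def by auto
  then show ?thesis
    using assms emb_edge unfolding copy_def by (auto simp: image_subset_iff intro: comp_inj_on inj_on_subset)
qed

lemma colourable_sub:
  assumes "colourable k G2"
  shows "colourable k G1"
proof -
  obtain col :: "'b \<Rightarrow> nat" where "col ` verts G2 \<subseteq> {..<k}" "\<And>u v. {u, v} \<in> edges G2 \<Longrightarrow> col u \<noteq> col v"
    using assms unfolding colourable_def by blast
  moreover have "emb ` verts G1 \<subseteq> verts G2" using emb unfolding embedding_def by auto
  ultimately show ?thesis
    unfolding colourable_def using emb_edge by (intro exI[of _ "col \<circ> emb"]) fastforce
qed

lemma has_free_3_colouring_small:
  assumes "finite V" "card V < n1 + n2"
  shows "has_free_3_colouring V"
proof -
  have "pair_free (\<lambda>_. 1) V"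
    unfolding pair_free_def
  proof clarify
    fix i \<phi>1 \<phi>2
    assume c: "copy (\<lambda>_. 1) i V G1 \<phi>1" "copy (\<lambda>_. 1) i V G2 \<phi>2" and d: "\<phi>1 ` verts G1 \<inter> \<phi>2 ` verts G2 = {}"
    have "card (\<phi>1 ` verts G1 \<union> \<phi>2 ` verts G2) = n1 + n2"
      using d connected_graphD(2)[OF conn1] connected_graphD(2)[OF conn2] card_copy[OF c(1)] card_copy[OF c(2)]
      by (simp add: card_Un_disjoint)
    moreover have "\<phi>1 ` verts G1 \<union> \<phi>2 ` verts G2 \<subseteq> V"
      using copyD(2)[OF c(1)] copyD(2)[OF c(2)] by blast
    ultimately show False using assms card_mono by (metis not_less)
  qed
  then show ?thesis unfolding has_free_3_colouring_def by (intro exI[of _ "\<lambda>_. 1"]) auto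
qed

lemma two_le_n2:
  assumes "finite V" "n1 + n2 \<le> card V" "pair_free c V"
  shows "2 \<le> n2"
proof (rule ccontr)
  assume "\<not> 2 \<le> n2"
  then have one: "n2 = 1" "n1 = 1"
    using n1_le_n2 connected_graphD(4)[OF conn1] connected_graphD(4)[OF conn2] by auto
  then have "\<not> card V \<le> Suc 0" using assms(2) by simp
  then obtain x y where "x \<in> V" "y \<in> V" "x \<noteq> y"
    using assms(1) by (metis card_le_Suc0_iff_eq)
  then show False
    using pair_freeD[OF assms(3) trivial_copy[OF conn1 one(2), of x V c 0] trivial_copy[OF conn2 one(1), of y V c 0]] by auto
qed

text \<open>If the smaller graph is a single vertex it can always be added to a copy of the larger one.\<close>

lemma two_le_n1:
  assumes "finite V" "n1 + n2 \<le> card V" "pair_free c V" and copy: "copy c i V G2 \<phi>"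
  shows "2 \<le> n1"
proof (rule ccontr)
  assume "\<not> 2 \<le> n1"
  then have one: "n1 = 1" using connected_graphD(4)[OF conn1] by auto
  then have "card (\<phi> ` verts G2) < card V" using card_copy[OF copy] assms(2) by simp
  then have "V - \<phi> ` verts G2 \<noteq> {}" using copyD(2)[OF copy] by auto
  then obtain x where "x \<in> V" "x \<notin> \<phi> ` verts G2" by blast
  then show False
    using pair_freeD[OF assms(3) trivial_copy[OF conn1 one, of x V c i] copy] by auto
qed

end

section \<open>Colourings with a dominating colour\<close>

text \<open>\<open>L x\<close> is the only colour other than \<open>d\<close> at \<open>x\<close>, if there is one.\<close>

locale dominated_colouring = graph_pair G1 G2 emb
  for G1 :: "'a ugraph" and G2 :: "'b ugraph" and emb :: "'a \<Rightarrow> 'b" +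
  fixes V :: "'v set" and c :: "'v set \<Rightarrow> nat" and d :: nat and L :: "'v \<Rightarrow> nat"
  assumes finV: "finite V"
    and dom: "\<And>x y. x \<in> V \<Longrightarrow> y \<in> V \<Longrightarrow> x \<noteq> y \<Longrightarrow> c {x, y} = d \<or> c {x, y} = L x \<and> L x = L y"
    and free: "pair_free c V"
    and size: "n1 + n2 \<le> card V"
begin

section \<open>Merging the colours other than the dominating one\<close>

definition has1 :: "nat \<Rightarrow> bool" where "has1 j \<longleftrightarrow> j \<noteq> d \<and> (\<exists>\<phi>. copy c j V G1 \<phi>)"

definition has2 :: "nat \<Rightarrow> bool" where "has2 j \<longleftrightarrow> j \<noteq> d \<and> (\<exists>\<phi>. copy c j V G2 \<phi>)"

lemma has2_has1: "has2 j \<Longrightarrow> has1 j"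
  unfolding has1_def has2_def by (auto dest: copy_sub)

lemmas n2_ge = two_le_n2[OF finV size free]

lemma n1_ge: "has2 j \<Longrightarrow> 2 \<le> n1"
  unfolding has2_def using two_le_n1[OF finV size free] by blast

text \<open>Edges of colours other than \<open>d\<close> that share a vertex have the same colour.
  So \<open>L\<close> is constant on a connected copy and merging such colours creates no new one.
  The edge that is returned tells into which merged class the colour \<open>j\<close> went.\<close>

lemma concentrate:
  assumes G: "connected_graph G" "2 \<le> card (verts G)" and copy: "copy c' i S G \<phi>" and "S \<subseteq> V"
    and c': "\<And>x y. x \<in> S \<Longrightarrow> y \<in> S \<Longrightarrow> x \<noteq> y \<Longrightarrow> c' {x, y} = i \<Longrightarrow> c {x, y} \<noteq> d"
  obtains j x y where "j \<noteq> d" "copy c j (S \<inter> {v. L v = j}) G \<phi>" "x \<in> S" "y \<in> S" "x \<noteq> y" "c' {x, y} = i" "c {x, y} = j"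
proof -
  have L: "L x = L y" "c {x, y} = L x" if "x \<in> S" "y \<in> S" "x \<noteq> y" "c' {x, y} = i" for x y
    using c'[OF that] dom[of x y] that \<open>S \<subseteq> V\<close> by auto
  obtain u where u: "u \<in> verts G" using connected_graphD(3)[OF G(1)] by blast
  obtain v where e: "{u, v} \<in> edges G" using connected_graph_edge_at[OF G u] by blast
  have uv: "\<phi> u \<in> S" "\<phi> v \<in> S" "\<phi> u \<noteq> \<phi> v" "c' {\<phi> u, \<phi> v} = i"
    using simple_graph_edgeD[OF connected_graphD(1)[OF G(1)] e] copyD[OF copy] e by (auto simp: inj_on_def)
  have const: "L x = L (\<phi> u)" if "x \<in> \<phi> ` verts G" for x
    using copy_const[OF G(1) copy, of L x "\<phi> u"] L(1) that u by blast
  have "copy c (L (\<phi> u)) (S \<inter> {v. L v = L (\<phi> u)}) G \<phi>"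
  proof (rule copy_change[OF connected_graphD(1)[OF G(1)] copy])
    show "\<phi> ` verts G \<subseteq> S \<inter> {v. L v = L (\<phi> u)}" using const copyD(2)[OF copy] by auto
  next
    fix x y assume "x \<in> \<phi> ` verts G" "y \<in> \<phi> ` verts G" "x \<noteq> y" "c' {x, y} = i"
    then show "c {x, y} = L (\<phi> u)" using L(2)[of x y] const[of x] copyD(2)[OF copy] by auto
  qed
  moreover have "L (\<phi> u) \<noteq> d" "c {\<phi> u, \<phi> v} = L (\<phi> u)" using L[OF uv] c'[OF uv] by auto
  ultimately show ?thesis using that uv by blast
qed

text \<open>The only colour containing \<open>G2\<close> gets a class of its own. A copy of
  \<open>G2\<close> in the class of the others would concentrate in one old colour, which would have
  to be that very colour.\<close>

lemma at_most_one_has2: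
  assumes one: "\<And>j j'. has2 j \<Longrightarrow> has2 j' \<Longrightarrow> j = j'"
  shows "has_free_3_colouring V"
proof -
  define c' where "c' e = (if c e = d then 1 else if has2 (c e) then 2 else (3::nat))" for e
  have c'1: "c' e = 1 \<longleftrightarrow> c e = d" and c'2: "c' e = 2 \<longleftrightarrow> c e \<noteq> d \<and> has2 (c e)" for e
    unfolding c'_def by simp_all
  have "pair_free c' V"
    unfolding pair_free_def
  proof (intro notI, elim exE conjE)
    fix i \<phi>1 \<phi>2
    assume c1: "copy c' i V G1 \<phi>1" and c2: "copy c' i V G2 \<phi>2" and dis: "\<phi>1 ` verts G1 \<inter> \<phi>2 ` verts G2 = {}"
    show False
    proof (cases "i = 1")
      case True
      have "c {x, y} = d" if "c' {x, y} = i" for x y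
        using that True c'1 by blast
      then show False
        by (rule pair_free_class[OF free c1 c2 dis])
    next
      case False
      then have nd: "c {x, y} \<noteq> d" if "c' {x, y} = i" for x y
        using that c'1 by blast
      obtain j x y where j: "j \<noteq> d" "copy c j (V \<inter> {v. L v = j}) G2 \<phi>2" "c' {x, y} = i" "c {x, y} = j"
        by (rule concentrate[OF conn2 n2_ge c2 subset_refl nd])
      then have "copy c j V G2 \<phi>2" by (auto intro: copy_mono)
      then have "has2 j" using j unfolding has2_def by blast
      then have "i = 2" using j c'2 by blast
      then have "c {x, y} = j" if "c' {x, y} = i" for x y
        using that one[OF _ \<open>has2 j\<close>] c'2 by blast
      then show False
        by (rule pair_free_class[OF free c1 c2 dis])
    qed
  qed
  moreover have "range c' \<subseteq> {1, 2, 3}" unfolding c'_def by auto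
  ultimately show ?thesis unfolding has_free_3_colouring_def by blast
qed

text \<open>Colours without \<open>G1\<close> contain no \<open>G2\<close> either and can join the
  class of \<open>j2\<close>: both copies found in that class concentrate in \<open>j2\<close>
  itself.\<close>

lemma at_most_two_has1:
  assumes n1: "2 \<le> n1" and two: "\<And>j. has1 j \<Longrightarrow> j = j1 \<or> j = j2"
  shows "has_free_3_colouring V"
proof -
  define c' where "c' e = (if c e = d then 1 else if c e = j1 then 2 else (3::nat))" for e
  have "pair_free c' V"
    unfolding pair_free_def
  proof clarify
    fix i \<phi>1 \<phi>2
    assume c1: "copy c' i V G1 \<phi>1" and c2: "copy c' i V G2 \<phi>2" and dis: "\<phi>1 ` verts G1 \<inter> \<phi>2 ` verts G2 = {}"
    show False
    proof (cases "i = 3")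
      case True
      then have nd: "c {x, y} \<noteq> d" if "c' {x, y} = i" for x y
        using that unfolding c'_def by (simp split: if_split_asm)
      obtain j x y where j: "j \<noteq> d" "copy c j (V \<inter> {v. L v = j}) G1 \<phi>1" "c' {x, y} = i" "c {x, y} = j"
        by (rule concentrate[OF conn1 n1 c1 subset_refl nd])
      then have j1: "copy c j V G1 \<phi>1" by (auto intro: copy_mono)
      then have "j = j2"
        using j two[of j] True unfolding has1_def c'_def by (auto split: if_split_asm)
      obtain j' x y where j': "j' \<noteq> d" "copy c j' (V \<inter> {v. L v = j'}) G2 \<phi>2" "c' {x, y} = i" "c {x, y} = j'"
        by (rule concentrate[OF conn2 n2_ge c2 subset_refl nd])
      then have j2: "copy c j' V G2 \<phi>2" by (auto intro: copy_mono)
      then have "has1 j'" using has2_has1 j' unfolding has2_def by blast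
      then have "j' = j2"
        using j' two[of j'] True unfolding c'_def by (simp split: if_split_asm)
      then show False using pair_freeD[OF free j1 _ dis] j2 \<open>j = j2\<close> by blast
    next
      case False
      have "c {x, y} = (if i = 1 then d else j1)" if "c' {x, y} = i" for x y
        using that False unfolding c'_def by (auto split: if_split_asm)
      then show False
        by (rule pair_free_class[OF free c1 c2 dis])
    qed
  qed
  moreover have "range c' \<subseteq> {1, 2, 3}" unfolding c'_def by auto
  ultimately show ?thesis unfolding has_free_3_colouring_def by blast
qed

section \<open>Multipartite graphs in the dominating colour\<close>

lemma cross: "x \<in> V \<Longrightarrow> y \<in> V \<Longrightarrow> L x \<noteq> L y \<Longrightarrow> c {x, y} = d"
  using dom[of x y] by auto

text \<open>\<open>A\<close> is the vertex set of a copy of \<open>G2\<close>; a copy of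
  \<open>G1\<close> in the same colour off \<open>A\<close> would complete a forbidden pair.
  Removing \<open>A\<close> thus clears colour \<open>j\<close> of both graphs.\<close>

lemma has2_part:
  assumes "has2 j"
  obtains A where "A \<subseteq> V \<inter> {v. L v = j}" "card A = n2" "\<And>\<phi>. \<not> copy c j (V - A) G1 \<phi>"
proof -
  obtain \<phi> where \<phi>: "copy c j V G2 \<phi>" and "j \<noteq> d" using assms unfolding has2_def by blast
  have "\<phi> ` verts G2 \<subseteq> V \<inter> {v. L v = j}"
  proof (rule concentrate[OF conn2 n2_ge \<phi> subset_refl])
    show "\<phi> ` verts G2 \<subseteq> V \<inter> {v. L v = j}" if "copy c j' (V \<inter> {v. L v = j'}) G2 \<phi>" "c {x, y} = j" "c {x, y} = j'" for j' x y
      using copyD(2)[OF that(1)] that(2,3) by simp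
  qed (use \<open>j \<noteq> d\<close> in simp)
  moreover have "\<not> copy c j (V - \<phi> ` verts G2) G1 \<phi>1" for \<phi>1
  proof
    assume *: "copy c j (V - \<phi> ` verts G2) G1 \<phi>1"
    show False
      by (rule pair_freeD[OF free copy_mono[OF * Diff_subset] \<phi>]) (use copyD(2)[OF *] in blast)
  qed
  ultimately show ?thesis using that card_copy[OF \<phi>] by blast
qed

lemma has1_part:
  assumes "has1 j" "2 \<le> n1"
  obtains A where "A \<subseteq> V \<inter> {v. L v = j}" "card A = n1"
proof -
  obtain \<phi> where \<phi>: "copy c j V G1 \<phi>" and "j \<noteq> d" using assms unfolding has1_def by blast
  have "\<phi> ` verts G1 \<subseteq> V \<inter> {v. L v = j}"
  proof (rule concentrate[OF conn1 assms(2) \<phi> subset_refl])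
    show "\<phi> ` verts G1 \<subseteq> V \<inter> {v. L v = j}" if "copy c j' (V \<inter> {v. L v = j'}) G1 \<phi>" "c {x, y} = j" "c {x, y} = j'" for j' x y
      using copyD(2)[OF that(1)] that(2,3) by simp
  qed (use \<open>j \<noteq> d\<close> in simp)
  then show ?thesis using that card_copy[OF \<phi>] by blast
qed

lemma finite_has1: "2 \<le> n1 \<Longrightarrow> finite {j. has1 j}"
proof -
  assume n1: "2 \<le> n1"
  have "j \<in> L ` V" if j: "has1 j" for j
  proof -
    obtain A where A: "A \<subseteq> V \<inter> {v. L v = j}" "card A = n1" using has1_part[OF j n1] .
    then have "A \<noteq> {}" using n1 by auto
    then show ?thesis using A(1) by blast
  qed
  then show ?thesis using finite_surj[OF finV, of "{j. has1 j}" L] by blast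
qed

text \<open>Two copies sharing a proper \<open>m\<close>-colouring fit side by side into \<open>m\<close> parts of size \<^term>\<open>n2\<close>
  after shifting the colour classes of the smaller one cyclically.\<close>

lemma parts_not_colourable:
  assumes m: "2 \<le> m" and P: "\<And>l. l < m \<Longrightarrow> P l \<subseteq> V" "\<And>l. l < m \<Longrightarrow> n2 \<le> card (P l)"
    and sep: "\<And>l l' x y. l < m \<Longrightarrow> l' < m \<Longrightarrow> l \<noteq> l' \<Longrightarrow> x \<in> P l \<Longrightarrow> y \<in> P l' \<Longrightarrow> L x \<noteq> L y"
  shows "\<not> colourable m G2"
proof
  assume "colourable m G2"
  then obtain col :: "'b \<Rightarrow> nat" where col: "\<And>v. v \<in> verts G2 \<Longrightarrow> col v < m"
      "\<And>u v. {u, v} \<in> edges G2 \<Longrightarrow> col u \<noteq> col v"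
    unfolding colourable_def by blast
  have fin2: "finite (verts G2)" by (rule connected_graphD(2)[OF conn2])
  have finP: "finite (P l)" if "l < m" for l using P(1)[OF that] finV finite_subset by blast
  have disj: "P l \<inter> P l' = {}" if "l < m" "l' < m" "l \<noteq> l'" for l l'
    using sep[OF that] by blast
  have crossP: "c {x, y} = d" if "l < m" "l' < m" "l \<noteq> l'" "x \<in> P l" "y \<in> P l'" for l l' x y
    using cross sep[OF that] P(1) that by blast
  obtain \<phi>2 where \<phi>2: "copy c d (\<Union>v\<in>verts G2. P (col v)) G2 \<phi>2" "\<And>v. v \<in> verts G2 \<Longrightarrow> \<phi>2 v \<in> P (col v)"
  proof (rule multipartite_copy[of G2 col P c d])
    show "card {u \<in> verts G2. col u = col v} \<le> card (P (col v))" if "v \<in> verts G2" for v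
      using P(2)[OF col(1)[OF that]] card_mono[OF fin2, of "{u \<in> verts G2. col u = col v}"] by auto
    show "c {x, y} = d" if "u \<in> verts G2" "v \<in> verts G2" "col u \<noteq> col v" "x \<in> P (col u)" "y \<in> P (col v)" for u v x y
      using that crossP[OF col(1) col(1)] by blast
  qed (use simple2 col finP disj in auto)
  define q where "q l = {v \<in> verts G2. col v = l}" for l
  define P' where "P' l = P l - \<phi>2 ` verts G2" for l
  define col' where "col' u = Suc (col (emb u)) mod m" for u
  have emb_verts: "emb u \<in> verts G2" if "u \<in> verts G1" for u
    using that emb unfolding embedding_def by auto
  have col'_less: "col' u < m" for u using m unfolding col'_def by simp
  have P'_card: "n2 - card (q l) \<le> card (P' l)" if l: "l < m" for l
  proof -
    have "P l \<inter> \<phi>2 ` verts G2 \<subseteq> \<phi>2 ` q l"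
      using \<phi>2(2) disj[OF l col(1)] unfolding q_def by fastforce
    then have "card (P l \<inter> \<phi>2 ` verts G2) \<le> card (q l)"
      using fin2 unfolding q_def by (metis (no_types, lifting) surj_card_le finite_subset mem_Collect_eq subsetI)
    then show ?thesis
      using card_Diff_subset_Int[of "P l" "\<phi>2 ` verts G2"] finP[OF l] P(2)[OF l] unfolding P'_def by simp
  qed
  \<comment> \<open>The shift by one fixes no colour since \<open>m\<close> is at least 2. Hence the
    vertices sent to part \<open>l\<close> correspond under \<open>emb\<close> to vertices of
    \<open>G2\<close> outside \<open>q l\<close>, and \<phi>2 leaves at least that much of the part
    free.\<close>
  have shift: "card {u \<in> verts G1. col' u = l} \<le> n2 - card (q l)" if l: "l < m" for l
  proof -
    have "emb ` {u \<in> verts G1. col' u = l} \<subseteq> verts G2 - q l"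
    proof
      fix v assume "v \<in> emb ` {u \<in> verts G1. col' u = l}"
      then obtain u where u: "u \<in> verts G1" "v = emb u" "Suc (col v) mod m = l" unfolding col'_def by blast
      have "col v < m" using u col(1) emb_verts by blast
      then have "Suc (col v) mod m \<noteq> col v" using m by (cases "Suc (col v) = m") auto
      then show "v \<in> verts G2 - q l" using u emb_verts unfolding q_def by auto
    qed
    moreover have "inj_on emb {u \<in> verts G1. col' u = l}"
      using emb unfolding embedding_def by (auto intro: inj_on_subset)
    ultimately have "card {u \<in> verts G1. col' u = l} \<le> card (verts G2 - q l)"
      using fin2 by (metis card_image card_mono finite_Diff)
    also have "\<dots> = n2 - card (q l)"
      using fin2 unfolding q_def by (intro card_Diff_subset) auto
    finally show ?thesis .
  qed
  obtain \<phi>1 where \<phi>1: "copy c d (\<Union>v\<in>verts G1. P' (col' v)) G1 \<phi>1"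
  proof (rule multipartite_copy[of G1 col' P' c d])
    show "col' u \<noteq> col' v" if e: "{u, v} \<in> edges G1" for u v
    proof -
      have "col (emb u) < m" "col (emb v) < m" "col (emb u) \<noteq> col (emb v)"
        using simple_graph_edgeD[OF simple1 e] emb_verts col emb_edge[OF e] by auto
      then show ?thesis unfolding col'_def by (auto simp: mod_Suc)
    qed
    show "card {u \<in> verts G1. col' u = col' v} \<le> card (P' (col' v))" for v
      using shift[OF col'_less] P'_card[OF col'_less] le_trans by blast
    show "c {x, y} = d" if "col' u \<noteq> col' v" "x \<in> P' (col' u)" "y \<in> P' (col' v)" for u v x y
      using that crossP[OF col'_less col'_less] unfolding P'_def by blast
    show "P' (col' u) \<inter> P' (col' v) = {}" if "col' u \<noteq> col' v" for u v
      using disj[OF col'_less col'_less that] unfolding P'_def by blast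
    show "finite (P' (col' v))" for v
      using finP[OF col'_less] unfolding P'_def by simp
  qed (use simple1 in auto)
  have "copy c d V G1 \<phi>1" "copy c d V G2 \<phi>2"
    using copy_mono[OF \<phi>1] copy_mono[OF \<phi>2(1)] P(1) col(1) col'_less unfolding P'_def by blast+
  moreover have "\<phi>1 ` verts G1 \<inter> \<phi>2 ` verts G2 = {}"
    using copyD(2)[OF \<phi>1] unfolding P'_def by blast
  ultimately show False using pair_freeD[OF free] by blast
qed

text \<open>The vertices of \<open>A\<close> are split into \<open>m - 1\<close> groups of \<open>m\<close> cliques of size less than \<^term>\<open>n2\<close>.
  Cliques have colour 2, colour 1 joins the cliques of a group, and colour 3 joins the groups to each
  other and to the rest of \<open>V\<close>, so that colour 3 is \<open>m\<close>-partite, like colour 1 inside a group.\<close>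

lemma clique_blowup:
  assumes A: "A \<subseteq> V" "card A \<le> m * n2" and m: "3 \<le> m" and G2: "\<not> colourable m G2"
    and no2: "\<And>j \<phi>. j \<noteq> d \<Longrightarrow> \<not> copy c j (V - A) G2 \<phi>"
    and alt: "\<not> colourable m G1 \<or> (\<forall>\<phi>. \<not> copy c d (V - A) G2 \<phi>)"
  shows "has_free_3_colouring V"
proof -
  have finA: "finite A" using A(1) finV finite_subset by blast
  obtain h where h: "bij_betw h A {0..<card A}" using ex_bij_betw_finite_nat[OF finA] by blast
  \<comment> \<open>Consecutive blocks of \<open>n2 - 1\<close> numbers in an enumeration of
    \<open>A\<close>, one vertex short of a copy of \<open>G2\<close>.\<close>
  define cell where "cell x = h x div (n2 - 1)" for x
  \<comment> \<open>Group 0 is reserved for the rest of \<open>V\<close>, hence the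
    \<open>Suc\<close>; with it there are at most \<open>m\<close> groups, which makes colour 3
    m-partite.\<close>
  define grp where "grp x = (if x \<in> A then Suc (cell x div m) else 0)" for x
  define clq where "clq x = cell x mod m" for x
  \<comment> \<open>The cells have room for all of \<open>A\<close>:
    \<open>n2 \<le> 2 * (n2 - 1)\<close>, and \<open>3 \<le> m\<close> provides the factor
    2.\<close>
  have "n2 \<le> (m - 1) * (n2 - 1)"
    using n2_ge m mult_le_mono1[of 2 "m - 1" "n2 - 1"] by linarith
  then have "card A \<le> (m - 1) * m * (n2 - 1)"
    using A(2) by (metis mult.assoc mult.commute mult_le_mono2 order_trans)
  moreover have "h x < card A" if "x \<in> A" for x using h that unfolding bij_betw_def by auto
  ultimately have "cell x < (m - 1) * m" if "x \<in> A" for x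
    using that unfolding cell_def by (metis less_le_trans less_mult_imp_div_less)
  then have "cell x div m < m - 1" if "x \<in> A" for x
    using that less_mult_imp_div_less by blast
  then have grp_less: "grp x < m" for x using m unfolding grp_def by fastforce
  have clq_less: "clq x < m" for x using m unfolding clq_def by simp
  have fibre: "card {x \<in> A. cell x = l} < n2" for l
  proof -
    have "h ` {x \<in> A. cell x = l} \<subseteq> {l * (n2 - 1)..<l * (n2 - 1) + (n2 - 1)}"
    proof
      fix y assume "y \<in> h ` {x \<in> A. cell x = l}"
      then have "y div (n2 - 1) = l" unfolding cell_def by blast
      then have "y = l * (n2 - 1) + y mod (n2 - 1)" by (metis div_mult_mod_eq)
      moreover have "y mod (n2 - 1) < n2 - 1" using n2_ge by simp
      ultimately show "y \<in> {l * (n2 - 1)..<l * (n2 - 1) + (n2 - 1)}" by simp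
    qed
    moreover have "inj_on h {x \<in> A. cell x = l}"
      using h unfolding bij_betw_def by (auto intro: inj_on_subset)
    ultimately have "card {x \<in> A. cell x = l} \<le> card {l * (n2 - 1)..<l * (n2 - 1) + (n2 - 1)}"
      by (intro card_inj_on_le) auto
    then show ?thesis using n2_ge by simp
  qed
  \<comment> \<open>Outside \<open>A\<close> the old colouring survives as colour 1 for
    \<open>d\<close> and colour 2 for all other colours merged.\<close>
  define c' where "c' e = (if \<exists>x\<in>e. \<exists>y\<in>e. grp x \<noteq> grp y then 3
      else if e \<inter> A = {} then if c e = d then 1 else 2
      else if \<exists>x\<in>e. \<exists>y\<in>e. clq x \<noteq> clq y then 1 else (2::nat))" for e
  have c'3: "grp x \<noteq> grp y" if "c' {x, y} = 3" for x y
    using that unfolding c'_def by (auto split: if_splits)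
  have c'12: "grp x = grp y" if "c' {x, y} = i" "i \<noteq> 3" for x y i
    using that unfolding c'_def by (auto split: if_splits)
  have c'1: "if x \<in> A then clq x \<noteq> clq y else c {x, y} = d" if "c' {x, y} = 1" for x y
    using that c'12[OF that] unfolding c'_def grp_def by (auto split: if_splits)
  have c'2: "if x \<in> A then cell x = cell y else c {x, y} \<noteq> d" if "c' {x, y} = 2" for x y
  proof (cases "x \<in> A")
    case True
    then have "y \<in> A" "cell x div m = cell y div m" using c'12[OF that] unfolding grp_def by (auto split: if_splits)
    moreover have "clq x = clq y" using that True unfolding c'_def by (auto split: if_splits)
    ultimately show ?thesis using True unfolding clq_def by (metis mult_div_mod_eq)
  next
    case False
    then have "y \<notin> A" using c'12[OF that] unfolding grp_def by (auto split: if_splits)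
    then show ?thesis using that False unfolding c'_def by (auto split: if_splits)
  qed
  have grp0: "grp x = 0 \<longleftrightarrow> x \<notin> A" for x unfolding grp_def by simp
  have side: "\<phi> ` verts G \<subseteq> A \<or> \<phi> ` verts G \<subseteq> V - A" if G: "connected_graph G" and copy: "copy c' i V G \<phi>" and "i \<noteq> 3" for G :: "'z ugraph" and i \<phi>
  proof -
    obtain u where u: "u \<in> verts G" using connected_graphD(3)[OF G] by blast
    have "grp x = grp (\<phi> u)" if "x \<in> \<phi> ` verts G" for x
      by (rule copy_const[OF G copy _ that]) (use c'12 \<open>i \<noteq> 3\<close> u in auto)
    then have "x \<in> A \<longleftrightarrow> \<phi> u \<in> A" if "x \<in> \<phi> ` verts G" for x
      using grp0 that by metis
    then show ?thesis using copyD(2)[OF copy] by (cases "\<phi> u \<in> A") auto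
  qed
  have one: "colourable m G \<or> copy c d (V - A) G \<phi>" if G: "connected_graph G" and copy: "copy c' 1 V G \<phi>" for G :: "'z ugraph" and \<phi>
  proof (cases "\<phi> ` verts G \<subseteq> A")
    case True
    have "colourable m G"
    proof (rule copy_colourable[OF connected_graphD(1)[OF G] copy, of clq])
      show "clq x \<noteq> clq y" if "x \<in> \<phi> ` verts G" "c' {x, y} = 1" for x y
        using c'1[OF that(2)] that(1) True by (auto split: if_splits)
    qed (rule clq_less)
    then show ?thesis ..
  next
    case False
    then have sub: "\<phi> ` verts G \<subseteq> V - A" using side[OF G copy] by simp
    have "copy c d (V - A) G \<phi>"
    proof (rule copy_change[OF connected_graphD(1)[OF G] copy sub])
      show "c {x, y} = d" if "x \<in> \<phi> ` verts G" "c' {x, y} = 1" for x y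
        using c'1[OF that(2)] that(1) sub by (auto split: if_splits)
    qed
    then show ?thesis ..
  qed
  have "pair_free c' V"
    unfolding pair_free_def
  proof (intro notI, elim exE conjE)
    fix i \<phi>1 \<phi>2
    assume c1: "copy c' i V G1 \<phi>1" and c2: "copy c' i V G2 \<phi>2" and dis: "\<phi>1 ` verts G1 \<inter> \<phi>2 ` verts G2 = {}"
    obtain u v where e: "{u, v} \<in> edges G2"
      using connected_graph_edge_at[OF conn2 n2_ge] connected_graphD(3)[OF conn2] by blast
    then have "i = c' {\<phi>2 u, \<phi>2 v}" using copyD(3)[OF c2] by simp
    then consider "i = 1" | "i = 2" | "i = 3" unfolding c'_def by (auto split: if_splits)
    then show False
    proof cases
      case 1
      \<comment> \<open>Inside a group colour 1 is m-partite, so \<phi>2 lies outside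
        \<open>A\<close>. By \<open>alt\<close>, \<phi>1 then cannot lie inside \<open>A\<close>
        either, and both copies have the old colour \<open>d\<close>.\<close>
      then have 2: "copy c d (V - A) G2 \<phi>2" using one[OF conn2] c2 G2 by blast
      then have 1: "copy c d (V - A) G1 \<phi>1" using one[OF conn1] c1 1 alt by blast
      show False
        by (rule pair_freeD[OF free copy_mono[OF 1 Diff_subset] copy_mono[OF 2 Diff_subset] dis])
    next
      case 2
      show False
      proof (cases "\<phi>2 ` verts G2 \<subseteq> A")
        case True
        then have cA: "copy c' i A G2 \<phi>2" using copy_restrict[OF c2] by blast
        obtain u where u: "u \<in> verts G2" using connected_graphD(3)[OF conn2] by blast
        have "cell x = cell (\<phi>2 u)" if "x \<in> \<phi>2 ` verts G2" for x
        proof (rule copy_const[OF conn2 cA _ that])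
          show "cell x = cell y" if "x \<in> A" "c' {x, y} = i" for x y
            using c'2[of x y] that 2 by simp
        qed (use u in simp)
        then have "\<phi>2 ` verts G2 \<subseteq> {x \<in> A. cell x = cell (\<phi>2 u)}" using True by blast
        then have "n2 \<le> card {x \<in> A. cell x = cell (\<phi>2 u)}"
          using card_copy[OF c2] card_mono[of "{x \<in> A. cell x = cell (\<phi>2 u)}" "\<phi>2 ` verts G2"] finA by simp
        then show False using fibre[of "cell (\<phi>2 u)"] by simp
      next
        case False
        then have sub: "\<phi>2 ` verts G2 \<subseteq> V - A" using side[OF conn2 c2] 2 by simp
        have nd: "c {x, y} \<noteq> d" if "x \<in> V - A" "c' {x, y} = i" for x y
          using c'2[of x y] that 2 by auto
        show False
        proof (rule concentrate[OF conn2 n2_ge copy_restrict[OF c2 sub] Diff_subset nd])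
          show False if "j \<noteq> d" "copy c j ((V - A) \<inter> {v. L v = j}) G2 \<phi>2" for j
            using no2[OF that(1)] copy_mono[OF that(2) Int_lower1] by blast
        qed
      qed
    next
      case 3
      have "colourable m G2"
        by (rule copy_colourable[OF simple2 c2, of grp]) (use grp_less c'3 3 in auto)
      then show False using G2 by blast
    qed
  qed
  moreover have "range c' \<subseteq> {1, 2, 3}" unfolding c'_def by auto
  ultimately show ?thesis unfolding has_free_3_colouring_def by blast
qed

text \<open>The function \<open>f\<close> describes a copy of \<^term>\<open>G2\<close> in the join of a part of \<open>V\<^sub>j - A\<close> with a complete
  bipartite graph that is small enough to be moved into \<open>A'\<close> and \<open>W\<close>, leaving room for \<^term>\<open>G1\<close>.\<close>

lemma join_excludes_G2:
  fixes f :: "'v \<Rightarrow> nat" and col :: "'a \<Rightarrow> nat"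
  assumes A: "A \<subseteq> V \<inter> {v. L v = j}" "card A = n2" and A': "A' \<subseteq> V \<inter> {v. L v = j'}" "card A' = n2"
    and "j \<noteq> j'" and W: "W \<subseteq> V" "\<And>x. x \<in> W \<Longrightarrow> L x \<noteq> j \<and> L x \<noteq> j'"
    and col: "\<And>v. v \<in> verts G1 \<Longrightarrow> col v < 3" "\<And>u v. {u, v} \<in> edges G1 \<Longrightarrow> col u \<noteq> col v"
    and y: "card {v \<in> verts G1. col v = 1} \<le> n2" and z: "card {v \<in> verts G1. col v = 2} \<le> card W"
    and copy: "copy c' i S G2 \<phi>"
    and f: "\<And>x. x \<in> \<phi> ` verts G2 \<Longrightarrow> f x < 3"
      "\<And>x. x \<in> \<phi> ` verts G2 \<Longrightarrow> f x = 0 \<Longrightarrow> x \<in> V \<inter> {v. L v = j} - A"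
      "card {x \<in> \<phi> ` verts G2. f x = 1} \<le> n2 - card {v \<in> verts G1. col v = 1}"
      "card {x \<in> \<phi> ` verts G2. f x = 2} \<le> card W - card {v \<in> verts G1. col v = 2}"
      "\<And>x y. x \<in> \<phi> ` verts G2 \<Longrightarrow> y \<in> \<phi> ` verts G2 \<Longrightarrow> x \<noteq> y \<Longrightarrow> c' {x, y} = i \<Longrightarrow>
        f x \<noteq> f y \<or> f x = 0 \<and> f y = 0 \<and> c {x, y} = d"
  shows False
proof -
  have fin: "finite A" "finite A'" "finite W" "finite (\<phi> ` verts G2)"
    using A A' W finV finite_subset connected_graphD(2)[OF conn2] by (blast, blast, blast, blast)
  \<comment> \<open>\<open>G1\<close> is placed on \<open>A\<close>, \<open>Y\<close> and
    \<open>Z\<close> according to its colour classes. The copy of \<open>G2\<close> keeps its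
    vertices with \<open>f x = 0\<close>, which avoid \<open>A\<close>; the others move to what
    \<open>Y\<close> and \<open>Z\<close> leave of \<open>A'\<close> and \<open>W\<close>.\<close>
  obtain Y where Y: "Y \<subseteq> A'" "card Y = card {v \<in> verts G1. col v = 1}"
    using obtain_subset_with_card_n[of "card {v \<in> verts G1. col v = 1}" A'] y A'(2) by auto
  obtain Z where Z: "Z \<subseteq> W" "card Z = card {v \<in> verts G1. col v = 2}"
    using obtain_subset_with_card_n[OF z] by blast
  define Q where "Q l = (if l = 0 then A else if l = 1 then Y else Z)" for l :: nat
  have Q: "Q l \<subseteq> V" for l using A A' W Y Z unfolding Q_def by auto
  have LQ: "L x \<noteq> L y" if "l < 3" "l' < 3" "l \<noteq> l'" "x \<in> Q l" "y \<in> Q l'" for l l' x y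
  proof -
    have "l = 0 \<or> l = 1 \<or> l = 2" "l' = 0 \<or> l' = 1 \<or> l' = 2" using that by auto
    moreover have "L x = j" if "x \<in> A" for x using that A by auto
    moreover have "L x = j'" if "x \<in> Y" for x using that A' Y by auto
    moreover have "L x \<noteq> j \<and> L x \<noteq> j'" if "x \<in> Z" for x using that W Z by auto
    ultimately show ?thesis using that \<open>j \<noteq> j'\<close> unfolding Q_def by (elim disjE) (simp_all, metis+)
  qed
  obtain \<phi>1 where \<phi>1: "copy c d (\<Union>v\<in>verts G1. Q (col v)) G1 \<phi>1"
  proof (rule multipartite_copy[of G1 col Q c d])
    show "finite (Q (col v))" for v using Q finV finite_subset by blast
    show "Q (col u) \<inter> Q (col v) = {}" if "u \<in> verts G1" "v \<in> verts G1" "col u \<noteq> col v" for u v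
      using LQ[OF col(1)[OF that(1)] col(1)[OF that(2)] that(3)] by blast
    show "card {u \<in> verts G1. col u = col v} \<le> card (Q (col v))" if "v \<in> verts G1" for v
    proof -
      have "card {u \<in> verts G1. col u = col v} \<le> n1"
        using connected_graphD(2)[OF conn1] by (intro card_mono) auto
      moreover have "col v = 0 \<or> col v = 1 \<or> col v = 2" using col(1)[OF that] by auto
      ultimately show ?thesis using n1_le_n2 A(2) Y(2) Z(2) unfolding Q_def by auto
    qed
    show "c {x, y} = d" if "u \<in> verts G1" "v \<in> verts G1" "col u \<noteq> col v" "x \<in> Q (col u)" "y \<in> Q (col v)" for u v x y
      using cross[of x y] LQ[OF col(1)[OF that(1)] col(1)[OF that(2)] that(3-5)] Q that by blast
  qed (use simple1 col in auto)
  have img1: "\<phi>1 ` verts G1 \<subseteq> A \<union> Y \<union> Z"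
    using copyD(2)[OF \<phi>1] unfolding Q_def by (auto split: if_splits)
  have "card (A' - Y) = n2 - card {v \<in> verts G1. col v = 1}" "card (W - Z) = card W - card {v \<in> verts G1. col v = 2}"
    using Y Z A'(2) fin by (simp_all add: card_Diff_subset finite_subset)
  then obtain g1 g2 where g1: "inj_on g1 {x \<in> \<phi> ` verts G2. f x = 1}" "g1 ` {x \<in> \<phi> ` verts G2. f x = 1} \<subseteq> A' - Y"
    and g2: "inj_on g2 {x \<in> \<phi> ` verts G2. f x = 2}" "g2 ` {x \<in> \<phi> ` verts G2. f x = 2} \<subseteq> W - Z"
    using card_le_inj[of "{x \<in> \<phi> ` verts G2. f x = 1}" "A' - Y"] card_le_inj[of "{x \<in> \<phi> ` verts G2. f x = 2}" "W - Z"] f(3,4) fin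
    by auto
  define h where "h x = (if f x = 0 then x else if f x = 1 then g1 x else g2 x)" for x
  have h0: "h x \<in> V - A \<and> L (h x) = j" if "x \<in> \<phi> ` verts G2" "f x = 0" for x
    using f(2)[OF that] that(2) unfolding h_def by auto
  have h1: "h x \<in> A' - Y \<and> L (h x) = j'" if "x \<in> \<phi> ` verts G2" "f x = 1" for x
  proof -
    have "h x \<in> A' - Y" using g1(2) that unfolding h_def by auto
    then show ?thesis using A'(1) by auto
  qed
  have h2: "h x \<in> W - Z \<and> L (h x) \<noteq> j \<and> L (h x) \<noteq> j'" if "x \<in> \<phi> ` verts G2" "f x = 2" for x
  proof -
    have "h x \<in> W - Z" using g2(2) that unfolding h_def by auto
    then show ?thesis using W(2) by auto
  qed
  have f3: "f x = 0 \<or> f x = 1 \<or> f x = 2" if "x \<in> \<phi> ` verts G2" for x using f(1)[OF that] by auto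
  have Lh: "L (h x) \<noteq> L (h y)" if "x \<in> \<phi> ` verts G2" "y \<in> \<phi> ` verts G2" "f x \<noteq> f y" for x y
    using f3[OF that(1)] f3[OF that(2)] h0[OF that(1)] h0[OF that(2)] h1[OF that(1)] h1[OF that(2)]
      h2[OF that(1)] h2[OF that(2)] that(3) \<open>j \<noteq> j'\<close> by metis
  have hV: "h x \<in> V" if "x \<in> \<phi> ` verts G2" for x
    using f3[OF that] h0[OF that] h1[OF that] h2[OF that] A' W(1) by blast
  have "copy c d V G2 (h \<circ> \<phi>)"
  proof (rule copy_transport[OF simple2 copy])
    show "inj_on h (\<phi> ` verts G2)"
    proof (rule inj_onI)
      fix x y assume xy: "x \<in> \<phi> ` verts G2" "y \<in> \<phi> ` verts G2" "h x = h y"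
      then have "f x = f y" using Lh by metis
      with f3[OF xy(1)] consider "f x = 0" "f y = 0" | "f x = 1" "f y = 1" | "f x = 2" "f y = 2" by auto
      then show "x = y"
      proof cases
        case 1
        then show ?thesis using xy(3) unfolding h_def by simp
      next
        case 2
        then show ?thesis using inj_onD[OF g1(1), of x y] xy unfolding h_def by simp
      next
        case 3
        then show ?thesis using inj_onD[OF g2(1), of x y] xy unfolding h_def by simp
      qed
    qed
    show "h ` \<phi> ` verts G2 \<subseteq> V" using hV by blast
    fix x y assume xy: "x \<in> \<phi> ` verts G2" "y \<in> \<phi> ` verts G2" "x \<noteq> y" "c' {x, y} = i"
    from f(5)[OF this] show "c {h x, h y} = d"
    proof
      assume "f x \<noteq> f y"
      then show ?thesis using cross[OF hV[OF xy(1)] hV[OF xy(2)]] Lh[OF xy(1,2)] by blast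
    qed (simp add: h_def)
  qed
  moreover have "copy c d V G1 \<phi>1"
    using copy_mono[OF \<phi>1] Q by blast
  moreover have "\<phi>1 ` verts G1 \<inter> (h \<circ> \<phi>) ` verts G2 = {}"
  proof -
    have "h x \<notin> A \<union> Y \<union> Z" if "x \<in> \<phi> ` verts G2" for x
    proof -
      have "h x \<in> A \<Longrightarrow> L (h x) = j" "h x \<in> A' \<Longrightarrow> L (h x) = j'" using A(1) A'(1) by auto
      moreover have "h x \<in> Y \<Longrightarrow> h x \<in> A'" "h x \<in> Z \<Longrightarrow> h x \<in> W" using Y(1) Z(1) by auto
      ultimately show ?thesis
        using f3[OF that] h0[OF that] h1[OF that] h2[OF that] W(2)[of "h x"] \<open>j \<noteq> j'\<close>
        unfolding Un_iff Diff_iff by metis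
    qed
    then show ?thesis using img1 by auto
  qed
  ultimately show False using pair_freeD[OF free] by blast
qed

text \<open>Edges of colour \<open>d\<close> keep a class of their own; other edges inside V_j1 and
  V_j2 become colours 2 and 3. The remaining vertices are halved: colour 2 is used inside the
  halves, which have fewer than \<open>n1\<close> vertices each, and colour 3 between them, where it
  is bipartite while \<open>G1\<close> is not. So copies of \<open>G1\<close> in colours 2 and 3
  come from the old colours \<open>j1\<close> and \<open>j2\<close>.\<close>

lemma few_outside:
  assumes n1: "2 \<le> n1" and j: "j1 \<noteq> j2" "j1 \<noteq> d" "j2 \<noteq> d"
    and G1: "\<not> colourable 2 G1" and W: "card {v \<in> V. L v \<noteq> j1 \<and> L v \<noteq> j2} \<le> 2 * (n1 - 1)"
  shows "has_free_3_colouring V"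
proof -
  define W where "W = {v \<in> V. L v \<noteq> j1 \<and> L v \<noteq> j2}"
  have finW: "finite W" using finV unfolding W_def by simp
  obtain W' where W': "W' \<subseteq> W" "card W' = min (card W) (n1 - 1)"
    using obtain_subset_with_card_n[of "min (card W) (n1 - 1)" W] by auto
  have half: "card W' < n1" "card (W - W') < n1"
    using W' n1 W finite_subset[OF W'(1) finW] unfolding W_def[symmetric] by (simp_all add: card_Diff_subset)
  define z where "z x = (if L x = j1 then 0 else if L x = j2 then 1 else if x \<in> W' then 2 else 3 :: nat)" for x
  define c' where "c' e = (if c e = d then 1 else if \<exists>x\<in>e. L x = j1 then 2 else if \<exists>x\<in>e. L x = j2 then 3
      else if \<exists>x\<in>e. \<exists>y\<in>e. z x \<noteq> z y then 3 else (2::nat))" for e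
  have z2: "x \<in> W'" if "z x = 2" for x
    using that unfolding z_def by (auto split: if_splits)
  have z3: "x \<in> W - W'" if "x \<in> V" "z x = 3" for x
    using that unfolding z_def W_def by (auto split: if_splits)
  have c'1: "c {x, y} = d" if "c' {x, y} = 1" for x y
    using that unfolding c'_def by (auto split: if_splits)
  have c'2: "z x = z y \<and> z x \<noteq> 1 \<and> (L x = j1 \<longrightarrow> c {x, y} = j1)" if "x \<in> V" "y \<in> V" "x \<noteq> y" "c' {x, y} = 2" for x y
  proof -
    have "c {x, y} \<noteq> d" using that(4) unfolding c'_def by auto
    then have "c {x, y} = L x" "L x = L y" using dom[OF that(1-3)] by auto
    then show ?thesis using that(4) j unfolding c'_def z_def by (auto split: if_splits)
  qed
  have c'3: "L x = L y \<and> L x \<noteq> j1 \<and> (L x = j2 \<longrightarrow> c {x, y} = j2) \<and> (L x \<noteq> j2 \<longrightarrow> z x \<noteq> z y)"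
    if "x \<in> V" "y \<in> V" "x \<noteq> y" "c' {x, y} = 3" for x y
  proof -
    have "c {x, y} \<noteq> d" using that(4) unfolding c'_def by auto
    then have "c {x, y} = L x" "L x = L y" using dom[OF that(1-3)] by auto
    then show ?thesis using that(4) j unfolding c'_def by (auto split: if_splits)
  qed
  have two: "L x = j1" if copy: "copy c' 2 V G1 \<phi>" and x: "x \<in> \<phi> ` verts G1" for \<phi> x
  proof (rule ccontr)
    assume Lx: "L x \<noteq> j1"
    obtain p q where pq: "p \<in> \<phi> ` verts G1" "q \<in> \<phi> ` verts G1" "p \<noteq> q" "c' {p, q} = 2"
      using copy_edge[OF conn1 n1 copy] by blast
    have const: "z y = z x" if "y \<in> \<phi> ` verts G1" for y
      by (rule copy_const[OF conn1 copy _ that x]) (use c'2 in blast)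
    have "z p \<noteq> 1" using c'2[OF _ _ pq(3,4)] pq copyD(2)[OF copy] by blast
    then have "z x = 2 \<or> z x = 3" using const[OF pq(1)] Lx unfolding z_def by (auto split: if_splits)
    moreover have "\<phi> ` verts G1 \<subseteq> W'" if "z x = 2"
      using const that z2 by auto
    moreover have "\<phi> ` verts G1 \<subseteq> W - W'" if "z x = 3"
      using const that z3 copyD(2)[OF copy] by (metis subset_iff)
    ultimately have "n1 \<le> card W' \<or> n1 \<le> card (W - W')"
      using card_copy[OF copy] card_mono[of W' "\<phi> ` verts G1"] card_mono[of "W - W'" "\<phi> ` verts G1"]
        finite_subset[OF W'(1) finW] finW by auto
    then show False using half by auto
  qed
  have three: "L x = j2" if copy: "copy c' 3 V G1 \<phi>" and x: "x \<in> \<phi> ` verts G1" for \<phi> x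
  proof (rule ccontr)
    assume Lx: "L x \<noteq> j2"
    have const: "L y = L x" if "y \<in> \<phi> ` verts G1" for y
      by (rule copy_const[OF conn1 copy _ that x]) (use c'3 in blast)
    obtain p q where pq: "p \<in> \<phi> ` verts G1" "q \<in> \<phi> ` verts G1" "p \<noteq> q" "c' {p, q} = 3"
      using copy_edge[OF conn1 n1 copy] by blast
    have "L p \<noteq> j1" using c'3[OF _ _ pq(3,4)] pq copyD(2)[OF copy] by blast
    then have z23: "z y = 2 \<or> z y = 3" if "y \<in> \<phi> ` verts G1" for y
      using const[OF that] const[OF pq(1)] Lx unfolding z_def by auto
    have "colourable 2 G1"
    proof (rule copy_colourable[OF simple1 copy, of "\<lambda>x. z x - 2"])
      show "z y - 2 < 2" if "y \<in> \<phi> ` verts G1" for y using z23[OF that] by auto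
      show "z y - 2 \<noteq> z y' - 2" if y: "y \<in> \<phi> ` verts G1" "y' \<in> \<phi> ` verts G1" "y \<noteq> y'" "c' {y, y'} = 3" for y y'
      proof -
        have "z y \<noteq> z y'"
          using c'3[OF subsetD[OF copyD(2)[OF copy] y(1)] subsetD[OF copyD(2)[OF copy] y(2)] y(3,4)] const[OF y(1)] Lx by simp
        then show ?thesis using z23[OF y(1)] z23[OF y(2)] by auto
      qed
    qed
    then show False using G1 by blast
  qed
  text \<open>By connectivity a copy of \<^term>\<open>G2\<close> lies where the copies of \<^term>\<open>G1\<close> inside it do.\<close>
  have two2: "L x = j1" if copy: "copy c' 2 V G2 \<phi>" and x: "x \<in> \<phi> ` verts G2" for \<phi> x
  proof -
    obtain u where u: "u \<in> verts G1" using connected_graphD(3)[OF conn1] by blast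
    then have "emb u \<in> verts G2" using emb unfolding embedding_def by auto
    then have "z x = z (\<phi> (emb u))"
      by (intro copy_const[OF conn2 copy _ x]) (use c'2 in auto)
    moreover have "L (\<phi> (emb u)) = j1" using two[OF copy_sub[OF copy], of "\<phi> (emb u)"] u by auto
    ultimately show ?thesis unfolding z_def by (auto split: if_splits)
  qed
  have three2: "L x = j2" if copy: "copy c' 3 V G2 \<phi>" and x: "x \<in> \<phi> ` verts G2" for \<phi> x
  proof -
    obtain u where u: "u \<in> verts G1" using connected_graphD(3)[OF conn1] by blast
    then have "emb u \<in> verts G2" using emb unfolding embedding_def by auto
    then have "L x = L (\<phi> (emb u))"
      by (intro copy_const[OF conn2 copy _ x]) (use c'3 in auto)
    moreover have "L (\<phi> (emb u)) = j2" using three[OF copy_sub[OF copy], of "\<phi> (emb u)"] u by auto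
    ultimately show ?thesis by simp
  qed
  have "pair_free c' V"
    unfolding pair_free_def
  proof (intro notI, elim exE conjE)
    fix i \<phi>1 \<phi>2
    assume c1: "copy c' i V G1 \<phi>1" and c2: "copy c' i V G2 \<phi>2" and dis: "\<phi>1 ` verts G1 \<inter> \<phi>2 ` verts G2 = {}"
    obtain p q where "c' {p, q} = i" using copy_edge[OF conn2 n2_ge c2] by blast
    then consider "i = 1" | "i = 2" | "i = 3" unfolding c'_def by (auto split: if_splits)
    then show False
    proof cases
      case 1
      then show False using pair_free_class[OF free c1 c2 dis] c'1 by blast
    next
      case 2
      note c1' = c1[unfolded 2] and c2' = c2[unfolded 2]
      have "c {x, y} = j1" if "x \<in> \<phi>1 ` verts G1" "y \<in> \<phi>1 ` verts G1" "x \<noteq> y" "c' {x, y} = 2" for x y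
        using c'2[OF subsetD[OF copyD(2)[OF c1'] that(1)] subsetD[OF copyD(2)[OF c1'] that(2)] that(3,4)] two[OF c1' that(1)]
        by simp
      then have 1: "copy c j1 V G1 \<phi>1" by (rule copy_change[OF simple1 c1' copyD(2)[OF c1']])
      have "c {x, y} = j1" if "x \<in> \<phi>2 ` verts G2" "y \<in> \<phi>2 ` verts G2" "x \<noteq> y" "c' {x, y} = 2" for x y
        using c'2[OF subsetD[OF copyD(2)[OF c2'] that(1)] subsetD[OF copyD(2)[OF c2'] that(2)] that(3,4)] two2[OF c2' that(1)]
        by simp
      then have 2: "copy c j1 V G2 \<phi>2" by (rule copy_change[OF simple2 c2' copyD(2)[OF c2']])
      show False by (rule pair_freeD[OF free 1 2 dis])
    next
      case 3
      note c1' = c1[unfolded 3] and c2' = c2[unfolded 3]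
      have "c {x, y} = j2" if "x \<in> \<phi>1 ` verts G1" "y \<in> \<phi>1 ` verts G1" "x \<noteq> y" "c' {x, y} = 3" for x y
        using c'3[OF subsetD[OF copyD(2)[OF c1'] that(1)] subsetD[OF copyD(2)[OF c1'] that(2)] that(3,4)] three[OF c1' that(1)]
        by simp
      then have 1: "copy c j2 V G1 \<phi>1" by (rule copy_change[OF simple1 c1' copyD(2)[OF c1']])
      have "c {x, y} = j2" if "x \<in> \<phi>2 ` verts G2" "y \<in> \<phi>2 ` verts G2" "x \<noteq> y" "c' {x, y} = 3" for x y
        using c'3[OF subsetD[OF copyD(2)[OF c2'] that(1)] subsetD[OF copyD(2)[OF c2'] that(2)] that(3,4)] three2[OF c2' that(1)]
        by simp
      then have 2: "copy c j2 V G2 \<phi>2" by (rule copy_change[OF simple2 c2' copyD(2)[OF c2']])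
      show False by (rule pair_freeD[OF free 1 2 dis])
    qed
  qed
  moreover have "range c' \<subseteq> {1, 2, 3}" unfolding c'_def by auto
  ultimately show ?thesis unfolding has_free_3_colouring_def by blast
qed

text \<open>Colour 3 joins two halves, each consisting of one of the sets \<open>V\<^sub>j - A\<^sub>j\<close> and two cliques of
  colour 2, with colour 1 between these three sets. The clique sizes are chosen such that a copy of
  \<^term>\<open>G2\<close> in colour 1 could be moved back into the original colouring.\<close>

lemma bipartite_blowup:
  fixes col :: "'a \<Rightarrow> nat"
  assumes j: "j1 \<noteq> j2" "j1 \<noteq> d" "j2 \<noteq> d"
    and A1: "A1 \<subseteq> V \<inter> {v. L v = j1}" "card A1 = n2" "\<And>\<phi>. \<not> copy c j1 (V - A1) G1 \<phi>"
    and A2: "A2 \<subseteq> V \<inter> {v. L v = j2}" "card A2 = n2" "\<And>\<phi>. \<not> copy c j2 (V - A2) G1 \<phi>"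
    and W: "W = {v \<in> V. L v \<noteq> j1 \<and> L v \<noteq> j2}" "card W < n2"
    and G2: "\<not> colourable 2 G2"
    and col: "\<And>v. v \<in> verts G1 \<Longrightarrow> col v < 3" "\<And>u v. {u, v} \<in> edges G1 \<Longrightarrow> col u \<noteq> col v"
    and y: "y = card {v \<in> verts G1. col v = 1}" "1 \<le> y" and z: "z = card {v \<in> verts G1. col v = 2}"
    and yz: "2 * (y + z) \<le> card W"
  shows "has_free_3_colouring V"
proof -
  define X where "X = A1 \<union> A2 \<union> W"
  \<comment> \<open>\<alpha> is what remains of \<open>A1\<close> or \<open>A2\<close>, and \<beta>
    what remains of \<open>W\<close>, after class 1 or class 2 of \<open>G1\<close> has been placed
    there. Two cells of each size hold all of \<open>X\<close> because
    \<open>2 * (y + z) \<le> card W\<close>, and every cell is smaller than \<open>n2\<close>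
    because \<open>1 \<le> y\<close> and \<open>card W < n2\<close>.\<close>
  define \<alpha> where "\<alpha> = n2 - y"
  define \<beta> where "\<beta> = card W - z"
  have fin: "finite A1" "finite A2" "finite W" using A1(1) A2(1) W(1) finV by (auto intro: finite_subset)
  have XV: "X \<subseteq> V" using A1(1) A2(1) W(1) unfolding X_def by auto
  have "card X = 2 * n2 + card W"
  proof -
    have "A1 \<inter> A2 = {}" "(A1 \<union> A2) \<inter> W = {}" using A1(1) A2(1) W(1) j by auto
    then show ?thesis using A1(2) A2(2) fin unfolding X_def by (simp add: card_Un_disjoint)
  qed
  have finX: "finite X" using fin unfolding X_def by simp
  have "y \<le> n2"
    using n1_le_n2 card_mono[OF connected_graphD(2)[OF conn1], of "{v \<in> verts G1. col v = 1}"] y(1) by auto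
  then have size: "card X \<le> 2 * (\<alpha> + \<beta>)" "\<alpha> < n2" "\<beta> < n2"
    using \<open>card X = _\<close> yz y(2) W(2) unfolding \<alpha>_def \<beta>_def by auto
  obtain h where h: "bij_betw h X {0..<card X}" using ex_bij_betw_finite_nat[OF finX] by blast
  define cell :: "'v \<Rightarrow> nat" where
    "cell x = (if h x < \<alpha> then 0 else if h x < \<alpha> + \<beta> then 1 else if h x < 2 * \<alpha> + \<beta> then 2 else 3)" for x
  define bound where "bound l = (if even l then \<alpha> else \<beta>)" for l :: nat
  have fibre: "card {x \<in> X. cell x = l} \<le> bound l" for l
  proof -
    define lo where "lo = (if l = 0 then 0 else if l = 1 then \<alpha> else if l = 2 then \<alpha> + \<beta> else 2 * \<alpha> + \<beta>)"
    have "h ` {x \<in> X. cell x = l} \<subseteq> {lo..<lo + bound l}"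
    proof
      fix n assume "n \<in> h ` {x \<in> X. cell x = l}"
      then obtain x where x: "x \<in> X" "cell x = l" "n = h x" by blast
      then have "h x \<in> {0..<card X}" using bij_betwE[OF h] by blast
      then have "h x < 2 * (\<alpha> + \<beta>)" using size(1) by simp
      then show "n \<in> {lo..<lo + bound l}"
        using x unfolding cell_def lo_def bound_def by (auto split: if_splits)
    qed
    moreover have "inj_on h {x \<in> X. cell x = l}"
      using h unfolding bij_betw_def by (auto intro: inj_on_subset)
    ultimately have "card {x \<in> X. cell x = l} \<le> card {lo..<lo + bound l}"
      by (intro card_inj_on_le) auto
    then show ?thesis by simp
  qed
  have cell4: "cell x < 4" for x unfolding cell_def by simp
  \<comment> \<open>Cells 0 and 1 join the half of \<open>j1\<close>, cells 2 and 3 that of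
    \<open>j2\<close>, so each half gets one cell of either size.\<close>
  define sd where "sd x = (if x \<in> X then cell x div 2 else if L x = j1 then 0 else 1)" for x
  define kd where "kd x = (if x \<in> X then Suc (cell x) else 0)" for x
  have sd2: "sd x < 2" for x using cell4[of x] unfolding sd_def by auto
  define c' where "c' e = (if \<exists>x\<in>e. \<exists>y\<in>e. sd x \<noteq> sd y then 3
      else if e \<inter> X = {} then if c e = d then 1 else 2
      else if \<exists>x\<in>e. \<exists>y\<in>e. kd x \<noteq> kd y then 1 else (2::nat))" for e
  have c'3: "sd x \<noteq> sd y" if "c' {x, y} = 3" for x y
    using that unfolding c'_def by (auto split: if_splits)
  have c'12: "sd x = sd y" if "c' {x, y} = i" "i \<noteq> 3" for x y i
    using that unfolding c'_def by (auto split: if_splits)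
  have kd0: "kd x = 0 \<longleftrightarrow> x \<notin> X" for x unfolding kd_def by simp
  have c'1: "kd x \<noteq> kd y \<or> x \<notin> X \<and> y \<notin> X \<and> c {x, y} = d" if "c' {x, y} = 1" for x y
    using that unfolding c'_def by (auto split: if_splits)
  have c'2: "kd x = kd y" "x \<notin> X \<Longrightarrow> c {x, y} \<noteq> d" if "c' {x, y} = 2" for x y
  proof -
    show "kd x = kd y" using that kd0[of x] kd0[of y] unfolding c'_def by (auto split: if_splits)
    then have "x \<in> X \<longleftrightarrow> y \<in> X" using kd0 by metis
    then show "x \<notin> X \<Longrightarrow> c {x, y} \<noteq> d" using that unfolding c'_def by (auto split: if_splits)
  qed
  have outX: "L x = j1 \<or> L x = j2" if "x \<in> V - X" for x
    using that W(1) unfolding X_def by auto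
  have B1: "L x = j1 \<and> x \<notin> A1" if "x \<in> V - X" "sd x = 0" for x
    using that unfolding sd_def X_def by (auto split: if_splits)
  have B2: "L x = j2 \<and> x \<notin> A2" if "x \<in> V - X" "sd x = 1" for x
    using that outX[OF that(1)] unfolding sd_def X_def by (auto split: if_splits)
  have one: False
    if copy: "copy c' 1 V G2 \<phi>" and t: "\<And>x. x \<in> \<phi> ` verts G2 \<Longrightarrow> sd x = t"
      and B: "\<And>x. x \<in> V - X \<Longrightarrow> sd x = t \<Longrightarrow> L x = j \<and> x \<notin> A"
      and A: "A \<subseteq> V \<inter> {v. L v = j}" "card A = n2" and A': "A' \<subseteq> V \<inter> {v. L v = j'}" "card A' = n2"
      and jj: "j \<noteq> j'" "{j, j'} = {j1, j2}" for \<phi> t j j' A A'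
  proof -
    \<comment> \<open>Within one half: 0 for what is left of V_j, 1 for the cell bounded by
      \<alpha>, 2 for the cell bounded by \<beta>, as \<open>join_excludes_G2\<close>
      requires.\<close>
    define f where "f x = (if x \<in> X then Suc (cell x mod 2) else 0)" for x
    have "t < 2" using t sd2 connected_graphD(3)[OF conn2] by blast
    have img: "x \<in> V" if "x \<in> \<phi> ` verts G2" for x using that copyD(2)[OF copy] by blast
    have cell_f: "cell x = 2 * t + (f x - 1)" if "x \<in> \<phi> ` verts G2" "x \<in> X" for x
      using t[OF that(1)] that(2) mult_div_mod_eq[of 2 "cell x"] unfolding sd_def f_def by simp
    have small: "card {x \<in> \<phi> ` verts G2. f x = Suc l} \<le> bound (2 * t + l)" for l
    proof -
      have "{x \<in> \<phi> ` verts G2. f x = Suc l} \<subseteq> {x \<in> X. cell x = 2 * t + l}"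
        using cell_f unfolding f_def by (auto split: if_splits)
      then have "card {x \<in> \<phi> ` verts G2. f x = Suc l} \<le> card {x \<in> X. cell x = 2 * t + l}"
        using finX by (intro card_mono) simp_all
      then show ?thesis using fibre[of "2 * t + l"] by simp
    qed
    show False
    proof (rule join_excludes_G2[where W = W and f = f and col = col, OF A A' jj(1) _ _ _ _ _ _ copy])
      show "W \<subseteq> V" using W(1) by blast
      show "L x \<noteq> j \<and> L x \<noteq> j'" if "x \<in> W" for x
        using that W(1) jj by (auto simp: doubleton_eq_iff)
      show "col v < 3" if "v \<in> verts G1" for v by (rule col(1)[OF that])
      show "col u \<noteq> col v" if "{u, v} \<in> edges G1" for u v by (rule col(2)[OF that])
      show "card {v \<in> verts G1. col v = 1} \<le> n2" using \<open>y \<le> n2\<close> y(1) by simp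
      show "card {v \<in> verts G1. col v = 2} \<le> card W" using yz z by simp
      show "f x < 3" for x unfolding f_def by auto
      show "x \<in> V \<inter> {v. L v = j} - A" if "x \<in> \<phi> ` verts G2" "f x = 0" for x
      proof -
        have "x \<in> V - X" using that img unfolding f_def by (auto split: if_splits)
        then show ?thesis using B t[OF that(1)] by blast
      qed
      show "card {x \<in> \<phi> ` verts G2. f x = 1} \<le> n2 - card {v \<in> verts G1. col v = 1}"
        using small[of 0] y(1) unfolding bound_def \<alpha>_def by simp
      show "card {x \<in> \<phi> ` verts G2. f x = 2} \<le> card W - card {v \<in> verts G1. col v = 2}"
        using small[of 1, unfolded Suc_1] z unfolding bound_def \<beta>_def by simp
      show "f x \<noteq> f x' \<or> f x = 0 \<and> f x' = 0 \<and> c {x, x'} = d"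
        if xx: "x \<in> \<phi> ` verts G2" "x' \<in> \<phi> ` verts G2" "c' {x, x'} = 1" for x x'
      proof -
        have "kd x = kd x'" if "f x = f x'"
          using that cell_f[OF xx(1)] cell_f[OF xx(2)] unfolding kd_def f_def by (auto split: if_splits)
        moreover have "f x = 0 \<longleftrightarrow> x \<notin> X" "f x' = 0 \<longleftrightarrow> x' \<notin> X" unfolding f_def by simp_all
        ultimately show ?thesis using c'1[OF xx(3)] by blast
      qed
    qed
  qed
  have "pair_free c' V"
    unfolding pair_free_def
  proof (intro notI, elim exE conjE)
    fix i \<phi>1 \<phi>2
    assume c1: "copy c' i V G1 \<phi>1" and c2: "copy c' i V G2 \<phi>2" and dis: "\<phi>1 ` verts G1 \<inter> \<phi>2 ` verts G2 = {}"
    obtain u where u: "u \<in> verts G2" using connected_graphD(3)[OF conn2] by blast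
    have const: "sd x = sd (\<phi>2 u)" if "x \<in> \<phi>2 ` verts G2" "i \<noteq> 3" for x
      by (rule copy_const[OF conn2 c2 _ that(1)]) (use c'12 that(2) u in auto)
    obtain p q where "c' {p, q} = i" using copy_edge[OF conn2 n2_ge c2] by blast
    then consider "i = 1" | "i = 2" | "i = 3" unfolding c'_def by (auto split: if_splits)
    then show False
    proof cases
      case 1
      note c2' = c2[unfolded 1]
      have t: "sd x = sd (\<phi>2 u)" if "x \<in> \<phi>2 ` verts G2" for x using const[OF that] 1 by simp
      consider "sd (\<phi>2 u) = 0" | "sd (\<phi>2 u) = 1" using sd2[of "\<phi>2 u"] by linarith
      then show False
      proof cases
        case 1
        show False by (rule one[OF c2' _ B1 A1(1,2) A2(1,2) j(1)]) (simp_all add: t 1)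
      next
        case 2
        show False by (rule one[OF c2' _ B2 A2(1,2) A1(1,2) j(1)[symmetric]]) (simp_all add: t 2 insert_commute)
      qed
    next
      case 2
      note c2' = c2[unfolded 2]
      have kd: "kd x = kd (\<phi>2 u)" if "x \<in> \<phi>2 ` verts G2" for x
        by (rule copy_const[OF conn2 c2' _ that]) (use c'2 u in auto)
      show False
      proof (cases "\<phi>2 u \<in> X")
        case True
        have "x \<in> X \<and> cell x = cell (\<phi>2 u)" if "x \<in> \<phi>2 ` verts G2" for x
          using kd[OF that] True unfolding kd_def by (simp split: if_split_asm)
        then have "\<phi>2 ` verts G2 \<subseteq> {x \<in> X. cell x = cell (\<phi>2 u)}" by blast
        then have "n2 \<le> card {x \<in> X. cell x = cell (\<phi>2 u)}"
          using card_copy[OF c2] card_mono[of "{x \<in> X. cell x = cell (\<phi>2 u)}" "\<phi>2 ` verts G2"] finX by simp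
        then show False using fibre[of "cell (\<phi>2 u)"] size(2,3) unfolding bound_def by (auto split: if_splits)
      next
        case False
        have sub: "\<phi>2 ` verts G2 \<subseteq> V - X"
          using kd kd0 False copyD(2)[OF c2] by (metis DiffI subset_iff)
        show False
        proof (rule concentrate[OF conn2 n2_ge copy_restrict[OF c2' sub] Diff_subset])
          show "c {x, y} \<noteq> d" if "x \<in> V - X" "c' {x, y} = 2" for x y using c'2(2)[OF that(2)] that(1) by blast
          fix j x y assume cj: "copy c j ((V - X) \<inter> {v. L v = j}) G2 \<phi>2"
          have "\<phi>2 u \<in> (V - X) \<inter> {v. L v = j}" using copyD(2)[OF cj] u by blast
          then have "j = j1 \<or> j = j2" using outX by blast
          moreover have "(V - X) \<inter> {v. L v = j} \<subseteq> V - A1" "(V - X) \<inter> {v. L v = j} \<subseteq> V - A2" unfolding X_def by auto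
          ultimately show False using copy_mono[OF copy_sub[OF cj]] A1(3) A2(3) by metis
        qed
      qed
    next
      case 3
      have "colourable 2 G2"
        by (rule copy_colourable[OF simple2 c2, of sd]) (use sd2 c'3 3 in auto)
      then show False using G2 by blast
    qed
  qed
  moreover have "range c' \<subseteq> {1, 2, 3}" unfolding c'_def by auto
  ultimately show ?thesis unfolding has_free_3_colouring_def by blast
qed

text \<open>The copies of \<open>G2\<close> in \<open>j1\<close> and \<open>j2\<close> exclude a
  proper 2-colouring of \<open>G2\<close>. As \<open>G2\<close> is 3-colourable, \<open>W\<close>
  cannot serve as a third part, so \<open>card W < n2\<close>; but colour \<open>j3\<close> puts at
  least \<open>n1\<close> vertices into \<open>W\<close>. If \<open>G1\<close> is bipartite or
  \<open>W\<close> is large, the cells of \<open>bipartite_blowup\<close> suffice; otherwise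
  \<open>few_outside\<close> applies.\<close>

lemma two_has2_three_colourable:
  assumes has: "has2 j1" "has2 j2" "j1 \<noteq> j2" "has1 j3" "j3 \<noteq> j1" "j3 \<noteq> j2" and G2: "colourable 3 G2"
  shows "has_free_3_colouring V"
proof -
  have n1: "2 \<le> n1" by (rule n1_ge[OF has(1)])
  have jd: "j1 \<noteq> d" "j2 \<noteq> d" using has(1,2) unfolding has2_def by auto
  obtain A1 where A1: "A1 \<subseteq> V \<inter> {v. L v = j1}" "card A1 = n2" "\<And>\<phi>. \<not> copy c j1 (V - A1) G1 \<phi>"
    using has2_part[OF has(1)] by blast
  obtain A2 where A2: "A2 \<subseteq> V \<inter> {v. L v = j2}" "card A2 = n2" "\<And>\<phi>. \<not> copy c j2 (V - A2) G1 \<phi>"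
    using has2_part[OF has(2)] by blast
  obtain A3 where A3: "A3 \<subseteq> V \<inter> {v. L v = j3}" "card A3 = n1" by (rule has1_part[OF has(4) n1])
  define W where "W = {v \<in> V. L v \<noteq> j1 \<and> L v \<noteq> j2}"
  have "A3 \<subseteq> W" using A3(1) has(5,6) unfolding W_def by auto
  then have n1W: "n1 \<le> card W" using A3(2) card_mono[of W A3] finV unfolding W_def by simp
  have LA: "x \<in> A1 \<Longrightarrow> L x = j1" "x \<in> A2 \<Longrightarrow> L x = j2" "x \<in> W \<Longrightarrow> L x \<noteq> j1 \<and> L x \<noteq> j2" for x
    using A1(1) A2(1) unfolding W_def by auto
  have not2: "\<not> colourable 2 G2"
  proof (rule parts_not_colourable[of 2 "\<lambda>l. if l = 0 then A1 else A2"])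
    show "L x \<noteq> L y" if "l < 2" "l' < 2" "l \<noteq> l'" "x \<in> (if l = 0 then A1 else A2)" "y \<in> (if l' = 0 then A1 else A2)"
      for l l' :: nat and x y
      using that LA has(3) by (cases "l = 0"; cases "l' = 0") auto
  qed (use A1 A2 in \<open>auto split: if_splits\<close>)
  have "card W < n2"
  proof (rule ccontr)
    assume "\<not> card W < n2"
    then have "\<not> colourable 3 G2"
    proof (intro parts_not_colourable[of 3 "\<lambda>l. if l = 0 then A1 else if l = 1 then A2 else W"])
      show "L x \<noteq> L y" if "l < 3" "l' < 3" "l \<noteq> l'" "x \<in> (if l = 0 then A1 else if l = 1 then A2 else W)"
        "y \<in> (if l' = 0 then A1 else if l' = 1 then A2 else W)" for l l' :: nat and x y
      proof -
        have "l = 0 \<or> l = 1 \<or> l = 2" "l' = 0 \<or> l' = 1 \<or> l' = 2" using that by auto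
        then show ?thesis using that has(3) LA by (elim disjE) (simp_all, metis+)
      qed
    qed (use A1 A2 in \<open>auto simp: W_def split: if_splits\<close>)
    then show False using G2 by blast
  qed
  show ?thesis
  proof (cases "\<not> colourable 2 G1 \<and> card W \<le> 2 * (n1 - 1)")
    case True
    then show ?thesis using few_outside[OF n1 has(3) jd] unfolding W_def by blast
  next
    case False
    obtain col0 :: "'a \<Rightarrow> nat" where col0: "\<And>v. v \<in> verts G1 \<Longrightarrow> col0 v < 3" "\<And>u v. {u, v} \<in> edges G1 \<Longrightarrow> col0 u \<noteq> col0 v"
      and two: "card {v \<in> verts G1. col0 v = 2} = 0 \<or> 2 * n1 \<le> card W + 1"
    proof (cases "colourable 2 G1")
      case True
      then obtain k :: "'a \<Rightarrow> nat" where k: "k ` verts G1 \<subseteq> {..<2}" "\<And>u v. {u, v} \<in> edges G1 \<Longrightarrow> k u \<noteq> k v"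
        unfolding colourable_def by blast
      have k2: "k v < 2" if "v \<in> verts G1" for v using k(1) that by auto
      then have e: "{v \<in> verts G1. k v = 2} = {}" by fastforce
      show ?thesis
      proof (rule that[of k])
        show "k v < 3" if "v \<in> verts G1" for v using k2[OF that] by simp
        show "k u \<noteq> k v" if "{u, v} \<in> edges G1" for u v by (rule k(2)[OF that])
        show "card {v \<in> verts G1. k v = 2} = 0 \<or> 2 * n1 \<le> card W + 1" unfolding e by simp
      qed
    next
      case F: False
      obtain k :: "'a \<Rightarrow> nat" where k: "k ` verts G1 \<subseteq> {..<3}" "\<And>u v. {u, v} \<in> edges G1 \<Longrightarrow> k u \<noteq> k v"
        using colourable_sub[OF G2] unfolding colourable_def by blast
      show ?thesis
      proof (rule that[of k])
        show "k v < 3" if "v \<in> verts G1" for v using k(1) that by auto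
        show "k u \<noteq> k v" if "{u, v} \<in> edges G1" for u v by (rule k(2)[OF that])
        show "card {v \<in> verts G1. k v = 2} = 0 \<or> 2 * n1 \<le> card W + 1" using False F by linarith
      qed
    qed
    obtain col :: "'a \<Rightarrow> nat" where col: "\<And>v. v \<in> verts G1 \<Longrightarrow> col v < 3" "\<And>u v. {u, v} \<in> edges G1 \<Longrightarrow> col u \<noteq> col v"
      and s: "card {v \<in> verts G1. col v = 1} \<le> card {v \<in> verts G1. col v = 0}"
        "card {v \<in> verts G1. col v = 2} \<le> card {v \<in> verts G1. col v = 1}"
        "card {v \<in> verts G1. col v = 2} \<le> card {v \<in> verts G1. col0 v = 2}"
    proof (rule sorted_three_colouring[where G = G1 and col = col0])
      fix k :: "'a \<Rightarrow> nat"
      assume "\<And>v. v \<in> verts G1 \<Longrightarrow> k v < 3" "\<And>u v. {u, v} \<in> edges G1 \<Longrightarrow> k u \<noteq> k v"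
        "card {v \<in> verts G1. k v = 1} \<le> card {v \<in> verts G1. k v = 0}"
        "card {v \<in> verts G1. k v = 2} \<le> card {v \<in> verts G1. k v = 1}"
        "card {v \<in> verts G1. k v = 2} \<le> card {v \<in> verts G1. col0 v = 2}"
      then show thesis by (rule that)
    qed (use col0 simple1 in auto)
    have fin1: "finite (verts G1)" by (rule connected_graphD(2)[OF conn1])
    have sum: "card {v \<in> verts G1. col v = 0} + card {v \<in> verts G1. col v = 1} + card {v \<in> verts G1. col v = 2} = n1"
      using sum_three_classes[OF fin1] col(1) by blast
    have pos: "1 \<le> card {v \<in> verts G1. col v = 1}"
    proof (rule ccontr)
      assume "\<not> ?thesis"
      then have "card {v \<in> verts G1. col v = 1} = 0" "card {v \<in> verts G1. col v = 2} = 0" using s(2) by linarith+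
      then have e: "{v \<in> verts G1. col v = 1} = {}" "{v \<in> verts G1. col v = 2} = {}" using fin1 by simp_all
      have zero: "col v = 0" if "v \<in> verts G1" for v
      proof -
        have "col v \<noteq> 1" "col v \<noteq> 2" using e that by blast+
        then show ?thesis using col(1)[OF that] by linarith
      qed
      obtain u v where e: "{u, v} \<in> edges G1"
        using connected_graph_edge_at[OF conn1 n1] connected_graphD(3)[OF conn1] by blast
      then show False using col(2)[OF e] zero simple_graph_edgeD[OF simple1 e] by simp
    qed
    \<comment> \<open>With classes sorted by size: for a bipartite colouring the second class has at
      most half of the \<open>n1\<close> vertices and \<open>n1 \<le> card W\<close>. Otherwise the
      two smaller classes have at most two thirds of them, and \<open>4 * n1 / 3\<close> is at most
      \<open>2 * n1 - 1\<close>.\<close>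
    have "2 * (card {v \<in> verts G1. col v = 1} + card {v \<in> verts G1. col v = 2}) \<le> card W"
      using two
    proof
      assume "card {v \<in> verts G1. col0 v = 2} = 0"
      moreover have "2 * (q + r) \<le> k" if "q \<le> p" "r \<le> q" "r \<le> z" "p + q + r = n" "n \<le> k" "z = 0" for p q r z n k :: nat
        using that by simp
      ultimately show ?thesis using s sum n1W by blast
    next
      assume "2 * n1 \<le> card W + 1"
      moreover have "2 * (q + r) \<le> k" if "q \<le> p" "r \<le> q" "p + q + r = n" "2 \<le> n" "2 * n \<le> k + 1" for p q r n k :: nat
        using that by simp
      ultimately show ?thesis using s(1,2) sum n1 by blast
    qed
    then show ?thesis
      by (intro bipartite_blowup[where col = col, OF has(3) jd A1(1,2) _ A2(1,2) _ W_def \<open>card W < n2\<close> not2 _ _ refl pos refl])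
        (auto simp: A1(3) A2(3) col)
  qed
qed

theorem dominated_has_free_3_colouring: "has_free_3_colouring V"
proof (cases "\<forall>j j'. has2 j \<longrightarrow> has2 j' \<longrightarrow> j = j'")
  case True
  then show ?thesis using at_most_one_has2 by blast
next
  case False
  then obtain j1 j2 where j: "has2 j1" "has2 j2" "j1 \<noteq> j2" by blast
  have n1: "2 \<le> n1" by (rule n1_ge[OF j(1)])
  show ?thesis
  proof (cases "\<exists>p q. \<forall>j. has1 j \<longrightarrow> j = p \<or> j = q")
    case True
    then show ?thesis using at_most_two_has1[OF n1] by blast
  next
    case F: False
    then obtain j3 where j3: "has1 j3" "j3 \<noteq> j1" "j3 \<noteq> j2" by blast
    \<comment> \<open>The clique blow-up needs three parts. If exactly two colours contain
      \<open>G2\<close>, one containing only \<open>G1\<close> is added; its part need not reach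
      size \<open>n2\<close>, so this is the one case in which \<open>G2\<close> can be
      m-colourable.\<close>
    define J where "J = (if {j. has2 j} = {j1, j2} then {j1, j2, j3} else {j. has2 j})"
    have J1: "has1 i" if "i \<in> J" for i
      using that j3 j has2_has1 unfolding J_def by (auto split: if_splits)
    have J2: "i \<in> J" if "has2 i" for i using that unfolding J_def by auto
    have finJ: "finite J" using finite_subset[OF _ finite_has1[OF n1]] J1 by blast
    have J3: "3 \<le> card J"
    proof (cases "{j. has2 j} = {j1, j2}")
      case True
      then show ?thesis using j j3 unfolding J_def by simp
    next
      case False
      then obtain i where "has2 i" "i \<noteq> j1" "i \<noteq> j2" using j by blast
      then have "{j1, j2, i} \<subseteq> J" "card {j1, j2, i} = 3" using j J2 by auto
      then show ?thesis using card_mono[OF finJ] by metis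
    qed
    have "\<forall>i\<in>J. \<exists>A. A \<subseteq> V \<inter> {v. L v = i} \<and> n1 \<le> card A \<and> card A \<le> n2 \<and>
        (has2 i \<longrightarrow> card A = n2 \<and> (\<forall>\<phi>. \<not> copy c i (V - A) G1 \<phi>))"
    proof
      fix i assume i: "i \<in> J"
      show "\<exists>A. A \<subseteq> V \<inter> {v. L v = i} \<and> n1 \<le> card A \<and> card A \<le> n2 \<and>
        (has2 i \<longrightarrow> card A = n2 \<and> (\<forall>\<phi>. \<not> copy c i (V - A) G1 \<phi>))"
      proof (cases "has2 i")
        case True
        then show ?thesis using has2_part[OF True] n1_le_n2 by (metis le_refl)
      next
        case False
        then show ?thesis using has1_part[OF J1[OF i] n1] n1_le_n2 by (metis le_refl)
      qed
    qed
    from bchoice[OF this] obtain A where A0: "\<forall>i\<in>J. A i \<subseteq> V \<inter> {v. L v = i} \<and> n1 \<le> card (A i) \<and> card (A i) \<le> n2 \<and>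
        (has2 i \<longrightarrow> card (A i) = n2 \<and> (\<forall>\<phi>. \<not> copy c i (V - A i) G1 \<phi>))" ..
    have A: "A i \<subseteq> V \<inter> {v. L v = i}" "n1 \<le> card (A i)" "card (A i) \<le> n2" if "i \<in> J" for i
      using bspec[OF A0 that] by auto
    have A': "card (A i) = n2" "\<not> copy c i (V - A i) G1 \<phi>" if "has2 i" for i \<phi>
      using bspec[OF A0 J2[OF that]] that by auto
    define m where "m = card J"
    obtain idx where idx: "bij_betw idx {0..<m} J" using ex_bij_betw_nat_finite[OF finJ] unfolding m_def by blast
    have idxJ: "idx l \<in> J" if "l < m" for l using bij_betwE[OF idx] that by simp
    have idx_ne: "idx l \<noteq> idx l'" if "l < m" "l' < m" "l \<noteq> l'" for l l'
      using inj_onD[OF bij_betw_imp_inj_on[OF idx], of l l'] that by auto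
    have sep: "L x \<noteq> L y" if "l < m" "l' < m" "l \<noteq> l'" "x \<in> A (idx l)" "y \<in> A (idx l')" for l l' x y
    proof -
      have "L x = idx l" "L y = idx l'"
        using subsetD[OF A(1)[OF idxJ[OF that(1)]] that(4)] subsetD[OF A(1)[OF idxJ[OF that(2)]] that(5)] by simp_all
      then show ?thesis using idx_ne[OF that(1-3)] by simp
    qed
    define U where "U = (\<Union>i\<in>J. A i)"
    have UV: "U \<subseteq> V" using A(1) unfolding U_def by auto
    show ?thesis
    proof (cases "colourable m G2")
      case True
      have "{j. has2 j} = {j1, j2}"
      proof (rule ccontr)
        assume "{j. has2 j} \<noteq> {j1, j2}"
        then have h: "has2 i" if "i \<in> J" for i using that unfolding J_def by auto
        have "\<not> colourable m G2"
        proof (rule parts_not_colourable[of m "\<lambda>l. A (idx l)"])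
          show "2 \<le> m" using J3 unfolding m_def by simp
          show "A (idx l) \<subseteq> V" if "l < m" for l using A(1)[OF idxJ[OF that]] by blast
          show "n2 \<le> card (A (idx l))" if "l < m" for l using A'(1)[OF h[OF idxJ[OF that]]] by simp
        qed (rule sep)
        then show False using True by blast
      qed
      then have "m = 3" using j j3 unfolding m_def J_def by simp
      then show ?thesis using two_has2_three_colourable[OF j j3] True by simp
    next
      case False
      show ?thesis
      proof (rule clique_blowup[OF UV _ _ False])
        have "card U \<le> (\<Sum>i\<in>J. card (A i))" unfolding U_def by (rule card_UN_le[OF finJ])
        also have "\<dots> \<le> m * n2" using sum_bounded_above[of J "\<lambda>i. card (A i)" n2] A(3) unfolding m_def by simp
        finally show "card U \<le> m * n2" .
        show "3 \<le> m" using J3 unfolding m_def .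
        show "\<not> copy c i (V - U) G2 \<phi>" if "i \<noteq> d" for i \<phi>
        proof
          assume copy: "copy c i (V - U) G2 \<phi>"
          have h: "has2 i" using copy_mono[OF copy Diff_subset] that unfolding has2_def by blast
          then have "V - U \<subseteq> V - A i" using J2 unfolding U_def by blast
          then show False using A'(2)[OF h] copy_mono[OF copy_sub[OF copy]] by blast
        qed
        \<comment> \<open>Each part has at least \<open>n1\<close> vertices, so an m-colourable
          \<open>G1\<close> would fit into \<open>U\<close> in colour \<open>d\<close>, beside any
          copy of \<open>G2\<close> outside \<open>U\<close>.\<close>
        show "\<not> colourable m G1 \<or> (\<forall>\<phi>. \<not> copy c d (V - U) G2 \<phi>)"
        proof (rule disjCI, rule notI)
          assume "\<not> (\<forall>\<phi>. \<not> copy c d (V - U) G2 \<phi>)" and "colourable m G1"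
          then obtain \<phi>2 and col :: "'a \<Rightarrow> nat" where \<phi>2: "copy c d (V - U) G2 \<phi>2"
            and col: "col ` verts G1 \<subseteq> {..<m}" "\<And>u v. {u, v} \<in> edges G1 \<Longrightarrow> col u \<noteq> col v"
            unfolding colourable_def by blast
          have colm: "col v < m" if "v \<in> verts G1" for v using that col(1) by auto
          obtain \<phi>1 where \<phi>1: "copy c d (\<Union>v\<in>verts G1. A (idx (col v))) G1 \<phi>1"
          proof (rule multipartite_copy[of G1 col "\<lambda>l. A (idx l)" c d])
            show "finite (A (idx (col v)))" if "v \<in> verts G1" for v
              using A(1)[OF idxJ[OF colm[OF that]]] finV by (auto intro: finite_subset)
            show "A (idx (col u)) \<inter> A (idx (col v)) = {}" if "u \<in> verts G1" "v \<in> verts G1" "col u \<noteq> col v" for u v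
              using sep[OF colm[OF that(1)] colm[OF that(2)] that(3)] by blast
            show "card {u \<in> verts G1. col u = col v} \<le> card (A (idx (col v)))" if "v \<in> verts G1" for v
              using A(2)[OF idxJ[OF colm[OF that]]] card_mono[OF connected_graphD(2)[OF conn1], of "{u \<in> verts G1. col u = col v}"]
              by auto
            show "c {x, y} = d" if uv: "u \<in> verts G1" "v \<in> verts G1" "col u \<noteq> col v" "x \<in> A (idx (col u))" "y \<in> A (idx (col v))" for u v x y
              using cross[OF _ _ sep[OF colm[OF uv(1)] colm[OF uv(2)] uv(3-5)]]
                A(1)[OF idxJ[OF colm[OF uv(1)]]] A(1)[OF idxJ[OF colm[OF uv(2)]]] uv(4,5) by blast
          qed (use simple1 col(2) in auto)
          have "(\<Union>v\<in>verts G1. A (idx (col v))) \<subseteq> U" using idxJ colm unfolding U_def by blast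
          then have 1: "copy c d U G1 \<phi>1" using copy_mono[OF \<phi>1] by blast
          show False
            by (rule pair_freeD[OF free copy_mono[OF 1 UV] copy_mono[OF \<phi>2 Diff_subset]])
              (use copyD(2)[OF 1] copyD(2)[OF \<phi>2] in blast)
        qed
      qed
    qed
  qed
qed

end

section \<open>The exceptional colourings\<close>

lemma edge_copy:
  assumes G: "simple_graph G" "card (verts G) \<le> 2" and pq: "p \<noteq> q" "c {p, q} = i"
  obtains \<phi> where "copy c i {p, q} G \<phi>"
proof -
  have "finite (verts G)" using G(1) unfolding simple_graph_def by simp
  then obtain \<phi> where \<phi>: "\<phi> ` verts G \<subseteq> {p, q}" "inj_on \<phi> (verts G)"
    using card_le_inj[of "verts G" "{p, q}"] G(2) pq(1) by auto
  have "c {\<phi> u, \<phi> v} = i" if e: "{u, v} \<in> edges G" for u v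
  proof -
    have "\<phi> u \<in> {p, q}" "\<phi> v \<in> {p, q}" "\<phi> u \<noteq> \<phi> v"
      using simple_graph_edgeD[OF G(1) e] \<phi> by (auto simp: inj_on_def)
    then have "{\<phi> u, \<phi> v} = {p, q}" by auto
    then show ?thesis using pq(2) by simp
  qed
  then show ?thesis using that \<phi> unfolding copy_def by blast
qed

text \<open>A connected bipartite graph on three vertices is a path: one of its colour classes is a
  singleton, and its vertex goes to the middle \<open>q\<close>.\<close>

lemma path_copy:
  assumes G: "connected_graph G" "card (verts G) = 3" "colourable 2 G"
    and d: "distinct [p, q, r]" and c: "c {q, p} = i" "c {q, r} = i"
  obtains \<phi> where "copy c i {p, q, r} G \<phi>"
proof -
  obtain k :: "'a \<Rightarrow> nat" where k: "k ` verts G \<subseteq> {..<2}" "\<And>u v. {u, v} \<in> edges G \<Longrightarrow> k u \<noteq> k v"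
    using G(3) unfolding colourable_def by blast
  have fin: "finite (verts G)" by (rule connected_graphD(2)[OF G(1)])
  have k01: "k v = 0 \<or> k v = 1" if "v \<in> verts G" for v using k(1) that by fastforce
  obtain u where u: "u \<in> verts G" using connected_graphD(3)[OF G(1)] by blast
  obtain v where uv: "{u, v} \<in> edges G" by (rule connected_graph_edge_at[OF G(1) _ u]) (use G(2) in auto)
  have v: "v \<in> verts G" using simple_graph_edgeD[OF connected_graphD(1)[OF G(1)] uv] by blast
  have kuv: "k w = k u \<or> k w = k v" if "w \<in> verts G" for w
    using k01[OF that] k01[OF u] k01[OF v] k(2)[OF uv] by auto
  have "card {w \<in> verts G. k w = k u} + card {w \<in> verts G. k w = k v} = card ({w \<in> verts G. k w = k u} \<union> {w \<in> verts G. k w = k v})"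
    using k(2)[OF uv] fin by (intro card_Un_disjoint[symmetric]) auto
  also have "{w \<in> verts G. k w = k u} \<union> {w \<in> verts G. k w = k v} = verts G"
    using kuv by blast
  finally have sum: "card {w \<in> verts G. k w = k u} + card {w \<in> verts G. k w = k v} = 3" using G(2) by simp
  have pos: "card {w \<in> verts G. k w = k u} > 0" "card {w \<in> verts G. k w = k v} > 0"
    using u v fin by (auto simp: card_gt_0_iff)
  define s where "s = (if card {w \<in> verts G. k w = k u} = 1 then k u else k v)"
  have s: "card {w \<in> verts G. k w = s} = 1" using sum pos unfolding s_def by auto
  have other: "card {w \<in> verts G. k w = t} \<le> 2" if "t \<in> k ` verts G" for t
  proof -
    have "t = k u \<or> t = k v" using that kuv by blast
    then show ?thesis using sum pos by (elim disjE) simp_all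
  qed
  obtain \<phi> where \<phi>: "copy c i (\<Union>w\<in>verts G. if k w = s then {q} else {p, r}) G \<phi>"
  proof (rule multipartite_copy[of G k "\<lambda>l. if l = s then {q} else {p, r}" c i])
    show "card {w \<in> verts G. k w = k x} \<le> card (if k x = s then {q} else {p, r})" if "x \<in> verts G" for x
      using s other[of "k x"] that d by (auto split: if_splits)
    show "c {x, y} = i" if "x' \<in> verts G" "y' \<in> verts G" "k x' \<noteq> k y'" "x \<in> (if k x' = s then {q} else {p, r})"
      "y \<in> (if k y' = s then {q} else {p, r})" for x' y' x y
    proof -
      have "k x' = s \<or> k y' = s" using kuv[OF that(1)] kuv[OF that(2)] that(3) unfolding s_def by presburger
      then show ?thesis using that(3-5) c by (auto simp: insert_commute)
    qed
    show "(if k x = s then {q} else {p, r}) \<inter> (if k y = s then {q} else {p, r}) = {}"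
      if "x \<in> verts G" "y \<in> verts G" "k x \<noteq> k y" for x y
    proof -
      have "k x = s \<or> k y = s" using kuv[OF that(1)] kuv[OF that(2)] that(3) unfolding s_def by presburger
      then show ?thesis using that(3) d by auto
    qed
  qed (use connected_graphD(1)[OF G(1)] k(2) in auto)
  have "(\<Union>w\<in>verts G. if k w = s then {q} else {p, r}) \<subseteq> {p, q, r}" by auto
  then show ?thesis using that copy_mono[OF \<phi>] by blast
qed

section \<open>Recolouring the exceptional families\<close>

context graph_pair
begin

text \<open>All edges of the copy pass through \<open>r\<close>. Exchanging \<open>r\<close> for
  \<open>u\<close> gives a copy of \<open>G2\<close> in colour \<open>i\<close> of \<open>c\<close>
  and frees \<open>r\<close> to serve as the one-vertex graph \<open>G1\<close>.\<close>

lemma star_move: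
  assumes n: "n1 = 1" "2 \<le> n2" and free: "pair_free c V" and copy: "copy c' m V G2 \<phi>"
    and u: "u \<in> V" "u \<notin> \<phi> ` verts G2"
    and r: "\<And>x y. x \<in> \<phi> ` verts G2 \<Longrightarrow> y \<in> \<phi> ` verts G2 \<Longrightarrow> x \<noteq> y \<Longrightarrow> c' {x, y} = m \<Longrightarrow> r \<in> {x, y}"
    and i: "\<And>x. x \<in> \<phi> ` verts G2 \<Longrightarrow> x \<noteq> r \<Longrightarrow> c {u, x} = i"
  shows False
proof -
  obtain x y where "x \<in> \<phi> ` verts G2" "y \<in> \<phi> ` verts G2" "x \<noteq> y" "c' {x, y} = m"
    by (rule copy_edge[OF conn2 n(2) copy])
  then have rimg: "r \<in> \<phi> ` verts G2" using r by blast
  define h where "h x = (if x = r then u else x)" for x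
  have "copy c i V G2 (h \<circ> \<phi>)"
  proof (rule copy_transport[OF simple2 copy])
    show "inj_on h (\<phi> ` verts G2)" using u(2) unfolding h_def inj_on_def by auto
    show "h ` \<phi> ` verts G2 \<subseteq> V" using u(1) copyD(2)[OF copy] unfolding h_def by auto
    fix x y assume xy: "x \<in> \<phi> ` verts G2" "y \<in> \<phi> ` verts G2" "x \<noteq> y" "c' {x, y} = m"
    then consider "x = r" | "y = r" using r by blast
    then show "c {h x, h y} = i"
    proof cases
      case 1
      then show ?thesis using i[OF xy(2)] xy(3) unfolding h_def by simp
    next
      case 2
      then show ?thesis using i[OF xy(1)] xy(3) unfolding h_def by (simp add: insert_commute)
    qed
  qed
  moreover have "copy c i V G1 (\<lambda>_. r)"
    by (rule trivial_copy[OF conn1 n(1)]) (use rimg copyD(2)[OF copy] in blast)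
  moreover have "r \<notin> (h \<circ> \<phi>) ` verts G2" using rimg u(2) unfolding h_def by auto
  ultimately show False using pair_freeD[OF free] by blast
qed

lemma common_vertex:
  assumes n: "2 \<le> n1" "2 \<le> n2" and copy: "copy c m V G1 \<phi>1" "copy c m V G2 \<phi>2"
    and dis: "\<phi>1 ` verts G1 \<inter> \<phi>2 ` verts G2 = {}"
    and r: "\<And>x y. x \<in> V \<Longrightarrow> y \<in> V \<Longrightarrow> x \<noteq> y \<Longrightarrow> c {x, y} = m \<Longrightarrow> r \<in> {x, y}"
  shows False
proof -
  obtain x y where "x \<in> \<phi>1 ` verts G1" "y \<in> \<phi>1 ` verts G1" "x \<noteq> y" "c {x, y} = m"
    by (rule copy_edge[OF conn1 n(1) copy(1)])
  then have "r \<in> \<phi>1 ` verts G1" using r copyD(2)[OF copy(1)] by blast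
  moreover obtain x y where "x \<in> \<phi>2 ` verts G2" "y \<in> \<phi>2 ` verts G2" "x \<noteq> y" "c {x, y} = m"
    by (rule copy_edge[OF conn2 n(2) copy(2)])
  then have "r \<in> \<phi>2 ` verts G2" using r copyD(2)[OF copy(2)] by blast
  ultimately show False using dis by blast
qed

lemma copy_vertex_edge:
  assumes "connected_graph G" "2 \<le> card (verts G)" and copy: "copy c m S G \<phi>" and x: "x \<in> \<phi> ` verts G"
  obtains y where "y \<in> \<phi> ` verts G" "x \<noteq> y" "c {x, y} = m"
proof -
  obtain u where u: "u \<in> verts G" "x = \<phi> u" using x by blast
  obtain v where e: "{u, v} \<in> edges G" by (rule connected_graph_edge_at[OF assms(1,2) u(1)])
  have "v \<in> verts G" "\<phi> u \<noteq> \<phi> v"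
    using simple_graph_edgeD[OF connected_graphD(1)[OF assms(1)] e] copyD(1)[OF copy] by (auto simp: inj_on_def)
  then show ?thesis using that copyD(3)[OF copy e] u by blast
qed

lemma n1_cases: "n1 = 1 \<or> 2 \<le> n1"
  using connected_graphD(4)[OF conn1] by linarith

lemma three_colours:
  assumes free: "pair_free c V" and pqr: "\<And>x y. x \<in> V \<Longrightarrow> y \<in> V \<Longrightarrow> x \<noteq> y \<Longrightarrow> c {x, y} \<in> {p, q, r}"
  shows "has_free_3_colouring V"
proof -
  define c' where "c' e = (if c e = p then 1 else if c e = q then 2 else (3::nat))" for e
  have "pair_free c' V"
    unfolding pair_free_def
  proof (intro notI, elim exE conjE)
    fix i \<phi>1 \<phi>2
    assume c1: "copy c' i V G1 \<phi>1" and c2: "copy c' i V G2 \<phi>2" and dis: "\<phi>1 ` verts G1 \<inter> \<phi>2 ` verts G2 = {}"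
    show False
    proof (rule pair_free_class[OF free c1 c2 dis])
      show "c {x, y} = (if i = 1 then p else if i = 2 then q else r)" if "x \<in> V" "y \<in> V" "x \<noteq> y" "c' {x, y} = i" for x y
        using pqr[OF that(1-3)] that(4) unfolding c'_def by (auto split: if_splits)
    qed
  qed
  moreover have "range c' \<subseteq> {1, 2, 3}" unfolding c'_def by auto
  ultimately show ?thesis unfolding has_free_3_colouring_def by blast
qed

text \<open>A one-vertex \<open>G1\<close> at \<open>a\<close> and \<open>G2\<close> on the rest
  would be a pair in colour \<open>i\<close>, so both graphs have edges. All edges of other colours
  contain \<open>a\<close>, and two disjoint copies cannot both use it.\<close>

lemma mono_off_vertex_case:
  assumes fin: "finite V" and size: "n1 + n2 \<le> card V" and free: "pair_free c V" and a: "a \<in> V"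
    and mono: "\<And>x y. x \<in> V - {a} \<Longrightarrow> y \<in> V - {a} \<Longrightarrow> x \<noteq> y \<Longrightarrow> c {x, y} = i"
  shows "has_free_3_colouring V"
proof -
  have n2: "2 \<le> n2" by (rule two_le_n2[OF fin size free])
  have n1: "2 \<le> n1"
  proof (rule ccontr)
    assume "\<not> 2 \<le> n1"
    then have one: "n1 = 1" using n1_cases by blast
    then have "n2 \<le> card (V - {a})" using size fin a by simp
    then obtain g where g: "g ` verts G2 \<subseteq> V - {a}" "inj_on g (verts G2)"
      using card_le_inj[of "verts G2" "V - {a}"] fin connected_graphD(2)[OF conn2] by blast
    have "c {g u, g v} = i" if e: "{u, v} \<in> edges G2" for u v
      using mono[of "g u" "g v"] g simple_graph_edgeD[OF simple2 e] by (auto simp: inj_on_def)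
    then have "copy c i V G2 g" using g unfolding copy_def by blast
    then show False using pair_freeD[OF free trivial_copy[OF conn1 one a]] g(1) by blast
  qed
  define c' where "c' e = (if c e = i then 1 else (2::nat))" for e
  have c'1: "c' e = 1 \<longleftrightarrow> c e = i" for e unfolding c'_def by simp
  have "pair_free c' V"
    unfolding pair_free_def
  proof (intro notI, elim exE conjE)
    fix m \<phi>1 \<phi>2
    assume c1: "copy c' m V G1 \<phi>1" and c2: "copy c' m V G2 \<phi>2" and dis: "\<phi>1 ` verts G1 \<inter> \<phi>2 ` verts G2 = {}"
    show False
    proof (cases "m = 1")
      case True
      have "c {x, y} = i" if "c' {x, y} = m" for x y
        using that True c'1 by blast
      then show False by (rule pair_free_class[OF free c1 c2 dis])
    next
      case False
      show False
      proof (rule common_vertex[OF n1 n2 c1 c2 dis])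
        show "a \<in> {x, y}" if "x \<in> V" "y \<in> V" "x \<noteq> y" "c' {x, y} = m" for x y
          using mono[of x y] that False c'1 by blast
      qed
    qed
  qed
  moreover have "range c' \<subseteq> {1, 2, 3}" unfolding c'_def by auto
  ultimately show ?thesis unfolding has_free_3_colouring_def by blast
qed

text \<open>Apart from colour \<open>i\<close> and the colour of \<open>b d\<close> only the edges
  \<open>a b\<close> and \<open>a d\<close> remain. Both contain \<open>a\<close>, so merging them
  creates no pair if \<open>G1\<close> has an edge; for a one-vertex \<open>G1\<close> the centre
  \<open>a\<close> of such a star is exchanged for a vertex outside the triangle.\<close>

lemma triangle_case:
  assumes fin: "finite V" and size: "n1 + n2 \<le> card V" and free: "pair_free c V" and V5: "5 \<le> card V"
    and d: "distinct [a, b, d]" "{a, b, d} \<subseteq> V" "distinct [c {a, b}, c {a, d}, c {b, d}, i]"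
    and out: "\<And>x. x \<in> V - {a, b, d} \<Longrightarrow> c {a, x} \<in> {i, c {b, d}} \<and> c {b, x} = i \<and> c {d, x} = i"
      "\<And>x y. x \<in> V - {a, b, d} \<Longrightarrow> y \<in> V - {a, b, d} \<Longrightarrow> x \<noteq> y \<Longrightarrow> c {x, y} = i"
  shows "has_free_3_colouring V"
proof -
  have n2: "2 \<le> n2" by (rule two_le_n2[OF fin size free])
  define c' where "c' e = (if c e = i then 1 else if c e = c {b, d} then 2 else (3::nat))" for e
  have inside: "x \<in> {a, b, d}" if xy: "x \<in> V" "y \<in> V" "x \<noteq> y" "c {x, y} \<noteq> i" "c {x, y} \<noteq> c {b, d}" for x y
  proof (rule ccontr)
    assume "x \<notin> {a, b, d}"
    then have x: "x \<in> V - {a, b, d}" using xy(1) by blast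
    consider "y = a" | "y = b" | "y = d" | "y \<in> V - {a, b, d}" using xy(2) by blast
    then show False
      using out(1)[OF x] out(2)[OF x _ xy(3)] xy(4,5) by cases (auto simp: insert_commute)
  qed
  have c'3: "{x, y} = {a, b} \<or> {x, y} = {a, d}" if "x \<in> V" "y \<in> V" "x \<noteq> y" "c' {x, y} = 3" for x y
  proof -
    have ne: "c {x, y} \<noteq> i" "c {x, y} \<noteq> c {b, d}" using that(4) unfolding c'_def by (auto split: if_splits)
    have "x \<in> {a, b, d}" "y \<in> {a, b, d}"
      using inside[of x y] inside[of y x] that(1-3) ne by (auto simp: insert_commute)
    then show ?thesis using ne that(3) by (auto simp: insert_commute)
  qed
  obtain u where u: "u \<in> V - {a, b, d}"
  proof -
    have "card {a, b, d} < card V" using V5 d(1) by simp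
    then have "\<not> V \<subseteq> {a, b, d}" using card_mono[of "{a, b, d}" V] by auto
    then show ?thesis using that by blast
  qed
  have "pair_free c' V"
    unfolding pair_free_def
  proof (intro notI, elim exE conjE)
    fix m \<phi>1 \<phi>2
    assume c1: "copy c' m V G1 \<phi>1" and c2: "copy c' m V G2 \<phi>2" and dis: "\<phi>1 ` verts G1 \<inter> \<phi>2 ` verts G2 = {}"
    show False
    proof (cases "m = 3")
      case False
      show False
      proof (rule pair_free_class[OF free c1 c2 dis])
        show "c {x, y} = (if m = 1 then i else c {b, d})" if "c' {x, y} = m" for x y
          using that False unfolding c'_def by (auto split: if_splits)
      qed
    next
      case True
      have av: "a \<in> {x, y}" if "x \<in> V" "y \<in> V" "x \<noteq> y" "c' {x, y} = m" for x y
        using c'3[OF that(1-3)] that(4) True by (auto simp: doubleton_eq_iff)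
      show False
        using n1_cases
      proof
        assume "2 \<le> n1"
        then show False using common_vertex[OF _ n2 c1 c2 dis av] by blast
      next
        assume one: "n1 = 1"
        have img: "x \<in> {a, b, d}" if x: "x \<in> \<phi>2 ` verts G2" for x
        proof -
          obtain y where "y \<in> \<phi>2 ` verts G2" "x \<noteq> y" "c' {x, y} = m" by (rule copy_vertex_edge[OF conn2 n2 c2 x])
          then have "{x, y} = {a, b} \<or> {x, y} = {a, d}" using c'3[of x y] copyD(2)[OF c2] x True by blast
          then show ?thesis by (auto simp: doubleton_eq_iff)
        qed
        show False
        proof (rule star_move[OF one n2 free c2, of u a i])
          show "u \<notin> \<phi>2 ` verts G2" using img u by blast
          show "a \<in> {x, y}" if "x \<in> \<phi>2 ` verts G2" "y \<in> \<phi>2 ` verts G2" "x \<noteq> y" "c' {x, y} = m" for x y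
            using av[OF _ _ that(3,4)] that copyD(2)[OF c2] by blast
          show "c {u, x} = i" if "x \<in> \<phi>2 ` verts G2" "x \<noteq> a" for x
            using out(1)[OF u] img[OF that(1)] that(2) by (auto simp: insert_commute)
        qed (use u in simp)
      qed
    qed
  qed
  moreover have "range c' \<subseteq> {1, 2, 3}" unfolding c'_def by auto
  ultimately show ?thesis unfolding has_free_3_colouring_def by blast
qed

lemma K4_case:
  assumes fin: "finite V" and size: "n1 + n2 \<le> card V" and free: "pair_free c V" and V5: "5 \<le> card V"
    and d: "distinct [a, b, d, e]" "{a, b, d, e} \<subseteq> V" "distinct [i, j, k, l]"
    and col: "c {a, b} \<in> {i, j}" "c {d, e} \<in> {i, j}" "c {a, d} \<in> {i, k}" "c {b, e} \<in> {i, k}"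
      "c {a, e} \<in> {i, l}" "c {b, d} \<in> {i, l}"
    and out: "\<And>x y. x \<in> V - {a, b, d, e} \<Longrightarrow> y \<in> V \<Longrightarrow> x \<noteq> y \<Longrightarrow> c {x, y} = i"
  shows "has_free_3_colouring V"
proof -
  have n2: "2 \<le> n2" by (rule two_le_n2[OF fin size free])
  let ?K = "{a, b, d, e}"
  have K4: "card ?K = 4" using d(1) by simp
  then have "V - ?K \<noteq> {}" using V5 card_mono[of ?K V] by auto
  then obtain u where u: "u \<in> V - ?K" by blast
  have sym: "c {b, a} = c {a, b}" "c {e, d} = c {d, e}" "c {d, a} = c {a, d}" "c {e, b} = c {b, e}"
    "c {e, a} = c {a, e}" "c {d, b} = c {b, d}" by (simp_all add: insert_commute)
  have inside: "x \<in> ?K \<and> y \<in> ?K" if xy: "x \<in> V" "y \<in> V" "x \<noteq> y" "c {x, y} \<noteq> i" for x y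
    using out[of x y] out[of y x] xy by (auto simp: insert_commute)
  show ?thesis
  proof (cases "n1 = 1 \<and> 4 \<le> n2")
    case True
    \<comment> \<open>The triangle \<open>a b d\<close> is too small for \<open>G2\<close>, which
      has at least four vertices here, and the other three edges on the four vertices form a star at
      \<open>e\<close>. All edges given colour 1 have the old colour \<open>i\<close>.\<close>
    define c' where "c' s = (if s \<subseteq> {a, b, d} then 2 else if s \<subseteq> ?K then 3 else (1::nat))" for s
    have "pair_free c' V"
      unfolding pair_free_def
    proof (intro notI, elim exE conjE)
      fix m \<phi>1 \<phi>2
      assume c1: "copy c' m V G1 \<phi>1" and c2: "copy c' m V G2 \<phi>2" and dis: "\<phi>1 ` verts G1 \<inter> \<phi>2 ` verts G2 = {}"
      obtain p q where "c' {p, q} = m" by (rule copy_edge[OF conn2 n2 c2])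
      then consider "m = 1" | "m = 2" | "m = 3" unfolding c'_def by (auto split: if_splits)
      then show False
      proof cases
        case 1
        show False
        proof (rule pair_free_class[OF free c1 c2 dis])
          show "c {x, y} = i" if "x \<in> V" "y \<in> V" "x \<noteq> y" "c' {x, y} = m" for x y
          proof (rule ccontr)
            assume "c {x, y} \<noteq> i"
            then have "{x, y} \<subseteq> ?K" using inside[OF that(1-3)] by blast
            then show False using that(4) 1 unfolding c'_def by (simp split: if_split_asm)
          qed
        qed
      next
        case 2
        have "x \<in> {a, b, d}" if x: "x \<in> \<phi>2 ` verts G2" for x
        proof -
          obtain y where "c' {x, y} = m" by (rule copy_vertex_edge[OF conn2 n2 c2 x])
          then show ?thesis using 2 unfolding c'_def by (simp split: if_split_asm)
        qed
        then have "card (\<phi>2 ` verts G2) \<le> card {a, b, d}" by (intro card_mono) auto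
        also have "\<dots> \<le> 3" by (simp add: card_insert_if)
        finally show False using card_copy[OF c2] True by simp
      next
        case 3
        have img: "x \<in> ?K" if x: "x \<in> \<phi>2 ` verts G2" for x
        proof -
          obtain y where "c' {x, y} = m" by (rule copy_vertex_edge[OF conn2 n2 c2 x])
          then show ?thesis using 3 unfolding c'_def by (simp split: if_split_asm)
        qed
        show False
        proof (rule star_move[OF _ n2 free c2, of u e i])
          show "n1 = 1" using True by blast
          show "u \<in> V" using u by blast
          show "u \<notin> \<phi>2 ` verts G2" using img u by blast
          show "e \<in> {x, y}" if "x \<in> \<phi>2 ` verts G2" "y \<in> \<phi>2 ` verts G2" "c' {x, y} = m" for x y
          proof (rule ccontr)
            assume "e \<notin> {x, y}"
            then have "{x, y} \<subseteq> {a, b, d}" using img[OF that(1)] img[OF that(2)] by blast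
            then show False using that(3) 3 unfolding c'_def by simp
          qed
          show "c {u, x} = i" if "x \<in> \<phi>2 ` verts G2" for x
            using out[OF u, of x] img[OF that] u copyD(2)[OF c2] that by blast
        qed
      qed
    qed
    moreover have "range c' \<subseteq> {1, 2, 3}" unfolding c'_def by auto
    ultimately show ?thesis unfolding has_free_3_colouring_def by blast
  next
    case False
    \<comment> \<open>Merging \<open>k\<close> and \<open>l\<close> leaves in colour 3 only edges of
      the 4-cycle between \<open>{a, b}\<close> and \<open>{d, e}\<close>.\<close>
    define c' where "c' s = (if c s = i then 1 else if c s = j then 2 else (3::nat))" for s
    have c'1: "c' s = 1 \<longleftrightarrow> c s = i" and c'2: "c' s = 2 \<longleftrightarrow> c s \<noteq> i \<and> c s = j"
      and c'3: "c' s = 3 \<longleftrightarrow> c s \<noteq> i \<and> c s \<noteq> j" for s unfolding c'_def by simp_all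
    have edge3: "x \<in> ?K \<and> y \<in> ?K \<and> (x \<in> {a, b} \<longleftrightarrow> y \<in> {d, e})" if "x \<in> V" "y \<in> V" "x \<noteq> y" "c' {x, y} = 3" for x y
    proof -
      have K: "x \<in> ?K" "y \<in> ?K" using inside[OF that(1-3)] c'3 that(4) by blast+
      moreover have "{x, y} \<noteq> {a, b}" "{x, y} \<noteq> {d, e}" using that(4) c'3 col by auto
      ultimately show ?thesis using that(3) d(1) by (auto simp: doubleton_eq_iff)
    qed
    have "pair_free c' V"
      unfolding pair_free_def
    proof (intro notI, elim exE conjE)
      fix m \<phi>1 \<phi>2
      assume c1: "copy c' m V G1 \<phi>1" and c2: "copy c' m V G2 \<phi>2" and dis: "\<phi>1 ` verts G1 \<inter> \<phi>2 ` verts G2 = {}"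
      have c1V: "\<phi>1 ` verts G1 \<subseteq> V" and c2V: "\<phi>2 ` verts G2 \<subseteq> V" using copyD(2)[OF c1] copyD(2)[OF c2] by auto
      obtain p q where pq: "p \<in> \<phi>2 ` verts G2" "q \<in> \<phi>2 ` verts G2" "p \<noteq> q" "c' {p, q} = m" by (rule copy_edge[OF conn2 n2 c2])
      then consider "m = 1" | "m = 2" | "m = 3" unfolding c'_def by (auto split: if_splits)
      then show False
      proof cases
        case 1
        show False by (rule pair_free_class[OF free c1 c2 dis, of i]) (use 1 c'1 in blast)
      next
        case 2
        show False by (rule pair_free_class[OF free c1 c2 dis, of j]) (use 2 c'2 in blast)
      next
        case 3
        have img: "x \<in> ?K" if x: "x \<in> \<phi>2 ` verts G2" for x
        proof -
          obtain y where "y \<in> \<phi>2 ` verts G2" "x \<noteq> y" "c' {x, y} = m" by (rule copy_vertex_edge[OF conn2 n2 c2 x])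
          then show ?thesis using edge3[of x y] 3 x c2V by blast
        qed
        show False
          using n1_cases
        proof
          assume n1: "2 \<le> n1"
          have img1: "x \<in> ?K" if x: "x \<in> \<phi>1 ` verts G1" for x
          proof -
            obtain y where "y \<in> \<phi>1 ` verts G1" "x \<noteq> y" "c' {x, y} = m" by (rule copy_vertex_edge[OF conn1 n1 c1 x])
            then show ?thesis using edge3[of x y] 3 x c1V by blast
          qed
          have "card (\<phi>1 ` verts G1 \<union> \<phi>2 ` verts G2) \<le> card ?K" using img img1 by (intro card_mono) auto
          moreover have "card (\<phi>1 ` verts G1 \<union> \<phi>2 ` verts G2) = n1 + n2"
            using dis card_copy[OF c1] card_copy[OF c2] connected_graphD(2)[OF conn1] connected_graphD(2)[OF conn2]
            by (simp add: card_Un_disjoint)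
          ultimately have two: "n1 = 2" "n2 = 2" using n1 n2 K4 by auto
          obtain r s where rs: "r \<in> \<phi>1 ` verts G1" "s \<in> \<phi>1 ` verts G1" "r \<noteq> s" "c' {r, s} = m" by (rule copy_edge[OF conn1 n1 c1])
          have "card (\<phi>1 ` verts G1) = 2" "card (\<phi>2 ` verts G2) = 2" using card_copy[OF c1] card_copy[OF c2] two by simp_all
          moreover have "card {r, s} = 2" "card {p, q} = 2" using rs(3) pq(3) by simp_all
          moreover have "finite (\<phi>1 ` verts G1)" "finite (\<phi>2 ` verts G2)"
            using connected_graphD(2)[OF conn1] connected_graphD(2)[OF conn2] by simp_all
          moreover have "{r, s} \<subseteq> \<phi>1 ` verts G1" "{p, q} \<subseteq> \<phi>2 ` verts G2" using rs pq by simp_all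
          ultimately have eq: "{r, s} = \<phi>1 ` verts G1" "{p, q} = \<phi>2 ` verts G2"
            using card_subset_eq by metis+
          have pr: "p \<noteq> r" "p \<noteq> s" "q \<noteq> r" "q \<noteq> s" using dis unfolding eq[symmetric] by auto
          \<comment> \<open>Disjoint edges of that 4-cycle are opposite, and opposite edges of
            colour 3 share their old colour, \<open>k\<close> or \<open>l\<close>.\<close>
          have "c {p, q} = c {r, s}"
            using edge3[of p q] edge3[of r s] pq rs c1V c2V 3 c'3[of "{p, q}"] c'3[of "{r, s}"] col d(1,3) pr sym
            by (smt (verit) distinct_length_2_or_more insert_iff empty_iff subsetD)
          then have "copy c (c {p, q}) V G1 \<phi>1"
            by (intro copy_change[OF simple1 c1 c1V]) (auto simp: eq[symmetric] insert_commute)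
          moreover have "copy c (c {p, q}) V G2 \<phi>2"
            by (intro copy_change[OF simple2 c2 c2V]) (auto simp: eq[symmetric] insert_commute)
          ultimately show False using pair_freeD[OF free _ _ dis] by blast
        next
          assume one: "n1 = 1"
          then have "n2 \<le> 3" using False by linarith
          \<comment> \<open>At most three vertices, split between \<open>{a, b}\<close> and
            \<open>{d, e}\<close>, leave at most one on some side, so the copy is a star centred
            there.\<close>
          define I where "I = \<phi>2 ` verts G2"
          have finI: "finite I" unfolding I_def using connected_graphD(2)[OF conn2] by simp
          have "card I \<le> 3" using card_copy[OF c2] \<open>n2 \<le> 3\<close> unfolding I_def by simp
          moreover have "card I = card (I \<inter> {a, b}) + card (I \<inter> {d, e})"
          proof -
            have "I = (I \<inter> {a, b}) \<union> (I \<inter> {d, e})" using img unfolding I_def by auto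
            moreover have "(I \<inter> {a, b}) \<inter> (I \<inter> {d, e}) = {}" using d(1) by auto
            ultimately show ?thesis using finI by (metis card_Un_disjoint finite_Int)
          qed
          ultimately have "card (I \<inter> {a, b}) \<le> 1 \<or> card (I \<inter> {d, e}) \<le> 1" by linarith
          then obtain B where B: "card (I \<inter> B) \<le> 1" "B = {a, b} \<or> B = {d, e}" by blast
          have cross: "x \<in> B \<or> y \<in> B" if "x \<in> I" "y \<in> I" "x \<noteq> y" "c' {x, y} = m" for x y
            using edge3[of x y] that B(2) 3 c2V unfolding I_def by blast
          then obtain r where r: "r \<in> I \<inter> B" using pq unfolding I_def by blast
          have uniq: "x = r" if "x \<in> I \<inter> B" for x
            using that r B(1) finI by (metis One_nat_def card_le_Suc0_iff_eq finite_Int)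
          show False
          proof (rule star_move[OF one n2 free c2, of u r i])
            show "u \<in> V" using u by blast
            show "u \<notin> \<phi>2 ` verts G2" using img u by blast
            show "r \<in> {x, y}" if "x \<in> \<phi>2 ` verts G2" "y \<in> \<phi>2 ` verts G2" "x \<noteq> y" "c' {x, y} = m" for x y
              using cross[of x y] uniq[of x] uniq[of y] that unfolding I_def by blast
            show "c {u, x} = i" if "x \<in> \<phi>2 ` verts G2" for x
              using out[OF u, of x] img[OF that] u c2V that by blast
          qed
        qed
      qed
    qed
    moreover have "range c' \<subseteq> {1, 2, 3}" unfolding c'_def by auto
    ultimately show ?thesis unfolding has_free_3_colouring_def by blast
  qed
qed

lemma K5_case:
  fixes V :: "'v set" and c :: "'v set \<Rightarrow> nat"
  assumes size: "n1 + n2 \<le> card V" and free: "pair_free c V"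
    and d: "distinct [a, b, d, e, f]" "V = {a, b, d, e, f}"
    and col: "c {a, e} = c {a, f}" "c {b, d} = c {a, f}" "c {b, e} = c {b, f}" "c {a, d} = c {b, f}"
      "c {d, e} = c {d, f}" "c {a, b} = c {d, f}" "distinct [c {a, f}, c {b, f}, c {d, f}, c {e, f}]"
  shows "has_free_3_colouring V"
proof -
  have fin: "finite V" using d(2) by simp
  have n2: "2 \<le> n2" by (rule two_le_n2[OF fin size free])
  have pairs: "{x, y} \<in> {{a, b}, {a, d}, {a, e}, {a, f}, {b, d}, {b, e}, {b, f}, {d, e}, {d, f}, {e, f}}"
    if "x \<in> V" "y \<in> V" "x \<noteq> y" for x y
    using that unfolding d(2) by (elim insertE emptyE) (simp_all add: insert_commute)
  show ?thesis
  proof (cases "colourable 2 G2")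
    case False
    \<comment> \<open>The colours of \<open>a f\<close> and \<open>b f\<close> together form the
      complete bipartite graph between \<open>{a, b}\<close> and \<open>{d, e, f}\<close>, and each
      of the other two colours is bipartite by itself. So no new colour contains
      \<open>G2\<close>.\<close>
    define c' where "c' s = (if c s = c {a, f} \<or> c s = c {b, f} then 1 else if c s = c {d, f} then 2 else (3::nat))" for s
    have "\<not> copy c' m V G2 \<phi>" for m \<phi>
    proof
      assume copy: "copy c' m V G2 \<phi>"
      define g :: "'v \<Rightarrow> nat" where "g x = (if x \<in> (if m = 1 then {a, b} else if m = 2 then {a, d} else {e}) then 0 else 1)" for x
      have "colourable 2 G2"
      proof (rule copy_colourable[OF simple2 copy, of g])
        show "g x < 2" for x unfolding g_def by auto
        show "g x \<noteq> g y" if xy: "x \<in> \<phi> ` verts G2" "y \<in> \<phi> ` verts G2" "x \<noteq> y" "c' {x, y} = m" for x y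
        proof -
          have "\<exists>u\<in>s. \<exists>v\<in>s. g u \<noteq> g v"
            if "s \<in> {{a, b}, {a, d}, {a, e}, {a, f}, {b, d}, {b, e}, {b, f}, {d, e}, {d, f}, {e, f}}" "c' s = m" for s
            using that d(1) col(7) unfolding g_def c'_def by (elim insertE emptyE) (simp_all add: col(1-6), auto)
          from this[OF pairs[OF _ _ xy(3)] xy(4)] have "\<exists>u\<in>{x, y}. \<exists>v\<in>{x, y}. g u \<noteq> g v"
            using xy(1,2) copyD(2)[OF copy] by blast
          then show ?thesis by auto
        qed
      qed
      then show False using False by blast
    qed
    then have "pair_free c' V" unfolding pair_free_def by blast
    moreover have "range c' \<subseteq> {1, 2, 3}" unfolding c'_def by auto
    ultimately show ?thesis unfolding has_free_3_colouring_def by blast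
  next
    case True
    \<comment> \<open>Here the colour of \<open>e f\<close> is merged with that of
      \<open>a f\<close>, which gives the triangle \<open>a e f\<close> and the separate edge
      \<open>b d\<close>.\<close>
    define c' where "c' s = (if c s = c {b, f} then 2 else if c s = c {d, f} then 3 else (1::nat))" for s
    have c'2: "c' s = 2 \<longleftrightarrow> c s = c {b, f}" and c'3: "c' s = 3 \<longleftrightarrow> c s \<noteq> c {b, f} \<and> c s = c {d, f}" for s
      unfolding c'_def by simp_all
    have zone: "x \<in> {a, e, f} \<longleftrightarrow> y \<in> {a, e, f}" if "x \<in> V" "y \<in> V" "x \<noteq> y" "c' {x, y} = 1" for x y
    proof -
      have "\<forall>u\<in>s. \<forall>v\<in>s. u \<in> {a, e, f} \<longleftrightarrow> v \<in> {a, e, f}"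
        if "s \<in> {{a, b}, {a, d}, {a, e}, {a, f}, {b, d}, {b, e}, {b, f}, {d, e}, {d, f}, {e, f}}" "c' s = 1" for s
        using that d(1) col(7) unfolding c'_def by (elim insertE emptyE) (simp_all add: col(1-6), auto)
      from this[OF pairs[OF that(1-3)] that(4)] show ?thesis by blast
    qed
    have side: "\<phi> ` verts G \<subseteq> {a, e, f} \<or> \<phi> ` verts G \<subseteq> {b, d}"
      if G: "connected_graph G" and copy: "copy c' 1 V G \<phi>" for G :: "'z ugraph" and \<phi>
    proof -
      obtain u where u: "u \<in> verts G" using connected_graphD(3)[OF G] by blast
      have "(x \<in> {a, e, f}) = (\<phi> u \<in> {a, e, f})" if "x \<in> \<phi> ` verts G" for x
        by (rule copy_const[OF G copy zone that]) (use u in auto)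
      moreover have "\<phi> ` verts G \<subseteq> V" by (rule copyD(2)[OF copy])
      ultimately show ?thesis unfolding d(2) by (cases "\<phi> u \<in> {a, e, f}") blast+
    qed
    have "pair_free c' V"
      unfolding pair_free_def
    proof (intro notI, elim exE conjE)
      fix m \<phi>1 \<phi>2
      assume c1: "copy c' m V G1 \<phi>1" and c2: "copy c' m V G2 \<phi>2" and dis: "\<phi>1 ` verts G1 \<inter> \<phi>2 ` verts G2 = {}"
      obtain p q where "c' {p, q} = m" by (rule copy_edge[OF conn2 n2 c2])
      then consider "m = 1" | "m = 2" | "m = 3" unfolding c'_def by (auto split: if_splits)
      then show False
      proof cases
        case 1
        note c1' = c1[unfolded 1] and c2' = c2[unfolded 1]
        have three: "card {a, e, f} = 3" and two: "card {b, d} = 2" using d(1) by auto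
        have le: "card I \<le> 3" if "I \<subseteq> {a, e, f}" for I using card_mono[OF _ that] three by simp
        have le': "card I \<le> 2" if "I \<subseteq> {b, d}" for I using card_mono[OF _ that] two by simp
        have n23: "n2 \<le> 3"
          by (rule disjE[OF side[OF conn2 c2']])
            (use le[of "\<phi>2 ` verts G2"] le'[of "\<phi>2 ` verts G2"] card_copy[OF c2] in linarith)+
        have "n1 \<le> 2"
        proof (rule ccontr)
          assume "\<not> n1 \<le> 2"
          then have n: "n1 = 3" "n2 = 3" using n1_le_n2 n23 by auto
          have "\<phi>1 ` verts G1 \<subseteq> {a, e, f}"
            using side[OF conn1 c1'] le'[of "\<phi>1 ` verts G1"] card_copy[OF c1] n(1) by linarith
          then have "\<phi>1 ` verts G1 = {a, e, f}"
            by (rule card_subset_eq[rotated]) (use card_copy[OF c1] n(1) three in simp_all)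
          moreover have "\<phi>2 ` verts G2 \<subseteq> {a, e, f}"
            using side[OF conn2 c2'] le'[of "\<phi>2 ` verts G2"] card_copy[OF c2] n(2) by linarith
          then have "\<phi>2 ` verts G2 = {a, e, f}"
            by (rule card_subset_eq[rotated]) (use card_copy[OF c2] n(2) three in simp_all)
          ultimately show False using dis by simp
        qed
        \<comment> \<open>\<open>G1\<close> has at most two vertices, and \<open>G2\<close> is
          bipartite with at most three; so in the old colour of \<open>a f\<close> the edge
          \<open>b d\<close> and the path \<open>e a f\<close> already hold a disjoint pair.\<close>
        then obtain \<psi>1 where p1: "copy c (c {a, f}) {b, d} G1 \<psi>1"
          by (rule edge_copy[OF simple1, of b d c "c {a, f}"]) (use d(1) col in auto)
        obtain \<psi>2 where p2: "copy c (c {a, f}) {e, a, f} G2 \<psi>2"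
        proof (cases "n2 = 3")
          case n: True
          show ?thesis
            by (rule path_copy[OF conn2 n True, of e a f c "c {a, f}"], use d(1) col in auto) (rule that)
        next
          case False
          then have "n2 \<le> 2" using n23 by linarith
          then obtain \<psi> where "copy c (c {a, f}) {a, f} G2 \<psi>"
            by (rule edge_copy[OF simple2, of a f c "c {a, f}"]) (use d(1) in auto)
          from copy_mono[OF this, of "{e, a, f}"] show ?thesis using that by blast
        qed
        have "\<psi>1 ` verts G1 \<inter> \<psi>2 ` verts G2 = {}"
          using copyD(2)[OF p1] copyD(2)[OF p2] d(1) by auto
        then show False
          by (intro pair_freeD[OF free copy_mono[OF p1] copy_mono[OF p2]]) (simp_all add: d(2))
      next
        case 2
        show False by (rule pair_free_class[OF free c1 c2 dis, of "c {b, f}"]) (use 2 c'2 in blast)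
      next
        case 3
        show False by (rule pair_free_class[OF free c1 c2 dis, of "c {d, f}"]) (use 3 c'3 in blast)
      qed
    qed
    moreover have "range c' \<subseteq> {1, 2, 3}" unfolding c'_def by auto
    ultimately show ?thesis unfolding has_free_3_colouring_def by blast
  qed
qed

text \<open>Up to four vertices the absence of a rainbow path says nothing about \<open>c\<close>,
  so a colouring is written down directly. Only for \<open>n1 + n2 = 3\<close> is there none to
  find: any edge and any further vertex form a pair, against \<open>free\<close>.\<close>

lemma small_case:
  assumes fin: "finite V" and size: "n1 + n2 \<le> card V" and free: "pair_free c V" and V4: "card V \<le> 4"
  shows "has_free_3_colouring V"
proof -
  have n2: "2 \<le> n2" by (rule two_le_n2[OF fin size free])
  have n1pos: "1 \<le> n1" using n1_cases by auto
  consider "n1 = 1" "n2 = 2" | "n1 = 1" "n2 = 3" "card V = 4" | "n1 = 2" "n2 = 2" "card V = 4"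
    using n2 n1pos n1_le_n2 size V4 by linarith
  then show ?thesis
  proof cases
    case 1
    obtain X where X: "X \<subseteq> V" "card X = 3" using obtain_subset_with_card_n[of 3 V] size 1 by auto
    then obtain p q r where pqr: "X = {p, q, r}" "p \<noteq> q" "p \<noteq> r" "q \<noteq> r" by (auto simp: card_3_iff)
    obtain \<phi> where \<phi>: "copy c (c {p, q}) {p, q} G2 \<phi>"
      by (rule edge_copy[OF simple2, of p q c "c {p, q}"]) (use 1 pqr in auto)
    have "copy c (c {p, q}) V G1 (\<lambda>_. r)" by (rule trivial_copy[OF conn1 1(1)]) (use X pqr in auto)
    moreover have "copy c (c {p, q}) V G2 \<phi>" by (rule copy_mono[OF \<phi>]) (use X pqr in auto)
    moreover have "r \<notin> \<phi> ` verts G2" using copyD(2)[OF \<phi>] pqr by auto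
    ultimately have False using pair_freeD[OF free] by blast
    then show ?thesis ..
  next
    case 2
    obtain p where p: "p \<in> V" using 2(3) by fastforce
    have "card (V - {p}) = 3" using 2(3) p fin by simp
    then obtain q r s where qrs: "V - {p} = {q, r, s}" "q \<noteq> r" "q \<noteq> s" "r \<noteq> s" by (auto simp: card_3_iff)
    then have V: "V = {p, q, r, s}" using p by auto
    have pn: "p \<noteq> q" "p \<noteq> r" "p \<noteq> s" using qrs by auto
    \<comment> \<open>The new colours are the three perfect matchings of K4, none of which has room
      for a connected graph on three vertices.\<close>
    define pairing where "pairing m = (if m = 1 then {p, q} else if m = 2 then {p, r} else {p, s})" for m :: nat
    define c' where "c' e = (if \<forall>x\<in>e. \<forall>y\<in>e. x \<in> pairing 1 \<longleftrightarrow> y \<in> pairing 1 then 1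
        else if \<forall>x\<in>e. \<forall>y\<in>e. x \<in> pairing 2 \<longleftrightarrow> y \<in> pairing 2 then 2 else (3::nat))" for e
    have const: "x \<in> pairing m \<longleftrightarrow> y \<in> pairing m" if "x \<in> V" "y \<in> V" "x \<noteq> y" "c' {x, y} = m" for x y m
      using that qrs(2-4) pn unfolding V c'_def pairing_def by (auto split: if_splits)
    have "\<not> copy c' m V G2 \<phi>" for m \<phi>
    proof
      assume copy: "copy c' m V G2 \<phi>"
      obtain u where u: "u \<in> verts G2" using connected_graphD(3)[OF conn2] by blast
      have eq: "(x \<in> pairing m) = (\<phi> u \<in> pairing m)" if "x \<in> \<phi> ` verts G2" for x
        by (rule copy_const[OF conn2 copy const that]) (use u in auto)
      have pm: "pairing m \<subseteq> V" "card (pairing m) = 2" unfolding pairing_def V using pn by auto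
      then have "card (V - pairing m) = 2" using 2(3) fin by (simp add: card_Diff_subset finite_subset)
      moreover have "\<phi> ` verts G2 \<subseteq> pairing m \<or> \<phi> ` verts G2 \<subseteq> V - pairing m"
        using eq copyD(2)[OF copy] by (cases "\<phi> u \<in> pairing m") blast+
      ultimately have "card (\<phi> ` verts G2) \<le> 2"
        using pm fin card_mono[of "pairing m" "\<phi> ` verts G2"] card_mono[of "V - pairing m" "\<phi> ` verts G2"]
        by (auto intro: finite_subset)
      then show False using card_copy[OF copy] 2(2) by simp
    qed
    then have "pair_free c' V" unfolding pair_free_def by blast
    moreover have "range c' \<subseteq> {1, 2, 3}" unfolding c'_def by auto
    ultimately show ?thesis unfolding has_free_3_colouring_def by blast
  next
    case 3
    obtain s where s: "s \<in> V" using 3(3) by fastforce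
    \<comment> \<open>Of two disjoint edges covering \<open>V\<close> exactly one contains
      \<open>s\<close>, so they get different colours.\<close>
    define c' where "c' e = (if s \<in> e then 2 else (1::nat))" for e
    have "pair_free c' V"
      unfolding pair_free_def
    proof (intro notI, elim exE conjE)
      fix m \<phi>1 \<phi>2
      assume c1: "copy c' m V G1 \<phi>1" and c2: "copy c' m V G2 \<phi>2" and dis: "\<phi>1 ` verts G1 \<inter> \<phi>2 ` verts G2 = {}"
      have "card (\<phi>1 ` verts G1 \<union> \<phi>2 ` verts G2) = card V"
        using dis card_copy[OF c1] card_copy[OF c2] connected_graphD(2)[OF conn1] connected_graphD(2)[OF conn2] 3
        by (simp add: card_Un_disjoint)
      then have "\<phi>1 ` verts G1 \<union> \<phi>2 ` verts G2 = V"
        using card_subset_eq[OF fin] copyD(2)[OF c1] copyD(2)[OF c2] by (metis Un_least)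
      then have sV: "s \<in> \<phi>1 ` verts G1 \<or> s \<in> \<phi>2 ` verts G2" using s by blast
      have n1: "2 \<le> n1" using 3 by simp
      have two: "m = 2" if G: "connected_graph G" "2 \<le> card (verts G)" "copy c' m V G \<phi>" "s \<in> \<phi> ` verts G" for G :: "'z ugraph" and \<phi>
      proof -
        obtain y where "c' {s, y} = m" by (rule copy_vertex_edge[OF G])
        then show ?thesis unfolding c'_def by simp
      qed
      have one: "m = 1" if G: "connected_graph G" "2 \<le> card (verts G)" "copy c' m V G \<phi>" "s \<notin> \<phi> ` verts G" for G :: "'z ugraph" and \<phi>
      proof -
        obtain x y where "x \<in> \<phi> ` verts G" "y \<in> \<phi> ` verts G" "c' {x, y} = m" by (rule copy_edge[OF G(1-3)])
        then show ?thesis using G(4) unfolding c'_def by (auto split: if_splits)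
      qed
      from sV show False
      proof
        assume "s \<in> \<phi>1 ` verts G1"
        moreover from this have "s \<notin> \<phi>2 ` verts G2" using dis by blast
        ultimately show False using two[OF conn1 n1 c1] one[OF conn2 n2 c2] by simp
      next
        assume "s \<in> \<phi>2 ` verts G2"
        moreover from this have "s \<notin> \<phi>1 ` verts G1" using dis by blast
        ultimately show False using two[OF conn2 n2 c2] one[OF conn1 n1 c1] by simp
      qed
    qed
    moreover have "range c' \<subseteq> {1, 2, 3}" unfolding c'_def by auto
    ultimately show ?thesis unfolding has_free_3_colouring_def by blast
  qed
qed

theorem rainbow_P5_free_has_free_3_colouring:
  assumes fin: "finite V" and free: "pair_free c V"
    and rainbow: "\<And>p q r s t. distinct [p, q, r, s, t] \<Longrightarrow> {p, q, r, s, t} \<subseteq> V \<Longrightarrow>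
      \<not> distinct [c {p, q}, c {q, r}, c {r, s}, c {s, t}]"
  shows "has_free_3_colouring V"
proof -
  interpret rainbow_P5_free V "\<lambda>x y. c {x, y}"
  proof
    show "c {x, y} = c {y, x}" for x y by (simp add: insert_commute)
  qed (rule rainbow)
  show ?thesis
  proof (cases "card V < n1 + n2")
    case True
    then show ?thesis by (rule has_free_3_colouring_small[OF fin])
  next
    case False
    then have size: "n1 + n2 \<le> card V" by simp
    show ?thesis
    proof (cases "card V \<le> 4")
      case True
      then show ?thesis by (rule small_case[OF fin size free])
    next
      case False
      then have V5: "5 \<le> card V" by simp
      show ?thesis
      proof (cases "\<exists>p q r. \<forall>x\<in>V. \<forall>y\<in>V. x \<noteq> y \<longrightarrow> c {x, y} \<in> {p, q, r}")
        case True
        then obtain p q r where "\<forall>x\<in>V. \<forall>y\<in>V. x \<noteq> y \<longrightarrow> c {x, y} \<in> {p, q, r}" by blast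
        then show ?thesis by (intro three_colours[OF free, of p q r]) blast
      next
        case False
        have many: "\<exists>x\<in>V. \<exists>y\<in>V. x \<noteq> y \<and> c {x, y} \<notin> {p, q, r}" for p q r
        proof (rule ccontr)
          assume "\<not> ?thesis"
          then have "\<forall>x\<in>V. \<forall>y\<in>V. x \<noteq> y \<longrightarrow> c {x, y} \<in> {p, q, r}" by blast
          with False show False by blast
        qed
        consider i where "dominated_by i" | mono_off_vertex | triangle_type | K4_type | K5_type
          using rainbow_P5_free_structure[OF fin V5 many] by blast
        then show ?thesis
        proof cases
          case (1 i)
          \<comment> \<open>Domination makes the colour \<open>c {x, nb x}\<close> independent of
            the neighbour chosen; a vertex all of whose edges have colour \<open>i\<close> gets the
            default label \<open>i\<close>.\<close>
          define nb where "nb x = (SOME y. y \<in> V \<and> y \<noteq> x \<and> c {x, y} \<noteq> i)" for x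
          define L where "L x = (if \<exists>y\<in>V. y \<noteq> x \<and> c {x, y} \<noteq> i then c {x, nb x} else i)" for x
          have L: "L x = c {x, y}" if xy: "x \<in> V" "y \<in> V" "x \<noteq> y" "c {x, y} \<noteq> i" for x y
          proof -
            have nb: "nb x \<in> V \<and> nb x \<noteq> x \<and> c {x, nb x} \<noteq> i"
              unfolding nb_def by (rule someI[of _ y]) (use xy in simp)
            have "\<exists>y\<in>V. y \<noteq> x \<and> c {x, y} \<noteq> i" by (rule bexI[of _ y]) (use xy in simp_all)
            then have "L x = c {x, nb x}" unfolding L_def by simp
            moreover have "c {x, nb x} = c {x, y}"
            proof (cases "y = nb x")
              case False
              then have "distinct [nb x, x, y]" using nb xy(3) by simp
              with 1 nb xy(1,2) have "c {nb x, x} = i \<or> c {x, y} = i \<or> c {nb x, x} = c {x, y}"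
                unfolding dominated_by_def by blast
              then show ?thesis using nb xy(4) by (simp add: insert_commute)
            qed simp
            ultimately show ?thesis by simp
          qed
          have dom: "c {x, y} = i \<or> c {x, y} = L x \<and> L x = L y" if xy: "x \<in> V" "y \<in> V" "x \<noteq> y" for x y
          proof (cases "c {x, y} = i")
            case False
            moreover from this have "c {y, x} \<noteq> i" by (simp add: insert_commute)
            ultimately have "L x = c {x, y}" "L y = c {y, x}"
              using L[OF xy] L[OF xy(2,1) xy(3)[symmetric]] by blast+
            then show ?thesis by (simp add: insert_commute)
          qed simp
          interpret dominated_colouring G1 G2 emb V c i L
            by unfold_locales (fact fin dom free size)+
          show ?thesis by (rule dominated_has_free_3_colouring)
        next
          case 2
          then obtain a i where "a \<in> V" "\<forall>x\<in>V - {a}. \<forall>y\<in>V - {a}. x \<noteq> y \<longrightarrow> c {x, y} = i"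
            unfolding mono_off_vertex_def by blast
          then show ?thesis by (intro mono_off_vertex_case[OF fin size free, of a i]) simp_all
        next
          case 3
          then obtain a b d i where t: "distinct [a, b, d]" "{a, b, d} \<subseteq> V" "distinct [c {a, b}, c {a, d}, c {b, d}, i]"
            "\<forall>x\<in>V - {a, b, d}. c {a, x} \<in> {i, c {b, d}} \<and> c {b, x} = i \<and> c {d, x} = i \<and>
              (\<forall>y\<in>V - {a, b, d}. x \<noteq> y \<longrightarrow> c {x, y} = i)"
            unfolding triangle_type_def by (elim exE conjE)
          show ?thesis
            by (rule triangle_case[OF fin size free V5 t(1-3)]) (use bspec[OF t(4)] in simp_all)
        next
          case 4
          then obtain a b d e i j k l where t: "distinct [a, b, d, e]" "{a, b, d, e} \<subseteq> V" "distinct [i, j, k, l]"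
            "c {a, b} \<in> {i, j}" "c {d, e} \<in> {i, j}" "c {a, d} \<in> {i, k}" "c {b, e} \<in> {i, k}"
            "c {a, e} \<in> {i, l}" "c {b, d} \<in> {i, l}" "\<forall>x\<in>V - {a, b, d, e}. \<forall>y\<in>V. x \<noteq> y \<longrightarrow> c {x, y} = i"
            unfolding K4_type_def by (elim exE conjE)
          show ?thesis
            by (rule K4_case[OF fin size free V5 t(1-9)]) (use bspec[OF t(10)] in simp)
        next
          case 5
          then obtain a b d e f where "distinct [a, b, d, e, f]" "V = {a, b, d, e, f}"
            "c {a, e} = c {a, f}" "c {b, d} = c {a, f}" "c {b, e} = c {b, f}" "c {a, d} = c {b, f}"
            "c {d, e} = c {d, f}" "c {a, b} = c {d, f}" "distinct [c {a, f}, c {b, f}, c {d, f}, c {e, f}]"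
            unfolding K5_type_def by (elim exE conjE)
          then show ?thesis by (rule K5_case[OF size free])
        qed
      qed
    qed
  qed
qed

section \<open>Comparison of the Ramsey numbers\<close>

text \<open>A copy of the union restricts along \<open>Inl\<close> and \<open>Inr\<close>, and
  \<open>case_sum\<close> glues disjoint copies together again. \<open>copy\<close> only speaks of
  edges of the form \<open>{u, v}\<close>; simplicity of the graphs makes these all the
  edges.\<close>

lemma has_monochromatic_iff:
  "has_monochromatic n c (disjoint_union G1 G2) \<longleftrightarrow> \<not> pair_free c {..<n}"
proof
  assume "has_monochromatic n c (disjoint_union G1 G2)"
  then obtain \<phi> i where \<phi>: "embedding \<phi> (disjoint_union G1 G2) (complete_graph n)"
    and i: "\<And>e. e \<in> edges (disjoint_union G1 G2) \<Longrightarrow> c (\<phi> ` e) = i"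
    unfolding has_monochromatic_def by blast
  have inj: "inj_on \<phi> (verts G1 <+> verts G2)" and img: "\<phi> ` (verts G1 <+> verts G2) \<subseteq> {..<n}"
    using \<phi> unfolding embedding_def disjoint_union_def complete_graph_def by auto
  have "c {\<phi> (Inl u), \<phi> (Inl v)} = i" if "{u, v} \<in> edges G1" for u v
  proof -
    have "Inl ` {u, v} \<in> edges (disjoint_union G1 G2)"
      unfolding disjoint_union_def snd_conv by (rule UnI1, rule imageI, rule that)
    from i[OF this] show ?thesis by simp
  qed
  then have "copy c i {..<n} G1 (\<phi> \<circ> Inl)"
    using inj img unfolding copy_def by (auto simp: inj_on_def image_subset_iff)
  moreover have "c {\<phi> (Inr u), \<phi> (Inr v)} = i" if "{u, v} \<in> edges G2" for u v
  proof -
    have "Inr ` {u, v} \<in> edges (disjoint_union G1 G2)"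
      unfolding disjoint_union_def snd_conv by (rule UnI2, rule imageI, rule that)
    from i[OF this] show ?thesis by simp
  qed
  then have "copy c i {..<n} G2 (\<phi> \<circ> Inr)"
    using inj img unfolding copy_def by (auto simp: inj_on_def image_subset_iff)
  moreover have "(\<phi> \<circ> Inl) ` verts G1 \<inter> (\<phi> \<circ> Inr) ` verts G2 = {}"
    using inj by (auto simp: inj_on_def)
  ultimately show "\<not> pair_free c {..<n}" unfolding pair_free_def by blast
next
  assume "\<not> pair_free c {..<n}"
  then obtain i \<phi>1 \<phi>2 where c1: "copy c i {..<n} G1 \<phi>1" and c2: "copy c i {..<n} G2 \<phi>2"
    and dis: "\<phi>1 ` verts G1 \<inter> \<phi>2 ` verts G2 = {}"
    unfolding pair_free_def by blast
  define \<phi> where "\<phi> = case_sum \<phi>1 \<phi>2"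
  have \<phi>_simps: "\<phi> (Inl u) = \<phi>1 u" "\<phi> (Inr v) = \<phi>2 v" for u v unfolding \<phi>_def by simp_all
  have ne: "\<phi>1 u \<noteq> \<phi>2 v" "\<phi>2 v \<noteq> \<phi>1 u" if "u \<in> verts G1" "v \<in> verts G2" for u v using dis that by blast+
  have inj: "inj_on \<phi> (verts G1 <+> verts G2)"
  proof (rule inj_onI)
    fix x y assume "x \<in> verts G1 <+> verts G2" "y \<in> verts G1 <+> verts G2" "\<phi> x = \<phi> y"
    then show "x = y"
      using inj_onD[OF copyD(1)[OF c1]] inj_onD[OF copyD(1)[OF c2]] ne
      by (elim PlusE) (simp_all add: \<phi>_simps)
  qed
  have img: "\<phi> ` (verts G1 <+> verts G2) \<subseteq> {..<n}"
    using copyD(2)[OF c1] copyD(2)[OF c2] by (auto simp: \<phi>_simps image_subset_iff)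
  have edge: "c (\<phi> ` e) = i \<and> \<phi> ` e \<in> nsets {..<n} 2" if e: "e \<in> edges (disjoint_union G1 G2)" for e
  proof -
    obtain u v where uv: "\<phi> ` e = {\<phi> u, \<phi> v}" "u \<in> verts G1 <+> verts G2" "v \<in> verts G1 <+> verts G2" "u \<noteq> v"
      "c {\<phi> u, \<phi> v} = i"
    proof -
      consider e' where "e' \<in> edges G1" "e = Inl ` e'" | e' where "e' \<in> edges G2" "e = Inr ` e'"
        using e unfolding disjoint_union_def by auto
      then show ?thesis
      proof cases
        case (1 e')
        obtain u v where "e' = {u, v}" "u \<in> verts G1" "v \<in> verts G1" "u \<noteq> v" by (rule simple_graph_edgeE[OF simple1 1(1)])
        then show ?thesis using that[of "Inl u" "Inl v"] 1 copyD(3)[OF c1, of u v] by (simp add: \<phi>_simps InlI)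
      next
        case (2 e')
        obtain u v where "e' = {u, v}" "u \<in> verts G2" "v \<in> verts G2" "u \<noteq> v" by (rule simple_graph_edgeE[OF simple2 2(1)])
        then show ?thesis using that[of "Inr u" "Inr v"] 2 copyD(3)[OF c2, of u v] by (simp add: \<phi>_simps InrI)
      qed
    qed
    have "\<phi> u \<noteq> \<phi> v" using inj uv(2-4) unfolding inj_on_def by blast
    moreover have "\<phi> u \<in> {..<n}" "\<phi> v \<in> {..<n}" using img uv(2,3) by blast+
    ultimately show ?thesis using uv(1,5) by (auto simp: nsets_def)
  qed
  have "embedding \<phi> (disjoint_union G1 G2) (complete_graph n)"
    unfolding embedding_def
  proof (intro conjI ballI)
    show "inj_on \<phi> (verts (disjoint_union G1 G2))" using inj unfolding disjoint_union_def by simp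
    show "\<phi> ` verts (disjoint_union G1 G2) \<subseteq> verts (complete_graph n)"
      using img unfolding disjoint_union_def complete_graph_def by simp
    show "\<phi> ` e \<in> edges (complete_graph n)" if "e \<in> edges (disjoint_union G1 G2)" for e
      using edge[OF that] unfolding complete_graph_def by simp
  qed
  then show "has_monochromatic n c (disjoint_union G1 G2)"
    unfolding has_monochromatic_def using edge by blast
qed

end

lemma edges_path_graph_5: "edges (path_graph 5) = {{0, 1}, {1, 2}, {2, 3}, {3, 4}}"
proof -
  have "{{i, Suc i} |i. Suc i < 5} = (\<lambda>i. {i, Suc i}) ` {..<4}" by auto
  also have "\<dots> = {{0, 1}, {1, 2}, {2, 3}, {3, 4}}"
    by (simp add: numeral_eq_Suc lessThan_Suc insert_commute)
  finally show ?thesis unfolding path_graph_def by simp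
qed

lemma has_rainbow_path5:
  assumes d: "distinct [p, q, r, s, t]" and V: "{p, q, r, s, t} \<subseteq> {..<n}"
    and col: "distinct [c {p, q}, c {q, r}, c {r, s}, c {s, t}]"
  shows "has_rainbow n c (path_graph 5)"
proof -
  define \<phi> where "\<phi> i = [p, q, r, s, t] ! i" for i
  have ev: "\<phi> 0 = p" "\<phi> 1 = q" "\<phi> (Suc 0) = q" "\<phi> 2 = r" "\<phi> 3 = s" "\<phi> 4 = t" unfolding \<phi>_def by simp_all
  have v5: "verts (path_graph 5) = {0, 1, 2, 3, 4}"
    unfolding path_graph_def by auto
  have "inj_on \<phi> (verts (path_graph 5))"
    unfolding \<phi>_def by (rule inj_on_nth[OF d]) (simp add: v5)
  moreover have "\<phi> ` verts (path_graph 5) \<subseteq> verts (complete_graph n)"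
    using V by (simp add: v5 ev complete_graph_def)
  moreover have "\<forall>e\<in>edges (path_graph 5). \<phi> ` e \<in> edges (complete_graph n)"
    using V d by (simp add: edges_path_graph_5 ev complete_graph_def nsets_def)
  moreover have "inj_on (\<lambda>e. c (\<phi> ` e)) (edges (path_graph 5))"
    using col by (simp add: edges_path_graph_5 inj_on_def ev eq_commute[of "c {q, r}" "c {p, q}"]
        eq_commute[of "c {r, s}" "c {p, q}"] eq_commute[of "c {r, s}" "c {q, r}"] eq_commute[of "c {s, t}"])
  ultimately show ?thesis
    unfolding has_rainbow_def embedding_def by blast
qed

lemma three_colours_no_rainbow_path5:
  assumes "c ` edges (complete_graph n) \<subseteq> {1..3}"
  shows "\<not> has_rainbow n c (path_graph 5)"
proof
  assume "has_rainbow n c (path_graph 5)"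
  then obtain \<phi> where \<phi>: "embedding \<phi> (path_graph 5) (complete_graph n)" "inj_on (\<lambda>e. c (\<phi> ` e)) (edges (path_graph 5))"
    unfolding has_rainbow_def by blast
  have "(\<lambda>e. c (\<phi> ` e)) ` edges (path_graph 5) \<subseteq> {1..3}"
    using \<phi>(1) assms unfolding embedding_def by blast
  then have "card (edges (path_graph 5)) \<le> card {1..3 :: nat}"
    using card_inj_on_le[OF \<phi>(2)] by blast
  moreover have "card (edges (path_graph 5)) = 4"
    unfolding edges_path_graph_5 by (simp add: doubleton_eq_iff card_insert_if)
  ultimately show False by simp
qed

theorem theorem1p7:
  fixes G1 :: "'a ugraph" and G2 :: "'b ugraph"
  assumes "connected_graph G1" and "connected_graph G2"
    and "is_subgraph G1 G2"
  shows "constrained_ramsey (disjoint_union G1 G2) (path_graph 5)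
           = multicolor_ramsey 3 (disjoint_union G1 G2)"
proof -
  obtain emb where emb: "embedding emb G1 G2" using assms(3) unfolding is_subgraph_def by blast
  interpret graph_pair G1 G2 emb by unfold_locales (fact assms(1) assms(2) emb)+
  have "(\<forall>c :: nat set \<Rightarrow> nat. has_monochromatic n c (disjoint_union G1 G2) \<or> has_rainbow n c (path_graph 5)) \<longleftrightarrow>
      (\<forall>c :: nat set \<Rightarrow> nat. c ` edges (complete_graph n) \<subseteq> {1..3} \<longrightarrow> has_monochromatic n c (disjoint_union G1 G2))"
    (is "?L \<longleftrightarrow> ?R") for n
  proof
    assume ?L
    then show ?R using three_colours_no_rainbow_path5 by blast
  next
    assume R: ?R
    show ?L
    proof (rule ccontr)
      assume "\<not> ?L"
      then obtain c :: "nat set \<Rightarrow> nat" where c: "pair_free c {..<n}" "\<not> has_rainbow n c (path_graph 5)"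
        unfolding has_monochromatic_iff by blast
      have "has_free_3_colouring {..<n}"
      proof (rule rainbow_P5_free_has_free_3_colouring[OF _ c(1)])
        show "\<not> distinct [c {p, q}, c {q, r}, c {r, s}, c {s, t}]"
          if "distinct [p, q, r, s, t]" "{p, q, r, s, t} \<subseteq> {..<n}" for p q r s t
          using has_rainbow_path5[OF that] c(2) by blast
      qed simp
      then obtain c' :: "nat set \<Rightarrow> nat" where c': "range c' \<subseteq> {1, 2, 3}" "pair_free c' {..<n}"
        unfolding has_free_3_colouring_def by blast
      have "c' e \<in> {1..3}" for e using subsetD[OF c'(1), of "c' e"] by auto
      then have "c' ` edges (complete_graph n) \<subseteq> {1..3}" by blast
      then show False using R c'(2) unfolding has_monochromatic_iff by blast
    qed
  qed
  then show ?thesis unfolding constrained_ramsey_def multicolor_ramsey_def by simp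
qed

end
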